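(* Assume (A0)–(A3) as in the context, $r>-1$, and that (M$_p$) holds for some $p>\max\{2,1+r\}$. Then for any $\varepsilon>0$, for all $x$ sufficiently large, $$x^{-\frac{1+r}{2}}(\log x)^{-\varepsilon}\le\mathbb{P}[\eta_1\ge x]\le x^{-\frac{1+r}{2}}(\log x)^{2+r+\varepsilon}.$$ In particular $\mathbb{E}[\eta_1^{(1+r)/2}]=\infty$ but $\mathbb{E}[\eta_1^{(1+r)/2-\varepsilon}]<\infty$ for every $\varepsilon>0$.
   Context: $\mathbb{N}=\{1,2,\dots\}$. (A0): $\mathbb{S}$ is a locally finite (every bounded set meets it in finitely many points), unbounded subset of $[0,\infty)$ with $0\in\mathbb{S}$; $(X_t)_{t\in\mathbb{N}}$ is an $\mathbb{S}$-valued process adapted to a filtration $(\mathcal{F}_t)_{t\in\mathbb{N}}$ with $\mathbb{P}[X_1=0]=1$. (A1): for each $x,y\in\mathbb{S}$ there exist $m(x,y)\in\mathbb{N}$, $\varphi(x,y)>0$ with $\mathbb{P}[X_{t+m(X_t,y)}=y\mid\mathcal{F}_t]\ge\varphi(X_t,y)$ a.s. for all $t$. Write $\Delta_t:=X_{t+1}-X_t$. (A2): there are $c\in\mathbb{R}$, $s^2\in(0,\infty)$ with, as $X_t\to\infty$, $\mathbb{E}[\Delta_t\mid\mathcal{F}_t]=cX_t^{-1}+o(X_t^{-1}(\log X_t)^{-1})$ and $\mathbb{E}[\Delta_t^2\mid\mathcal{F}_t]=s^2+o((\log X_t)^{-1})$ a.s., where the implicit constants in $o(\cdot)$ are non-random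 and uniform in $t$ and in the sample point. Set $r:=-2c/s^2$. Excursions: $\tau_0:=1$, $\tau_n:=\min\{t>\tau_{n-1}:X_t=0\}$ ($\min\emptyset=\infty$), $\eta_n:=\tau_n-\tau_{n-1}$, $\mathcal{E}_n:=(X_t)_{\tau_{n-1}\le t\le\tau_n-1}$, $N:=\min\{n\in\mathbb{N}:\tau_n=\infty\}$. (A3): (a) on $\{N=\infty\}$, $(\mathcal{E}_n)_{n\in\mathbb{N}}$ is i.i.d.; (b) $\mathbb{P}[\eta_{n+1}<\infty\mid\tau_n<\infty]=\mathbb{P}[\eta_1<\infty]$ for all $n$. (M$_p$): there exist $\delta>0$, $C<\infty$ with $\mathbb{E}[|\Delta_t|^p\mid\mathcal{F}_t]\le C(1+X_t)^{p-2-\delta}$ a.s. for all $t$. *)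

theory Defs
  imports "HOL-Probability.Probability"
begin

text \<open>Return times to 0. Times are indexed by positive naturals; the value \<infinity> encodes min of the empty set.
  tau X 0 = 1, tau X (n+1) = min {t > tau X n. X t = 0}.\<close>
fun ret_time :: "(nat \<Rightarrow> 'a \<Rightarrow> real) \<Rightarrow> nat \<Rightarrow> 'a \<Rightarrow> enat" where
  "ret_time X 0 \<omega> = enat 1"
| "ret_time X (Suc n) \<omega> =
     (case ret_time X n \<omega> of
        \<infinity> \<Rightarrow> \<infinity>
      | enat k \<Rightarrow> (if \<exists>t>k. X t \<omega> = 0 then enat (LEAST t. t > k \<and> X t \<omega> = 0) else \<infinity>))"

definition exc_length :: "(nat \<Rightarrow> 'a \<Rightarrow> real) \<Rightarrow> nat \<Rightarrow> 'a \<Rightarrow> enat" where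
  "exc_length X n \<omega> = ret_time X n \<omega> - ret_time X (n - 1) \<omega>"

text \<open>Excursion E_n = (X_t) for tau_(n-1) <= t <= tau_n - 1 (a finite list when both times are finite;
  only used on the event that all return times are finite).\<close>
definition excursion :: "(nat \<Rightarrow> 'a \<Rightarrow> real) \<Rightarrow> nat \<Rightarrow> 'a \<Rightarrow> real list" where
  "excursion X n \<omega> =
     map (\<lambda>t. X t \<omega>) [the_enat (ret_time X (n - 1) \<omega>) ..< the_enat (ret_time X n \<omega>)]"

definition N_infinite :: "(nat \<Rightarrow> 'a \<Rightarrow> real) \<Rightarrow> 'a measure \<Rightarrow> 'a set" where
  "N_infinite X M = {\<omega> \<in> space M. \<forall>n. ret_time X n \<omega> \<noteq> \<infinity>}"

definition incr :: "(nat \<Rightarrow> 'a \<Rightarrow> real) \<Rightarrow> nat \<Rightarrow> 'a \<Rightarrow> real" where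
  "incr X t \<omega> = X (Suc t) \<omega> - X t \<omega>"

definition enat_powr :: "enat \<Rightarrow> real \<Rightarrow> ennreal" where
  "enat_powr k a = (case k of enat m \<Rightarrow> ennreal (real m powr a) | \<infinity> \<Rightarrow> \<infinity>)"

end

theory Submission
  imports Defs "HOL-Real_Asymp.Real_Asymp"
begin

text \<open>
  For \<open>f(x) = x\<^sup>a (log x)\<^sup>g\<close> the conditional drift of \<open>f(X\<^sub>t)\<close> at a large level \<open>x\<close> is
  \<open>(s\<^sup>2/2) x\<^bsup>a-2\<^esup> (log x)\<^bsup>g-1\<^esup>\<close> times
  \<open>a (a - 1 - r) log x + g (2a - 1 - r)\<close>, up to smaller terms. For \<open>a = 1 + r\<close> the process
  \<open>f(X\<^sub>t)\<close> is thus a supermartingale (\<open>g < 0\<close>) or a submartingale (\<open>g > 0\<close>) away from a bounded set,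
  and irreducibility bounds the expected time that an excursion spends in that set. Hence an
  excursion exceeds \<open>y\<close> with probability \<open>y\<^bsup>-(1+r)\<^esup>\<close> up to small powers of \<open>log y\<close>.

  Upper tail: with \<open>a = min (1 + r) 2\<close> and \<open>g = -1\<close> the same function shows that an excursion
  staying below \<open>y\<close> dies within \<open>O(y\<^sup>2 log y)\<close> steps with probability at least one half, whatever
  happened before; take \<open>y\<close> slightly smaller than \<open>\<surd>x / log x\<close>.

  Lower tail: after exceeding \<open>y\<close>, the process needs of order \<open>y\<^sup>2\<close> steps to come down to \<open>y/2\<close>, with
  probability at least one half; take \<open>y\<close> of order \<open>\<surd>x\<close>. That the first excursion reaches high
  levels with positive probability follows from recurrence and from the equidistribution of the excursions.
\<close>

section \<open>Powers times powers of the logarithm\<close>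

definition plog :: "real \<Rightarrow> real \<Rightarrow> real \<Rightarrow> real" where
  "plog a g x = x powr a * ln x powr g"

lemma plog_measurable [measurable]: "plog a g \<in> borel_measurable borel"
  unfolding plog_def by measurable

lemma plog_nonneg [simp]: "0 \<le> plog a g x"
  by (simp add: plog_def)

lemma plog_pos: "1 < x \<Longrightarrow> 0 < plog a g x"
  by (simp add: plog_def)

lemma plog_has_derivative:
  assumes "1 < x"
  shows "(plog a g has_real_derivative a * plog (a - 1) g x + g * plog (a - 1) (g - 1) x) (at x)"
proof -
  have "((\<lambda>x. x powr a * ln x powr g) has_real_derivative
      a * plog (a - 1) g x + g * plog (a - 1) (g - 1) x) (at x)"
    using assms
    by (auto intro!: derivative_eq_intros simp: plog_def powr_diff field_simps)
  then show ?thesis by (simp add: plog_def [abs_def])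
qed

definition plog1 :: "real \<Rightarrow> real \<Rightarrow> real \<Rightarrow> real" where
  "plog1 a g x = a * plog (a - 1) g x + g * plog (a - 1) (g - 1) x"

definition plog2 :: "real \<Rightarrow> real \<Rightarrow> real \<Rightarrow> real" where
  "plog2 a g x = a * plog1 (a - 1) g x + g * plog1 (a - 1) (g - 1) x"

definition plog3 :: "real \<Rightarrow> real \<Rightarrow> real \<Rightarrow> real" where
  "plog3 a g x = a * plog2 (a - 1) g x + g * plog2 (a - 1) (g - 1) x"

lemma plog_has_derivative1: "1 < x \<Longrightarrow> (plog a g has_real_derivative plog1 a g x) (at x)"
  unfolding plog1_def by (rule plog_has_derivative)

lemma plog1_has_derivative:
  assumes "1 < x" shows "(plog1 a g has_real_derivative plog2 a g x) (at x)"
proof -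
  have "plog1 a g = (\<lambda>x. a * plog (a - 1) g x + g * plog (a - 1) (g - 1) x)"
    by (simp add: plog1_def fun_eq_iff)
  then show ?thesis
    unfolding plog2_def using assms
    by (auto intro!: derivative_eq_intros plog_has_derivative1)
qed

lemma plog2_has_derivative:
  assumes "1 < x" shows "(plog2 a g has_real_derivative plog3 a g x) (at x)"
proof -
  have "plog2 a g = (\<lambda>x. a * plog1 (a - 1) g x + g * plog1 (a - 1) (g - 1) x)"
    by (simp add: plog2_def fun_eq_iff)
  then show ?thesis
    unfolding plog3_def using assms
    by (auto intro!: derivative_eq_intros plog1_has_derivative)
qed

lemma plog_le_powr:
  assumes "0 < h" shows "\<forall>\<^sub>F x in at_top. plog a g x \<le> x powr (a + h)"
  unfolding plog_def using assms by real_asymp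

lemma plog1_le_powr:
  assumes "0 < h" shows "\<exists>C>0. \<forall>\<^sub>F x in at_top. \<bar>plog1 a g x\<bar> \<le> C * x powr (a - 1 + h)"
proof (intro exI conjI)
  show "0 < \<bar>a\<bar> + \<bar>g\<bar> + 1" by simp
  show "\<forall>\<^sub>F x in at_top. \<bar>plog1 a g x\<bar> \<le> (\<bar>a\<bar> + \<bar>g\<bar> + 1) * x powr (a - 1 + h)"
    using plog_le_powr [OF assms, of "a - 1" g] plog_le_powr [OF assms, of "a - 1" "g - 1"]
  proof eventually_elim
    case (elim x)
    have "\<bar>plog1 a g x\<bar> \<le> \<bar>a\<bar> * plog (a - 1) g x + \<bar>g\<bar> * plog (a - 1) (g - 1) x"
      unfolding plog1_def by (rule order_trans [OF abs_triangle_ineq]) (simp add: abs_mult)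
    also have "\<dots> \<le> \<bar>a\<bar> * x powr (a - 1 + h) + \<bar>g\<bar> * x powr (a - 1 + h)"
      using elim by (intro add_mono mult_left_mono) auto
    also have "\<dots> \<le> (\<bar>a\<bar> + \<bar>g\<bar> + 1) * x powr (a - 1 + h)"
      by (simp add: algebra_simps)
    finally show ?case .
  qed
qed

lemma comb_le_powr:
  assumes "\<forall>\<^sub>F x in at_top. \<bar>u x\<bar> \<le> C * x powr e" "\<forall>\<^sub>F x in at_top. \<bar>v x\<bar> \<le> D * x powr e"
  shows "\<forall>\<^sub>F x in at_top. \<bar>a * u x + g * v x\<bar> \<le> (\<bar>a\<bar> * C + \<bar>g\<bar> * D) * (x :: real) powr e"
  using assms
proof eventually_elim
  case (elim x)
  have "\<bar>a * u x + g * v x\<bar> \<le> \<bar>a\<bar> * \<bar>u x\<bar> + \<bar>g\<bar> * \<bar>v x\<bar>"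
    by (rule order_trans [OF abs_triangle_ineq]) (simp add: abs_mult)
  also have "\<dots> \<le> \<bar>a\<bar> * (C * x powr e) + \<bar>g\<bar> * (D * x powr e)"
    using elim by (intro add_mono mult_left_mono) auto
  finally show ?case by (simp add: algebra_simps)
qed

lemma plog2_le_powr:
  assumes "0 < h" shows "\<exists>C. \<forall>\<^sub>F x in at_top. \<bar>plog2 a g x\<bar> \<le> C * x powr (a - 2 + h)"
proof -
  obtain C D where "\<forall>\<^sub>F x in at_top. \<bar>plog1 (a - 1) g x\<bar> \<le> C * x powr (a - 1 - 1 + h)"
      "\<forall>\<^sub>F x in at_top. \<bar>plog1 (a - 1) (g - 1) x\<bar> \<le> D * x powr (a - 1 - 1 + h)"
    using plog1_le_powr [OF assms, of "a - 1"] by meson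
  from comb_le_powr [OF this, of a g]
  have "\<forall>\<^sub>F x in at_top. \<bar>plog2 a g x\<bar> \<le> (\<bar>a\<bar> * C + \<bar>g\<bar> * D) * x powr (a - 2 + h)"
    by (simp add: plog2_def)
  then show ?thesis by blast
qed

lemma plog3_le_powr:
  assumes "0 < h" shows "\<exists>C. \<forall>\<^sub>F x in at_top. \<bar>plog3 a g x\<bar> \<le> C * x powr (a - 3 + h)"
proof -
  obtain C D where "\<forall>\<^sub>F x in at_top. \<bar>plog2 (a - 1) g x\<bar> \<le> C * x powr (a - 1 - 2 + h)"
      "\<forall>\<^sub>F x in at_top. \<bar>plog2 (a - 1) (g - 1) x\<bar> \<le> D * x powr (a - 1 - 2 + h)"
    using plog2_le_powr [OF assms, of "a - 1"] by meson
  from comb_le_powr [OF this, of a g]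
  have "\<forall>\<^sub>F x in at_top. \<bar>plog3 a g x\<bar> \<le> (\<bar>a\<bar> * C + \<bar>g\<bar> * D) * x powr (a - 3 + h)"
    by (simp add: plog3_def)
  then show ?thesis by blast
qed

lemma powr_near:
  fixes x t q :: real
  assumes "0 < x" "x / 2 \<le> t" "t \<le> 3 * x / 2"
  shows "t powr q \<le> 2 powr \<bar>q\<bar> * x powr q"
proof (cases "q \<ge> 0")
  case True
  have "t powr q \<le> (2 * x) powr q" using assms True by (intro powr_mono2) auto
  then show ?thesis using assms True by (simp add: powr_mult)
next
  case False
  have "t powr q \<le> (x / 2) powr q" using assms False by (intro powr_mono2') auto
  then show ?thesis using assms False by (simp add: powr_divide powr_minus field_simps)
qed

lemma plog_taylor:
  assumes "0 < h"
  shows "\<exists>C\<ge>0. \<forall>\<^sub>F x in at_top. \<forall>d. \<bar>d\<bar> \<le> x / 2 \<longrightarrow>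
    \<bar>plog a g (x + d) - plog a g x - plog1 a g x * d - plog2 a g x / 2 * d\<^sup>2\<bar>
      \<le> C * x powr (a - 3 + h) * \<bar>d\<bar> ^ 3"
    (is "\<exists>C\<ge>0. ?P C")
proof -
  obtain C0 t0 where C0: "\<And>x. x \<ge> t0 \<Longrightarrow> \<bar>plog3 a g x\<bar> \<le> C0 * x powr (a - 3 + h)"
    using plog3_le_powr [OF assms, of a g] unfolding eventually_at_top_linorder by blast
  define C where "C = \<bar>C0\<bar> * 2 powr \<bar>a - 3 + h\<bar>"
  have "?P C"
    using eventually_ge_at_top [of "2 * \<bar>t0\<bar> + 3"]
  proof eventually_elim
    case (elim x)
    show ?case
    proof (intro allI impI)
      fix d assume d: "\<bar>d\<bar> \<le> x / 2"
      show "\<bar>plog a g (x + d) - plog a g x - plog1 a g x * d - plog2 a g x / 2 * d\<^sup>2\<bar>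
        \<le> C * x powr (a - 3 + h) * \<bar>d\<bar> ^ 3"
      proof (cases "d = 0")
        case False
        let ?diff = "\<lambda>n :: nat. if n = 0 then plog a g else if n = 1 then plog1 a g
            else if n = 2 then plog2 a g else plog3 a g"
        have ders: "\<forall>m t. m < 3 \<and> x / 2 \<le> t \<and> t \<le> 3 * x / 2 \<longrightarrow> DERIV (?diff m) t :> ?diff (Suc m) t"
        proof (intro allI impI)
          fix m :: nat and t assume h: "m < 3 \<and> x / 2 \<le> t \<and> t \<le> 3 * x / 2"
          then have "1 < t" "m = 0 \<or> m = 1 \<or> m = 2" using elim by auto
          then show "DERIV (?diff m) t :> ?diff (Suc m) t"
            using plog_has_derivative1 plog1_has_derivative plog2_has_derivative by auto
        qed
        have ex: "\<exists>t. (if x + d < x then x + d < t \<and> t < x else x < t \<and> t < x + d) \<and>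
          plog a g (x + d) = (\<Sum>m<3. ?diff m x / fact m * (x + d - x) ^ m) +
            ?diff 3 t / fact 3 * (x + d - x) ^ 3"
          by (rule Taylor [where a = "x / 2" and b = "3 * x / 2" and diff = ?diff, OF _ _ ders])
            (use elim d False in \<open>auto simp: abs_le_iff\<close>)
        then obtain t where t: "(if x + d < x then x + d < t \<and> t < x else x < t \<and> t < x + d)"
          "plog a g (x + d) = (\<Sum>m<3. ?diff m x / fact m * (x + d - x) ^ m) +
            ?diff 3 t / fact 3 * (x + d - x) ^ 3" by blast
        have tb: "x / 2 \<le> t" "t \<le> 3 * x / 2" using t(1) d by (auto split: if_splits)
        have "plog a g (x + d) = plog a g x + plog1 a g x * d + plog2 a g x / 2 * d\<^sup>2 + plog3 a g t / 6 * d ^ 3"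
          using t(2) by (simp add: numeral_3_eq_3 fact_numeral numeral_2_eq_2)
        then have "\<bar>plog a g (x + d) - plog a g x - plog1 a g x * d - plog2 a g x / 2 * d\<^sup>2\<bar>
            = \<bar>plog3 a g t\<bar> / 6 * \<bar>d\<bar> ^ 3"
          by (simp add: abs_mult power_abs)
        also have "\<dots> \<le> \<bar>plog3 a g t\<bar> * \<bar>d\<bar> ^ 3"
          by (intro mult_right_mono) auto
        also have "\<bar>plog3 a g t\<bar> \<le> \<bar>C0\<bar> * t powr (a - 3 + h)"
          using C0 [of t] tb elim
          by (smt (verit, best) field_sum_of_halves mult_right_mono powr_ge_zero)
        also have "\<dots> \<le> C * x powr (a - 3 + h)"
          unfolding C_def mult.assoc using tb elim by (intro mult_left_mono powr_near) auto
        finally show ?thesis by (simp add: mult_right_mono)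
      qed auto
    qed
  qed
  moreover have "C \<ge> 0" by (simp add: C_def)
  ultimately show ?thesis by blast
qed

text \<open>\<open>G\<close> is only assumed to agree with \<open>plog a g\<close> near \<open>x\<close>, which makes the estimate uniform over
  truncations of \<open>plog a g\<close> at low and at high levels. Jumps beyond \<open>x\<close> to the power \<open>1 - 2h\<close> are
  absorbed by the moment term.\<close>

lemma plog_remainder:
  fixes a b g p dl B :: real
  assumes ab: "0 < a" "a < b" "b \<le> p" and p: "2 < p" and dl: "0 < dl" "b \<le> a + dl / 4" and B: "0 \<le> B"
  shows "\<exists>h>0. \<exists>C\<ge>0. \<forall>\<^sub>F x in at_top. \<forall>G z. 0 \<le> z \<longrightarrow> (\<forall>w\<in>{x / 2..3 * x / 2}. G w = plog a g w) \<longrightarrow>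
    \<bar>G z\<bar> \<le> B * (1 + z) powr b \<longrightarrow>
    \<bar>G z - plog a g x - plog1 a g x * (z - x) - plog2 a g x / 2 * (z - x)\<^sup>2\<bar>
      \<le> C * (x powr (a - 2 - h) * (z - x)\<^sup>2 + x powr (a - p + dl - h) * \<bar>z - x\<bar> powr p)"
    (is "\<exists>h>0. \<exists>C\<ge>0. ?P h C")
proof -
  define h where "h = min (b - a) (dl / (8 * p))"
  have h: "0 < h" using ab p dl by (auto simp: h_def)
  have hb: "a + h \<le> b" by (auto simp: h_def)
  have hp: "8 * (h * p) \<le> dl"
  proof -
    have "h \<le> dl / (8 * p)" by (simp add: h_def)
    then show ?thesis using p by (simp add: field_simps)
  qed
  have h2p: "h * 2 \<le> h * p" using h p by (intro mult_left_mono) auto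
  obtain C1 where C1: "C1 \<ge> 0" "\<forall>\<^sub>F x in at_top. \<forall>d. \<bar>d\<bar> \<le> x / 2 \<longrightarrow>
    \<bar>plog a g (x + d) - plog a g x - plog1 a g x * d - plog2 a g x / 2 * d\<^sup>2\<bar>
      \<le> C1 * x powr (a - 3 + h) * \<bar>d\<bar> ^ 3" using plog_taylor [OF h] by blast
  obtain C2 where C2: "C2 > 0" "\<forall>\<^sub>F x in at_top. \<bar>plog1 a g x\<bar> \<le> C2 * x powr (a - 1 + h)"
    using plog1_le_powr [OF h] by blast
  obtain C3 where C3: "\<forall>\<^sub>F x in at_top. \<bar>plog2 a g x\<bar> \<le> C3 * x powr (a - 2 + h)"
    using plog2_le_powr [OF h] by blast
  define C where "C = C1 + B * 3 powr b + 1 + C2 + \<bar>C3\<bar>"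
  have ev: "\<forall>\<^sub>F x in at_top. x powr (1 - 2 * h) \<le> x / 2" using h by real_asymp
  have "?P h C"
    using C1(2) C2(2) C3 ev plog_le_powr [OF h, of a g] eventually_ge_at_top [of 1]
  proof eventually_elim
    case (elim x)
    have x: "x \<ge> 1" "x > 0" using elim by auto
    show ?case
    proof (intro allI impI)
      fix G :: "real \<Rightarrow> real" and z
      assume z: "0 \<le> z" and G: "\<forall>w\<in>{x / 2..3 * x / 2}. G w = plog a g w"
        and Gb: "\<bar>G z\<bar> \<le> B * (1 + z) powr b"
      define D where "D = \<bar>z - x\<bar>"
      have D0: "D \<ge> 0" and Dsq: "(z - x)\<^sup>2 = D\<^sup>2" by (auto simp: D_def)
      let ?R = "\<bar>G z - plog a g x - plog1 a g x * (z - x) - plog2 a g x / 2 * (z - x)\<^sup>2\<bar>"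
      have CC: "C1 \<le> C" "B * 3 powr b + 1 + C2 + \<bar>C3\<bar> \<le> C" "0 \<le> C"
        using C1 C2 B by (auto simp: C_def)
      show "?R \<le> C * (x powr (a - 2 - h) * (z - x)\<^sup>2 + x powr (a - p + dl - h) * \<bar>z - x\<bar> powr p)"
      proof (cases "D \<le> x powr (1 - 2 * h)")
        case True
        then have Dx: "\<bar>z - x\<bar> \<le> x / 2" using elim D_def by linarith
        then have "z - x \<le> x / 2" "x - z \<le> x / 2" by linarith+
        then have "z \<in> {x / 2..3 * x / 2}" by auto
        then have Gz: "G z = plog a g (x + (z - x))" using G by auto
        have "?R \<le> C1 * x powr (a - 3 + h) * D ^ 3"
          using elim(1) Dx unfolding Gz D_def by blast
        also have "D ^ 3 = D * D\<^sup>2" by (simp add: power3_eq_cube power2_eq_square)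
        also have "C1 * x powr (a - 3 + h) * (D * D\<^sup>2) \<le> C1 * x powr (a - 3 + h) * (x powr (1 - 2 * h) * D\<^sup>2)"
          using True C1(1) by (intro mult_left_mono mult_right_mono) auto
        also have "\<dots> = C1 * (x powr (a - 2 - h) * D\<^sup>2)"
          by (simp add: mult.assoc [symmetric] powr_add [symmetric])
            (simp add: algebra_simps)
        also have "\<dots> \<le> C * (x powr (a - 2 - h) * D\<^sup>2)"
          using CC by (intro mult_right_mono) auto
        also have "\<dots> \<le> C * (x powr (a - 2 - h) * D\<^sup>2 + x powr (a - p + dl - h) * \<bar>z - x\<bar> powr p)"
          using CC by (intro mult_left_mono) auto
        finally show ?thesis by (simp add: Dsq)
      next
        case False
        define u where "u = D * x powr (2 * h - 1)"
        have Du: "D = u * x powr (1 - 2 * h)"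
          using x by (simp add: u_def mult.assoc powr_add [symmetric])
        have "x powr (1 - 2 * h) * x powr (2 * h - 1) \<le> u"
          unfolding u_def using False by (intro mult_right_mono) auto
        then have u1: "u \<ge> 1" using x by (simp add: powr_add [symmetric])
        have "x powr (1 - 2 * h) \<le> x powr 1" using x h by (intro powr_mono) auto
        then have Dux: "D \<le> u * x" unfolding Du using u1 x by (intro mult_left_mono) auto
        have xux: "x \<le> u * x" using u1 x by simp
        have "1 + z \<le> 1 + x + D" by (auto simp: D_def)
        then have z3: "1 + z \<le> 3 * (u * x)" using Dux xux x by linarith
        define W where "W = x powr b * u powr p"
        have W0: "0 \<le> W" by (simp add: W_def)
        have t1: "\<bar>G z\<bar> \<le> B * 3 powr b * W"
        proof -
          have "(1 + z) powr b \<le> (3 * (u * x)) powr b" using z z3 ab by (intro powr_mono2) auto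
          also have "\<dots> = 3 powr b * (u powr b * x powr b)" using u1 x by (simp add: powr_mult)
          also have "\<dots> \<le> 3 powr b * (u powr p * x powr b)"
            using u1 ab by (intro mult_left_mono mult_right_mono powr_mono) auto
          finally have "(1 + z) powr b \<le> 3 powr b * W" by (simp add: W_def mult.commute)
          then have "B * (1 + z) powr b \<le> B * (3 powr b * W)" using B by (intro mult_left_mono)
          then show ?thesis using Gb by simp
        qed
        have up: "1 \<le> u powr p" "u \<le> u powr p" "u\<^sup>2 \<le> u powr p"
        proof -
          show "1 \<le> u powr p" using u1 p by (intro ge_one_powr_ge_zero) auto
          have "u powr 1 \<le> u powr p" using u1 p by (intro powr_mono) auto
          then show "u \<le> u powr p" using u1 by simp
          have "u powr 2 \<le> u powr p" using u1 p by (intro powr_mono) auto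
          then show "u\<^sup>2 \<le> u powr p" using u1 by simp
        qed
        have xb: "x powr (a + h) \<le> x powr b" using x hb by (intro powr_mono) auto
        have t2: "\<bar>plog a g x\<bar> \<le> 1 * W"
        proof -
          have "\<bar>plog a g x\<bar> \<le> x powr (a + h) * 1" using elim by simp
          also have "\<dots> \<le> x powr b * u powr p" using xb up by (intro mult_mono) auto
          finally show ?thesis by (simp add: W_def)
        qed
        have t3: "\<bar>plog1 a g x * (z - x)\<bar> \<le> C2 * W"
        proof -
          have "\<bar>plog1 a g x * (z - x)\<bar> = \<bar>plog1 a g x\<bar> * D" by (simp add: abs_mult D_def)
          also have "\<dots> \<le> (C2 * x powr (a - 1 + h)) * (u * x)"
            using elim Dux D0 C2 by (intro mult_mono) auto
          also have "\<dots> = C2 * ((x powr (a - 1 + h) * x powr 1) * u)" using x by simp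
          also have "\<dots> = C2 * (x powr (a + h) * u)"
            unfolding powr_add [symmetric] by (simp add: algebra_simps)
          also have "\<dots> \<le> C2 * (x powr b * u powr p)"
            using xb up u1 C2 by (intro mult_left_mono mult_mono) auto
          finally show ?thesis by (simp add: W_def)
        qed
        have t4: "\<bar>plog2 a g x / 2 * (z - x)\<^sup>2\<bar> \<le> \<bar>C3\<bar> * W"
        proof -
          have "\<bar>plog2 a g x / 2 * (z - x)\<^sup>2\<bar> \<le> \<bar>plog2 a g x\<bar> * D\<^sup>2"
            by (simp add: abs_mult D_def)
          also have "\<dots> \<le> (\<bar>C3\<bar> * x powr (a - 2 + h)) * (u * x)\<^sup>2"
          proof (intro mult_mono power_mono)
            have "C3 * x powr (a - 2 + h) \<le> \<bar>C3\<bar> * x powr (a - 2 + h)" by (intro mult_right_mono) auto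
            then show "\<bar>plog2 a g x\<bar> \<le> \<bar>C3\<bar> * x powr (a - 2 + h)" using elim by linarith
          qed (use Dux D0 in auto)
          also have "\<dots> = \<bar>C3\<bar> * ((x powr (a - 2 + h) * x powr 2) * u\<^sup>2)"
            using x by (simp add: power_mult_distrib)
          also have "\<dots> = \<bar>C3\<bar> * (x powr (a + h) * u\<^sup>2)"
            unfolding powr_add [symmetric] by (simp add: algebra_simps)
          also have "\<dots> \<le> \<bar>C3\<bar> * (x powr b * u powr p)"
            using xb up u1 by (intro mult_left_mono mult_mono) auto
          finally show ?thesis by (simp add: W_def)
        qed
        have "?R \<le> B * 3 powr b * W + 1 * W + C2 * W + \<bar>C3\<bar> * W"
          using t1 t2 t3 t4 by linarith
        also have "\<dots> = (B * 3 powr b + 1 + C2 + \<bar>C3\<bar>) * W" by (simp add: algebra_simps)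
        also have "\<dots> \<le> C * W" using CC W0 by (intro mult_right_mono) auto
        also have "W = x powr (b + (2 * h - 1) * p) * D powr p"
          using D0 by (simp add: W_def u_def powr_mult powr_powr powr_add mult.commute mult.left_commute)
        also have "C * (x powr (b + (2 * h - 1) * p) * D powr p) \<le> C * (x powr (a - p + dl - h) * D powr p)"
        proof (intro mult_left_mono mult_right_mono powr_mono)
          show "b + (2 * h - 1) * p \<le> a - p + dl - h"
          proof -
            have "b + (2 * h - 1) * p = b + 2 * (h * p) - p" by (simp add: algebra_simps)
            then show ?thesis using dl hp h2p h by linarith
          qed
        qed (use x CC in auto)
        also have "\<dots> \<le> C * (x powr (a - 2 - h) * (z - x)\<^sup>2 + x powr (a - p + dl - h) * \<bar>z - x\<bar> powr p)"
          using CC by (intro mult_left_mono) (auto simp: D_def)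
        finally show ?thesis .
      qed
    qed
  qed
  moreover have "C \<ge> 0" using C1 C2 B by (auto simp: C_def)
  ultimately show ?thesis using h by blast
qed

text \<open>The leading part of the drift of \<open>plog a g (X t)\<close> at level \<open>x\<close>, for mean increment \<open>c / x\<close>
  and second moment \<open>s2\<close>.\<close>

definition plog_gen :: "real \<Rightarrow> real \<Rightarrow> real \<Rightarrow> real \<Rightarrow> real \<Rightarrow> real" where
  "plog_gen c s2 a g x = plog1 a g x * (c / x) + plog2 a g x / 2 * s2"

lemma plog1_eq:
  assumes "1 < x" shows "plog1 a g x = x * plog (a - 2) (g - 1) x * (a * ln x + g)"
proof -
  have "x powr (a - 1) = x * x powr (a - 2)"
    using assms powr_add [of x 1 "a - 2"] by simp
  moreover have "ln x powr g = ln x * ln x powr (g - 1)"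
    using assms powr_add [of "ln x" 1 "g - 1"] by simp
  ultimately show ?thesis by (simp add: plog1_def plog_def algebra_simps)
qed

lemma plog2_eq:
  assumes "1 < x"
  shows "plog2 a g x = plog (a - 2) (g - 1) x *
    (a * (a - 1) * ln x + g * (2 * a - 1) + g * (g - 1) / ln x)"
proof -
  have 1: "ln x powr (g - 1) = ln x * ln x powr (g - 2)"
    using assms powr_add [of "ln x" 1 "g - 2"] by simp
  have "ln x powr g = ln x * ln x powr (g - 1)"
    using assms powr_add [of "ln x" 1 "g - 1"] by simp
  then have "ln x powr g = ln x * (ln x * ln x powr (g - 2))" by (simp add: 1)
  with 1 show ?thesis using assms
    by (simp add: plog2_def plog1_def plog_def field_simps)
qed

lemma plog_gen_eq:
  assumes "1 < x"
  shows "plog_gen (- r * s2 / 2) s2 a g x = s2 / 2 * plog (a - 2) (g - 1) x *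
    (a * (a - 1 - r) * ln x + g * (2 * a - 1 - r) + g * (g - 1) / ln x)"
  using assms by (simp add: plog_gen_def plog1_eq plog2_eq field_simps)

lemma plog_gen_neg:
  assumes "g < 0" "0 < a" "a \<le> 1 + r" "0 < s2"
  shows "\<exists>k>0. \<forall>\<^sub>F x in at_top. plog_gen (- r * s2 / 2) s2 a g x \<le> - k * plog (a - 2) (g - 1) x"
proof (intro exI conjI)
  let ?k = "s2 / 2 * (- g * a / 2)"
  show "0 < ?k" using assms by (simp add: mult_less_0_iff zero_less_mult_iff)
  have ga: "g * a < 0" using assms by (simp add: mult_neg_pos)
  have ev: "\<forall>\<^sub>F x in at_top. a * (a - 1 - r) * ln x + g * (2 * a - 1 - r) + g * (g - 1) / ln x \<le> g * a / 2"
  proof (cases "a = 1 + r")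
    case True
    define d where "d = - (g * a / 2)"
    have "0 < d" using ga by (simp add: d_def)
    then have "\<forall>\<^sub>F x in at_top. g * (g - 1) / ln x \<le> d" by real_asymp
    then show ?thesis
    proof eventually_elim
      case (elim x)
      have "a * (a - 1 - r) * ln x = 0" "g * (2 * a - 1 - r) = g * a"
        using True by simp_all
      then show ?case using elim unfolding d_def by linarith
    qed
  next
    case False
    then have "a * (a - 1 - r) < 0" using assms by (intro mult_pos_neg) auto
    then show ?thesis by real_asymp
  qed
  show "\<forall>\<^sub>F x in at_top. plog_gen (- r * s2 / 2) s2 a g x \<le> - ?k * plog (a - 2) (g - 1) x"
    using ev eventually_gt_at_top [of 1]
  proof eventually_elim
    case (elim x)
    have "plog_gen (- r * s2 / 2) s2 a g x \<le> s2 / 2 * plog (a - 2) (g - 1) x * (g * a / 2)"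
      unfolding plog_gen_eq [OF elim(2)] using elim assms by (intro mult_left_mono) auto
    then show ?case by (simp add: algebra_simps)
  qed
qed

lemma plog_gen_pos:
  assumes "0 < g" "0 < 1 + r" "0 < s2"
  shows "\<exists>k>0. \<forall>\<^sub>F x in at_top. k * plog (1 + r - 2) (g - 1) x \<le> plog_gen (- r * s2 / 2) s2 (1 + r) g x"
proof (intro exI conjI)
  let ?k = "s2 / 2 * (g * (1 + r) / 2)"
  show "0 < ?k" using assms by simp
  have ga: "g * (1 + r) > 0" using assms by simp
  have ev: "\<forall>\<^sub>F x in at_top. g * (1 + r) + g * (g - 1) / ln x \<ge> g * (1 + r) / 2" using ga by real_asymp
  show "\<forall>\<^sub>F x in at_top. ?k * plog (1 + r - 2) (g - 1) x \<le> plog_gen (- r * s2 / 2) s2 (1 + r) g x"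
    using ev eventually_gt_at_top [of 1]
  proof eventually_elim
    case (elim x)
    have "s2 / 2 * plog (1 + r - 2) (g - 1) x * (g * (1 + r) / 2) \<le>
      s2 / 2 * plog (1 + r - 2) (g - 1) x * (g * (1 + r) + g * (g - 1) / ln x)"
      using elim assms by (intro mult_left_mono) auto
    also have "\<dots> = plog_gen (- r * s2 / 2) s2 (1 + r) g x"
      unfolding plog_gen_eq [OF elim(2)] by (simp add: algebra_simps)
    finally show ?case by (simp add: algebra_simps)
  qed
qed

lemma plog_drift_approx:
  fixes a g c s2 p dl C Cp h e :: real
  assumes e: "0 < e" and h: "0 < h" and C: "0 \<le> C" and Cp: "0 \<le> Cp" and s2: "0 < s2"
    and dl: "dl \<le> p - 2"
  shows "\<exists>e'>0. \<forall>\<^sub>F x in at_top. \<forall>q m1 m2 mp v. 0 \<le> q \<longrightarrow> \<bar>m1 - c / x * q\<bar> \<le> e' / (x * ln x) * q \<longrightarrow>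
     \<bar>m2 - s2 * q\<bar> \<le> e' / ln x * q \<longrightarrow> mp \<le> Cp * (1 + x) powr (p - 2 - dl) * q \<longrightarrow>
     \<bar>v - plog1 a g x * m1 - plog2 a g x / 2 * m2\<bar>
        \<le> C * (x powr (a - 2 - h) * m2 + x powr (a - p + dl - h) * mp) \<longrightarrow>
     \<bar>v - plog_gen c s2 a g x * q\<bar> \<le> e * plog (a - 2) (g - 1) x * q"
    (is "\<exists>e'>0. ?P e'")
proof -
  define C4 where "C4 = \<bar>a\<bar> + \<bar>g\<bar> + (\<bar>a * (a - 1)\<bar> + \<bar>g * (2 * a - 1)\<bar> + \<bar>g * (g - 1)\<bar>)"
  have C40: "C4 \<ge> 0" by (simp add: C4_def)
  define e' where "e' = min 1 (e / (4 * (C4 + 1)))"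
  have e'0: "0 < e'" using e C40 by (simp add: e'_def)
  have e'1: "e' \<le> 1" by (simp add: e'_def)
  have e'e: "e' * C4 \<le> e / 4"
  proof -
    have "e' * C4 \<le> e / (4 * (C4 + 1)) * C4" using C40 by (intro mult_right_mono) (auto simp: e'_def)
    also have "\<dots> \<le> e / 4" using C40 e by (simp add: field_simps)
    finally show ?thesis .
  qed
  define C5 where "C5 = C * (s2 + 1 + Cp * 2 powr (p - 2 - dl))"
  have ev: "\<forall>\<^sub>F x in at_top. C5 * x powr (a - 2 - h) \<le> e / 2 * plog (a - 2) (g - 1) x"
    unfolding plog_def using e h by real_asymp
  have "?P e'"
    using ev eventually_gt_at_top [of "exp 1"]
  proof eventually_elim
    case (elim x)
    have x: "x > 1" using elim one_le_exp_iff [of 1] by linarith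
    have L: "ln x \<ge> 1" using elim x by (simp add: ln_ge_iff)
    define w where "w = plog (a - 2) (g - 1) x"
    have w0: "w \<ge> 0" by (simp add: w_def)
    show ?case
    proof (intro allI impI)
      fix q m1 m2 mp v
      assume q: "0 \<le> q" and m1: "\<bar>m1 - c / x * q\<bar> \<le> e' / (x * ln x) * q"
        and m2: "\<bar>m2 - s2 * q\<bar> \<le> e' / ln x * q" and mp: "mp \<le> Cp * (1 + x) powr (p - 2 - dl) * q"
        and v: "\<bar>v - plog1 a g x * m1 - plog2 a g x / 2 * m2\<bar>
        \<le> C * (x powr (a - 2 - h) * m2 + x powr (a - p + dl - h) * mp)"
      have b1: "\<bar>plog1 a g x * (m1 - c / x * q)\<bar> \<le> (\<bar>a\<bar> + \<bar>g\<bar>) * (e' * w * q)"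
      proof -
        have "\<bar>a * ln x + g\<bar> \<le> \<bar>a\<bar> * ln x + \<bar>g\<bar>"
          using L by (intro order_trans [OF abs_triangle_ineq]) (simp add: abs_mult)
        also have "\<dots> \<le> \<bar>a\<bar> * ln x + \<bar>g\<bar> * ln x" using L by (simp add: mult_le_cancel_left1)
        finally have l: "\<bar>a * ln x + g\<bar> \<le> (\<bar>a\<bar> + \<bar>g\<bar>) * ln x" by (simp add: algebra_simps)
        have "\<bar>plog1 a g x * (m1 - c / x * q)\<bar> = (x * w * \<bar>a * ln x + g\<bar>) * \<bar>m1 - c / x * q\<bar>"
          using x w0 by (simp add: plog1_eq abs_mult w_def)
        also have "\<dots> \<le> (x * w * ((\<bar>a\<bar> + \<bar>g\<bar>) * ln x)) * (e' / (x * ln x) * q)"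
          using x w0 l m1 L q e'0 by (intro mult_mono mult_left_mono) auto
        also have "\<dots> = (\<bar>a\<bar> + \<bar>g\<bar>) * (e' * w * q)" using x L by (simp add: field_simps)
        finally show ?thesis .
      qed
      define C6 where "C6 = \<bar>a * (a - 1)\<bar> + \<bar>g * (2 * a - 1)\<bar> + \<bar>g * (g - 1)\<bar>"
      have b2: "\<bar>plog2 a g x / 2 * (m2 - s2 * q)\<bar> \<le> C6 * (e' * w * q)"
      proof -
        have "\<bar>g * (g - 1) / ln x\<bar> \<le> \<bar>g * (g - 1)\<bar> * ln x"
        proof -
          have "\<bar>g * (g - 1) / ln x\<bar> \<le> \<bar>g * (g - 1)\<bar> / 1"
            using L unfolding abs_divide by (intro divide_left_mono) auto
          also have "\<dots> \<le> \<bar>g * (g - 1)\<bar> * ln x" using L by (simp add: mult_le_cancel_left1)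
          finally show ?thesis .
        qed
        moreover have "\<bar>g * (2 * a - 1)\<bar> \<le> \<bar>g * (2 * a - 1)\<bar> * ln x"
          using L by (simp add: mult_le_cancel_left1)
        moreover have "\<bar>a * (a - 1) * ln x\<bar> = \<bar>a * (a - 1)\<bar> * ln x" using L by (simp add: abs_mult)
        ultimately have l: "\<bar>a * (a - 1) * ln x + g * (2 * a - 1) + g * (g - 1) / ln x\<bar> \<le> C6 * ln x"
          unfolding C6_def distrib_right by linarith
        have "\<bar>plog2 a g x / 2 * (m2 - s2 * q)\<bar> \<le> \<bar>plog2 a g x\<bar> * \<bar>m2 - s2 * q\<bar>"
          by (simp add: abs_mult)
        also have "\<dots> = (w * \<bar>a * (a - 1) * ln x + g * (2 * a - 1) + g * (g - 1) / ln x\<bar>) * \<bar>m2 - s2 * q\<bar>"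
          using x w0 by (simp add: plog2_eq abs_mult w_def)
        also have "\<dots> \<le> (w * (C6 * ln x)) * (e' / ln x * q)"
          using w0 l m2 L q e'0 by (intro mult_mono mult_left_mono) (auto simp: C6_def)
        also have "\<dots> = C6 * (e' * w * q)" using L by (simp add: field_simps)
        finally show ?thesis .
      qed
      have "e' / ln x \<le> 1" using L e'0 e'1 by (simp add: divide_le_eq)
      then have "e' / ln x * q \<le> 1 * q" using q by (intro mult_right_mono)
      then have m2': "m2 \<le> (s2 + 1) * q" using m2 by (simp add: algebra_simps abs_le_iff)
      have mp': "mp \<le> Cp * 2 powr (p - 2 - dl) * x powr (p - 2 - dl) * q"
      proof -
        have "(1 + x) powr (p - 2 - dl) \<le> (2 * x) powr (p - 2 - dl)"
          using x dl by (intro powr_mono2) auto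
        also have "\<dots> = 2 powr (p - 2 - dl) * x powr (p - 2 - dl)" using x by (simp add: powr_mult)
        finally have "Cp * (1 + x) powr (p - 2 - dl) * q \<le> Cp * (2 powr (p - 2 - dl) * x powr (p - 2 - dl)) * q"
          using Cp q by (intro mult_right_mono mult_left_mono)
        then show ?thesis using mp by (simp add: mult.assoc)
      qed
      have "C * (x powr (a - 2 - h) * m2 + x powr (a - p + dl - h) * mp) \<le>
          C * (x powr (a - 2 - h) * ((s2 + 1) * q) + x powr (a - p + dl - h) * (Cp * 2 powr (p - 2 - dl) * x powr (p - 2 - dl) * q))"
        using C m2' mp' by (intro mult_left_mono add_mono) auto
      also have "x powr (a - p + dl - h) * (Cp * 2 powr (p - 2 - dl) * x powr (p - 2 - dl) * q)
        = Cp * 2 powr (p - 2 - dl) * (x powr (a - p + dl - h) * x powr (p - 2 - dl)) * q" by (simp add: algebra_simps)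
      also have "x powr (a - p + dl - h) * x powr (p - 2 - dl) = x powr (a - 2 - h)"
        by (simp add: powr_add [symmetric] algebra_simps)
      also have "C * (x powr (a - 2 - h) * ((s2 + 1) * q) + Cp * 2 powr (p - 2 - dl) * x powr (a - 2 - h) * q)
          = C5 * x powr (a - 2 - h) * q"
        unfolding C5_def by (simp add: algebra_simps)
      also have "\<dots> \<le> e / 2 * w * q" using elim(1) q unfolding w_def by (intro mult_right_mono)
      finally have b3: "\<bar>v - plog1 a g x * m1 - plog2 a g x / 2 * m2\<bar> \<le> e / 2 * w * q"
        using v by linarith
      have "e' * C4 * (w * q) \<le> e / 4 * (w * q)" using e'e w0 q by (intro mult_right_mono) auto
      then have b4: "(\<bar>a\<bar> + \<bar>g\<bar>) * (e' * w * q) + C6 * (e' * w * q) \<le> e / 4 * (w * q)"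
        unfolding C4_def C6_def by (simp add: algebra_simps)
      have eq: "v - plog_gen c s2 a g x * q = (v - plog1 a g x * m1 - plog2 a g x / 2 * m2)
        + plog1 a g x * (m1 - c / x * q) + plog2 a g x / 2 * (m2 - s2 * q)"
        unfolding plog_gen_def by (simp add: field_simps)
      have "\<bar>v - plog_gen c s2 a g x * q\<bar> \<le> e / 2 * w * q + e / 4 * (w * q)"
      proof -
        have tri: "\<bar>u1 + u2 + u3\<bar> \<le> \<bar>u1\<bar> + \<bar>u2\<bar> + \<bar>u3\<bar>" for u1 u2 u3 :: real by linarith
        show ?thesis unfolding eq by (rule order_trans [OF tri]) (use b1 b2 b3 b4 in linarith)
      qed
      also have "\<dots> \<le> e * w * q" using e w0 q by (simp add: algebra_simps)
      finally show "\<bar>v - plog_gen c s2 a g x * q\<bar> \<le> e * plog (a - 2) (g - 1) x * q" by (simp add: w_def)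
    qed
  qed
  then show ?thesis using e'0 by blast
qed

section \<open>Conditional moments on level sets\<close>

lemma powr_add_le_two_powr:
  fixes u v q :: real
  assumes "0 \<le> u" "0 \<le> v" "0 \<le> q"
  shows "(u + v) powr q \<le> 2 powr q * (u powr q + v powr q)"
proof -
  have "(u + v) powr q \<le> (2 * max u v) powr q" using assms by (intro powr_mono2) auto
  also have "\<dots> = 2 powr q * max u v powr q" using assms by (intro powr_mult)
  also have "max u v powr q \<le> u powr q + v powr q" by (simp add: max_def)
  finally show ?thesis by simp
qed

locale near_critical_process = prob_space M for M :: "'a measure" +
  fixes F :: "nat \<Rightarrow> 'a measure" and X :: "nat \<Rightarrow> 'a \<Rightarrow> real" and S :: "real set"
    and r s2 p dl Cp :: real and mm :: "real \<Rightarrow> real \<Rightarrow> nat" and phi :: "real \<Rightarrow> real \<Rightarrow> real"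
  assumes S_nonneg: "S \<subseteq> {0..}" and S_zero: "0 \<in> S"
    and S_locfin: "finite (S \<inter> {..b})" and S_unbdd: "\<not> bdd_above S"
    and filt_sub: "1 \<le> t \<Longrightarrow> subalgebra M (F t)"
    and filt_mono: "1 \<le> s \<Longrightarrow> s \<le> t \<Longrightarrow> sets (F s) \<subseteq> sets (F t)"
    and adapted: "1 \<le> t \<Longrightarrow> X t \<in> borel_measurable (F t)"
    and X_in_S: "1 \<le> t \<Longrightarrow> w \<in> space M \<Longrightarrow> X t w \<in> S"
    and start: "AE w in M. X 1 w = 0"
    and mm_ge: "x \<in> S \<Longrightarrow> y \<in> S \<Longrightarrow> 1 \<le> mm x y"
    and phi_pos: "x \<in> S \<Longrightarrow> y \<in> S \<Longrightarrow> 0 < phi x y"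
    and irreducible_step: "y \<in> S \<Longrightarrow> 1 \<le> t \<Longrightarrow> AE w in M.
        phi (X t w) y \<le> real_cond_exp M (F t) (indicator {w\<in>space M. X (t + mm (X t w) y) w = y}) w"
    and s2_pos: "0 < s2"
    and drift_mean: "0 < e \<Longrightarrow> \<exists>x0. \<forall>t\<ge>1. AE w in M. X t w \<ge> x0 \<longrightarrow>
        \<bar>real_cond_exp M (F t) (incr X t) w - (- r * s2 / 2) / X t w\<bar> \<le> e / (X t w * ln (X t w))"
    and drift_var: "0 < e \<Longrightarrow> \<exists>x0. \<forall>t\<ge>1. AE w in M. X t w \<ge> x0 \<longrightarrow>
        \<bar>real_cond_exp M (F t) (\<lambda>w. (incr X t w)\<^sup>2) w - s2\<bar> \<le> e / ln (X t w)"
    and r_gt: "-1 < r" and p_gt2: "2 < p" and p_gt_r: "1 + r < p"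
    and dl: "0 < dl" "dl \<le> p - 2" and Cp: "0 \<le> Cp"
    and moment: "1 \<le> t \<Longrightarrow> AE w in M. nn_cond_exp M (F t) (\<lambda>w. ennreal (\<bar>incr X t w\<bar> powr p)) w
        \<le> ennreal (Cp * (1 + X t w) powr (p - 2 - dl))"
begin

lemma sets_F_subset: "1 \<le> t \<Longrightarrow> A \<in> sets (F t) \<Longrightarrow> A \<in> sets M"
  using filt_sub by (auto simp: subalgebra_def)

lemma space_F: "1 \<le> t \<Longrightarrow> space (F t) = space M"
  using filt_sub by (auto simp: subalgebra_def)

lemma X_measurable: "1 \<le> t \<Longrightarrow> X t \<in> borel_measurable M"
  using measurable_from_subalg [OF filt_sub adapted] by blast

lemma X_measurable_F: "1 \<le> s \<Longrightarrow> s \<le> t \<Longrightarrow> X s \<in> borel_measurable (F t)"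
  using adapted [of s] filt_mono [of s t] space_F [of s] space_F [of t]
  by (intro measurable_from_subalg [of "F t" "F s"]) (auto simp: subalgebra_def)

lemma X_nonneg: "1 \<le> t \<Longrightarrow> w \<in> space M \<Longrightarrow> 0 \<le> X t w"
  using X_in_S S_nonneg by fastforce

lemma incr_measurable: "1 \<le> t \<Longrightarrow> incr X t \<in> borel_measurable M"
  unfolding incr_def [abs_def] using X_measurable [of t] X_measurable [of "Suc t"] by measurable

lemma F_sigma_finite: "1 \<le> t \<Longrightarrow> sigma_finite_subalgebra M (F t)"
  by (intro finite_measure_subalgebra_is_sigma_finite finite_measure_subalgebra.intro
      finite_measure_subalgebra_axioms.intro finite_measure_axioms filt_sub)

lemma level_set_F: "1 \<le> t \<Longrightarrow> {w \<in> space M. X t w = x} \<in> sets (F t)"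
proof -
  assume t: "1 \<le> t"
  have "{w \<in> space (F t). X t w = x} \<in> sets (F t)"
    using adapted [OF t] by measurable
  then show ?thesis by (simp add: space_F [OF t])
qed

lemma countable_S: "countable S"
proof -
  have "S = (\<Union>n::nat. S \<inter> {..real n})"
    using real_arch_simple by auto
  moreover have "countable (\<Union>n::nat. S \<inter> {..real n})"
    using S_locfin by (intro countable_UN) (auto intro: countable_finite)
  ultimately show ?thesis by simp
qed

lemma nn_incr_powr:
  assumes "1 \<le> t" "A \<in> sets (F t)"
  shows "(\<integral>\<^sup>+w\<in>A. ennreal (\<bar>incr X t w\<bar> powr p) \<partial>M)
    \<le> (\<integral>\<^sup>+w\<in>A. ennreal (Cp * (1 + X t w) powr (p - 2 - dl)) \<partial>M)"
proof -
  interpret sigma_finite_subalgebra M "F t" by (rule F_sigma_finite [OF assms(1)])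
  have [measurable]: "incr X t \<in> borel_measurable M" "A \<in> sets (F t)"
    using incr_measurable assms by auto
  have "(\<integral>\<^sup>+w\<in>A. ennreal (\<bar>incr X t w\<bar> powr p) \<partial>M)
      = (\<integral>\<^sup>+w. indicator A w * ennreal (\<bar>incr X t w\<bar> powr p) \<partial>M)" by (simp add: mult.commute)
  also have "\<dots> = (\<integral>\<^sup>+w. indicator A w * nn_cond_exp M (F t) (\<lambda>w. ennreal (\<bar>incr X t w\<bar> powr p)) w \<partial>M)"
    by (rule nn_cond_exp_intg [symmetric]) measurable
  also have "\<dots> \<le> (\<integral>\<^sup>+w. indicator A w * ennreal (Cp * (1 + X t w) powr (p - 2 - dl)) \<partial>M)"
    using moment [OF assms(1)] by (intro nn_integral_mono_AE) (auto simp: indicator_def)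
  finally show ?thesis by (simp add: mult.commute)
qed

lemma nn_powr_finite:
  assumes "1 \<le> t" shows "(\<integral>\<^sup>+w. ennreal ((1 + X t w) powr p) \<partial>M) < \<infinity>
    \<and> (\<integral>\<^sup>+w. ennreal (\<bar>incr X t w\<bar> powr p) \<partial>M) < \<infinity>"
proof -
  have incr_fin: "(\<integral>\<^sup>+w. ennreal (\<bar>incr X t w\<bar> powr p) \<partial>M) < \<infinity>"
    if t: "1 \<le> t" and fin: "(\<integral>\<^sup>+w. ennreal ((1 + X t w) powr p) \<partial>M) < \<infinity>" for t
  proof -
    have [measurable]: "X t \<in> borel_measurable M" using X_measurable t by auto
    have "(\<integral>\<^sup>+w. ennreal (\<bar>incr X t w\<bar> powr p) \<partial>M) =
        (\<integral>\<^sup>+w\<in>space (F t). ennreal (\<bar>incr X t w\<bar> powr p) \<partial>M)"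
      by (intro nn_integral_cong) (use t in \<open>auto simp: space_F indicator_def\<close>)
    also have "\<dots> \<le> (\<integral>\<^sup>+w\<in>space (F t). ennreal (Cp * (1 + X t w) powr (p - 2 - dl)) \<partial>M)"
      by (intro nn_incr_powr t sets.top)
    also have "\<dots> \<le> (\<integral>\<^sup>+w. ennreal Cp * ennreal ((1 + X t w) powr p) \<partial>M)"
    proof (intro nn_integral_mono)
      fix w assume w: "w \<in> space M"
      have "(1 + X t w) powr (p - 2 - dl) \<le> (1 + X t w) powr p"
        using X_nonneg [OF t w] dl by (intro powr_mono) auto
      then have "Cp * (1 + X t w) powr (p - 2 - dl) \<le> Cp * (1 + X t w) powr p"
        using Cp by (intro mult_left_mono)
      then have "ennreal (Cp * (1 + X t w) powr (p - 2 - dl)) \<le> ennreal Cp * ennreal ((1 + X t w) powr p)"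
        using Cp by (simp add: ennreal_mult' [symmetric] ennreal_leI)
      then show "ennreal (Cp * (1 + X t w) powr (p - 2 - dl)) * indicator (space (F t)) w
          \<le> ennreal Cp * ennreal ((1 + X t w) powr p)"
        by (auto simp: indicator_def)
    qed
    also have "\<dots> = ennreal Cp * (\<integral>\<^sup>+w. ennreal ((1 + X t w) powr p) \<partial>M)"
      by (rule nn_integral_cmult) measurable
    also have "\<dots> < \<infinity>" using fin by (simp add: ennreal_mult_less_top)
    finally show ?thesis .
  qed
  have "(\<integral>\<^sup>+w. ennreal ((1 + X t w) powr p) \<partial>M) < \<infinity>"
    using assms
  proof (induction t rule: dec_induct)
    case base
    have "(\<integral>\<^sup>+w. ennreal ((1 + X 1 w) powr p) \<partial>M) = (\<integral>\<^sup>+w. 1 \<partial>M)"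
      using start by (intro nn_integral_cong_AE) auto
    then show ?case by (simp add: emeasure_space_1)
  next
    case (step t)
    have t: "1 \<le> t" using step by simp
    have [measurable]: "X t \<in> borel_measurable M" "incr X t \<in> borel_measurable M"
      using X_measurable incr_measurable t by auto
    have "(\<integral>\<^sup>+w. ennreal ((1 + X (Suc t) w) powr p) \<partial>M) \<le>
        (\<integral>\<^sup>+w. ennreal (2 powr p) * (ennreal ((1 + X t w) powr p) + ennreal (\<bar>incr X t w\<bar> powr p)) \<partial>M)"
    proof (intro nn_integral_mono)
      fix w assume w: "w \<in> space M"
      have "(1 + X (Suc t) w) powr p \<le> ((1 + X t w) + \<bar>incr X t w\<bar>) powr p"
        using X_nonneg [OF _ w, of "Suc t"] p_gt2 by (intro powr_mono2) (auto simp: incr_def)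
      also have "\<dots> \<le> 2 powr p * ((1 + X t w) powr p + \<bar>incr X t w\<bar> powr p)"
        using X_nonneg [OF t w] p_gt2 by (intro powr_add_le_two_powr) auto
      finally show "ennreal ((1 + X (Suc t) w) powr p) \<le>
          ennreal (2 powr p) * (ennreal ((1 + X t w) powr p) + ennreal (\<bar>incr X t w\<bar> powr p))"
        by (simp add: ennreal_mult' [symmetric] ennreal_plus [symmetric] ennreal_leI del: ennreal_plus)
    qed
    also have "\<dots> = ennreal (2 powr p) * ((\<integral>\<^sup>+w. ennreal ((1 + X t w) powr p) \<partial>M)
        + (\<integral>\<^sup>+w. ennreal (\<bar>incr X t w\<bar> powr p) \<partial>M))"
      by (subst nn_integral_cmult, measurable, subst nn_integral_add, auto)
    also have "\<dots> < \<infinity>" using step.IH incr_fin [OF t]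
      by (auto simp: ennreal_mult_less_top)
    finally show ?case .
  qed
  with incr_fin [OF assms] show ?thesis by blast
qed

lemma integrable_powr_X: "1 \<le> t \<Longrightarrow> integrable M (\<lambda>w. (1 + X t w) powr p)"
  using nn_powr_finite [of t] X_measurable [of t]
  by (intro integrableI_nonneg) auto

lemma integrable_powr_incr: "1 \<le> t \<Longrightarrow> integrable M (\<lambda>w. \<bar>incr X t w\<bar> powr p)"
  using nn_powr_finite [of t] incr_measurable [of t]
  by (intro integrableI_nonneg) auto

lemma integrable_fun_X:
  assumes t: "1 \<le> t" and [measurable]: "G \<in> borel_measurable borel"
    and G: "\<And>z. 0 \<le> z \<Longrightarrow> \<bar>G z\<bar> \<le> B * (1 + z) powr b" and "b \<le> p" "0 \<le> B"
  shows "integrable M (\<lambda>w. G (X t w))"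
proof (rule Bochner_Integration.integrable_bound)
  show "integrable M (\<lambda>w. B * (1 + X t w) powr p)" using integrable_powr_X [OF t] by simp
  show "(\<lambda>w. G (X t w)) \<in> borel_measurable M" using X_measurable [OF t] by measurable
  show "AE w in M. norm (G (X t w)) \<le> norm (B * (1 + X t w) powr p)"
  proof (rule AE_I2)
    fix w assume w: "w \<in> space M"
    have "\<bar>G (X t w)\<bar> \<le> B * (1 + X t w) powr b" using G X_nonneg [OF t w] by blast
    also have "\<dots> \<le> B * (1 + X t w) powr p"
      using assms X_nonneg [OF t w] by (intro mult_left_mono powr_mono) auto
    finally show "norm (G (X t w)) \<le> norm (B * (1 + X t w) powr p)" by simp
  qed
qed

lemma integrable_incr:
  assumes t: "1 \<le> t" shows "integrable M (incr X t)" "integrable M (\<lambda>w. (incr X t w)\<^sup>2)"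
proof -
  have [measurable]: "incr X t \<in> borel_measurable M" using incr_measurable t by auto
  have b: "\<bar>u\<bar> \<le> 1 + \<bar>u\<bar> powr p" "u\<^sup>2 \<le> 1 + \<bar>u\<bar> powr p" for u :: real
  proof -
    show "\<bar>u\<bar> \<le> 1 + \<bar>u\<bar> powr p"
    proof (cases "\<bar>u\<bar> \<le> 1")
      case False
      then have "\<bar>u\<bar> powr 1 \<le> \<bar>u\<bar> powr p" using p_gt2 by (intro powr_mono) auto
      then show ?thesis by simp
    qed (simp add: add_increasing2)
    show "u\<^sup>2 \<le> 1 + \<bar>u\<bar> powr p"
    proof (cases "\<bar>u\<bar> \<le> 1")
      case True
      then have "u\<^sup>2 \<le> 1" by (simp add: abs_square_le_1)
      then show ?thesis by (simp add: add_increasing2)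
    next
      case False
      then have "\<bar>u\<bar> powr 2 \<le> \<bar>u\<bar> powr p" using p_gt2 by (intro powr_mono) auto
      then show ?thesis using False by simp
    qed
  qed
  have int: "integrable M (\<lambda>w. 1 + \<bar>incr X t w\<bar> powr p)"
    using integrable_powr_incr [OF t] by simp
  show "integrable M (incr X t)"
    by (rule Bochner_Integration.integrable_bound [OF int]) (use b(1) in auto)
  show "integrable M (\<lambda>w. (incr X t w)\<^sup>2)"
    by (rule Bochner_Integration.integrable_bound [OF int]) (use b(2) in auto)
qed

lemma set_integrable_restrict: "integrable M g \<Longrightarrow> A \<in> sets M \<Longrightarrow> set_integrable M A (g :: 'a \<Rightarrow> real)"
  unfolding set_integrable_def using integrable_mult_indicator by blast

lemma set_integral_prob: "A \<in> sets M \<Longrightarrow> (LINT w:A|M. k) = k * prob A" for k :: real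
  by (simp add: set_integral_const emeasure_eq_measure)

lemma cond_exp_set_bound:
  assumes t: "1 \<le> t" and B: "B \<in> sets (F t)" and g: "integrable M g"
    and ae: "AE w in M. w \<in> B \<longrightarrow> \<bar>real_cond_exp M (F t) g w - k\<bar> \<le> l"
  shows "\<bar>(LINT w:B|M. g w) - k * prob B\<bar> \<le> l * prob B"
proof -
  interpret sigma_finite_subalgebra M "F t" by (rule F_sigma_finite [OF t])
  have BM: "B \<in> sets M" using B t sets_F_subset by blast
  have int: "integrable M (real_cond_exp M (F t) g)" by (rule real_cond_exp_int(1) [OF g])
  have eq: "(LINT w:B|M. g w) = (LINT w:B|M. real_cond_exp M (F t) g w)"
    by (rule real_cond_exp_intA [OF g B])
  have "(LINT w:B|M. real_cond_exp M (F t) g w) \<le> (LINT w:B|M. k + l)"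
    using ae by (intro set_integral_mono_AE set_integrable_restrict int BM) auto
  moreover have "(LINT w:B|M. k - l) \<le> (LINT w:B|M. real_cond_exp M (F t) g w)"
    using ae by (intro set_integral_mono_AE set_integrable_restrict int BM) auto
  ultimately show ?thesis
    unfolding set_integral_prob [OF BM] eq by (simp add: algebra_simps abs_le_iff)
qed

lemma set_integral_incr_powr:
  assumes t: "1 \<le> t" and B: "B \<in> sets (F t)" "B \<subseteq> {w \<in> space M. X t w = x}"
  shows "(LINT w:B|M. \<bar>incr X t w\<bar> powr p) \<le> Cp * (1 + x) powr (p - 2 - dl) * prob B"
proof -
  have BM: "B \<in> sets M" using B t sets_F_subset by blast
  have [measurable]: "incr X t \<in> borel_measurable M" using incr_measurable t by auto
  have "ennreal (LINT w:B|M. \<bar>incr X t w\<bar> powr p) = (\<integral>\<^sup>+w\<in>B. ennreal (\<bar>incr X t w\<bar> powr p) \<partial>M)"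
    using set_integrable_restrict [OF integrable_powr_incr [OF t] BM]
    unfolding set_lebesgue_integral_def set_integrable_def
    by (subst nn_integral_eq_integral [symmetric])
      (auto intro!: nn_integral_cong simp: indicator_def)
  also have "\<dots> \<le> (\<integral>\<^sup>+w\<in>B. ennreal (Cp * (1 + X t w) powr (p - 2 - dl)) \<partial>M)"
    by (rule nn_incr_powr [OF t B(1)])
  also have "\<dots> = (\<integral>\<^sup>+w. ennreal (Cp * (1 + x) powr (p - 2 - dl)) * indicator B w \<partial>M)"
    using B(2) by (intro nn_integral_cong) (auto simp: indicator_def)
  also have "\<dots> = ennreal (Cp * (1 + x) powr (p - 2 - dl)) * emeasure M B"
    using BM by (simp add: nn_integral_cmult_indicator)
  also have "\<dots> = ennreal (Cp * (1 + x) powr (p - 2 - dl) * prob B)"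
    using Cp by (simp add: emeasure_eq_measure ennreal_mult')
  finally show ?thesis using Cp by (subst (asm) ennreal_le_iff) auto
qed

lemma set_integral_mean:
  assumes "0 < e"
  shows "\<exists>x0. \<forall>x\<ge>x0. \<forall>t\<ge>1. \<forall>B\<in>sets (F t). B \<subseteq> {w \<in> space M. X t w = x} \<longrightarrow>
    \<bar>(LINT w:B|M. incr X t w) - (- r * s2 / 2) / x * prob B\<bar> \<le> e / (x * ln x) * prob B"
proof -
  obtain x0 where x0: "\<And>t. t \<ge> 1 \<Longrightarrow> AE w in M. X t w \<ge> x0 \<longrightarrow>
        \<bar>real_cond_exp M (F t) (incr X t) w - (- r * s2 / 2) / X t w\<bar> \<le> e / (X t w * ln (X t w))"
    using drift_mean [OF assms] by blast
  have "\<bar>(LINT w:B|M. incr X t w) - (- r * s2 / 2) / x * prob B\<bar> \<le> e / (x * ln x) * prob B"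
    if "x \<ge> x0" "t \<ge> 1" "B \<in> sets (F t)" "B \<subseteq> {w \<in> space M. X t w = x}" for x t B
  proof (rule cond_exp_set_bound)
    show "AE w in M. w \<in> B \<longrightarrow> \<bar>real_cond_exp M (F t) (incr X t) w - (- r * s2 / 2) / x\<bar> \<le> e / (x * ln x)"
      using x0 [OF that(2)] that by (elim AE_mp) (auto intro!: AE_I2)
  qed (use that integrable_incr in auto)
  then show ?thesis by blast
qed

lemma set_integral_var:
  assumes "0 < e"
  shows "\<exists>x0. \<forall>x\<ge>x0. \<forall>t\<ge>1. \<forall>B\<in>sets (F t). B \<subseteq> {w \<in> space M. X t w = x} \<longrightarrow>
    \<bar>(LINT w:B|M. (incr X t w)\<^sup>2) - s2 * prob B\<bar> \<le> e / ln x * prob B"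
proof -
  obtain x0 where x0: "\<And>t. t \<ge> 1 \<Longrightarrow> AE w in M. X t w \<ge> x0 \<longrightarrow>
        \<bar>real_cond_exp M (F t) (\<lambda>w. (incr X t w)\<^sup>2) w - s2\<bar> \<le> e / ln (X t w)"
    using drift_var [OF assms] by blast
  have "\<bar>(LINT w:B|M. (incr X t w)\<^sup>2) - s2 * prob B\<bar> \<le> e / ln x * prob B"
    if "x \<ge> x0" "t \<ge> 1" "B \<in> sets (F t)" "B \<subseteq> {w \<in> space M. X t w = x}" for x t B
  proof (rule cond_exp_set_bound)
    show "AE w in M. w \<in> B \<longrightarrow> \<bar>real_cond_exp M (F t) (\<lambda>w. (incr X t w)\<^sup>2) w - s2\<bar> \<le> e / ln x"
      using x0 [OF that(2)] that by (elim AE_mp) (auto intro!: AE_I2)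
  qed (use that integrable_incr in auto)
  then show ?thesis by blast
qed

lemma hit_set_measurable:
  assumes t: "1 \<le> t"
  shows "{w \<in> space M. X (t + mm (X t w) y) w = y} \<in> sets M"
proof -
  have "{w \<in> space M. X (t + mm (X t w) y) w = y} =
      (\<Union>x\<in>S. {w \<in> space M. X t w = x} \<inter> {w \<in> space M. X (t + mm x y) w = y})"
    using X_in_S t by auto
  moreover have "{w \<in> space M. X u w = x} \<in> sets M" if "1 \<le> u" for u x
    using level_set_F sets_F_subset that by blast
  ultimately show ?thesis using countable_S t by (auto intro!: sets.countable_UN')
qed

lemma prob_hit_ge:
  assumes t: "1 \<le> t" and y: "y \<in> S" and B: "B \<in> sets (F t)" "B \<subseteq> {w \<in> space M. X t w = x}"
  shows "phi x y * prob B \<le> prob (B \<inter> {w \<in> space M. X (t + mm x y) w = y})"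
proof -
  interpret sigma_finite_subalgebra M "F t" by (rule F_sigma_finite [OF t])
  let ?H = "{w \<in> space M. X (t + mm (X t w) y) w = y}"
  have BM: "B \<in> sets M" using B t sets_F_subset by blast
  have HM: "?H \<in> sets M" by (rule hit_set_measurable [OF t])
  have ii: "integrable M (indicator ?H :: 'a \<Rightarrow> real)"
    using HM by (simp add: integrable_real_indicator emeasure_eq_measure)
  have int: "integrable M (real_cond_exp M (F t) (indicator ?H))"
    by (rule real_cond_exp_int(1) [OF ii])
  have "phi x y * prob B = (LINT w:B|M. phi x y)" using set_integral_prob [OF BM] by simp
  also have "\<dots> \<le> (LINT w:B|M. real_cond_exp M (F t) (indicator ?H) w)"
  proof (intro set_integral_mono_AE set_integrable_restrict int BM)
    show "AE w\<in>B in M. phi x y \<le> real_cond_exp M (F t) (indicator ?H) w"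
      using irreducible_step [OF y t] B(2) by (elim AE_mp) (auto intro!: AE_I2)
  qed simp
  also have "\<dots> = (LINT w:B|M. indicator ?H w)" by (rule real_cond_exp_intA [OF ii B(1), symmetric])
  also have "\<dots> = prob (B \<inter> ?H)"
    unfolding set_lebesgue_integral_def using BM HM
    by (simp add: indicator_inter_arith [symmetric])
  also have "B \<inter> ?H = B \<inter> {w \<in> space M. X (t + mm x y) w = y}" using B(2) by auto
  finally show ?thesis .
qed

lemma set_integral_nonpos_by_levels:
  assumes t: "1 \<le> t" and B: "B \<in> sets (F t)" and g: "integrable M g"
    and lev: "\<And>x. x \<in> S \<Longrightarrow> (LINT w:(B \<inter> {w \<in> space M. X t w = x})|M. g w) \<le> (0 :: real)"
  shows "(LINT w:B|M. g w) \<le> 0"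
proof -
  have BM: "B \<in> sets M" using B t sets_F_subset by blast
  have levM: "{w \<in> space M. X t w = x} \<in> sets M" for x using level_set_F sets_F_subset t by blast
  define A where "A n = (\<Union>x\<in>S \<inter> {..real n}. B \<inter> {w \<in> space M. X t w = x})" for n :: nat
  have AM: "A n \<in> sets M" for n
    unfolding A_def using S_locfin BM levM by (intro sets.finite_UN) auto
  have Bsp: "B \<subseteq> space M" using BM sets.sets_into_space by blast
  have UA: "(\<Union>n. A n) = B"
  proof -
    have "\<exists>n. w \<in> A n" if "w \<in> B" for w
    proof -
      obtain n :: nat where "X t w \<le> real n" using real_arch_simple by blast
      then have "w \<in> A n" using that Bsp X_in_S [OF t, of w] by (auto simp: A_def)
      then show ?thesis by blast
    qed
    then show ?thesis by (auto simp: A_def)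
  qed
  have le: "(LINT w:A n|M. g w) \<le> 0" for n
  proof -
    have "(LINT w:A n|M. g w) = (\<Sum>x\<in>S \<inter> {..real n}. (LINT w:(B \<inter> {w \<in> space M. X t w = x})|M. g w))"
      unfolding A_def using S_locfin BM levM g
      by (intro set_integral_finite_Union set_integrable_restrict) (auto simp: disjoint_family_on_def)
    also have "\<dots> \<le> 0" using lev by (intro sum_nonpos) auto
    finally show ?thesis .
  qed
  have "(\<lambda>n. LINT w:A n|M. g w) \<longlonglongrightarrow> (LINT w:(\<Union>n. A n)|M. g w)"
  proof (rule set_integral_cont_up)
    show "incseq A" unfolding incseq_def A_def by fastforce
  qed (use AM g UA BM set_integrable_restrict in auto)
  then show ?thesis unfolding UA using le by (intro LIMSEQ_le_const2) auto
qed

lemma plog_drift_set: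
  assumes ab: "0 < a" "a < b" "b \<le> p" "b \<le> a + dl / 4" and Bd: "0 \<le> Bd" and e: "0 < e"
  shows "\<forall>\<^sub>F x in at_top. \<forall>t\<ge>1. \<forall>B\<in>sets (F t). B \<subseteq> {w \<in> space M. X t w = x} \<longrightarrow>
    (\<forall>G. G \<in> borel_measurable borel \<longrightarrow> (\<forall>z\<ge>0. \<bar>G z\<bar> \<le> Bd * (1 + z) powr b) \<longrightarrow>
      (\<forall>z\<in>{x / 2..3 * x / 2}. G z = plog a g z) \<longrightarrow>
      \<bar>(LINT w:B|M. (G (X (Suc t) w) - G (X t w))) - plog_gen (- r * s2 / 2) s2 a g x * prob B\<bar>
        \<le> e * plog (a - 2) (g - 1) x * prob B)"
proof -
  obtain h C where h: "h > 0" and C: "C \<ge> 0" and rem: "\<forall>\<^sub>F x in at_top. \<forall>G z. 0 \<le> z \<longrightarrow>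
    (\<forall>w\<in>{x / 2..3 * x / 2}. G w = plog a g w) \<longrightarrow> \<bar>G z\<bar> \<le> Bd * (1 + z) powr b \<longrightarrow>
    \<bar>G z - plog a g x - plog1 a g x * (z - x) - plog2 a g x / 2 * (z - x)\<^sup>2\<bar>
      \<le> C * (x powr (a - 2 - h) * (z - x)\<^sup>2 + x powr (a - p + dl - h) * \<bar>z - x\<bar> powr p)"
    using plog_remainder [OF ab(1,2,3) p_gt2 dl(1) ab(4) Bd] by blast
  obtain e' where e': "e' > 0" and appr: "\<forall>\<^sub>F x in at_top. \<forall>q m1 m2 mp v. 0 \<le> q \<longrightarrow>
     \<bar>m1 - (- r * s2 / 2) / x * q\<bar> \<le> e' / (x * ln x) * q \<longrightarrow>
     \<bar>m2 - s2 * q\<bar> \<le> e' / ln x * q \<longrightarrow> mp \<le> Cp * (1 + x) powr (p - 2 - dl) * q \<longrightarrow>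
     \<bar>v - plog1 a g x * m1 - plog2 a g x / 2 * m2\<bar>
        \<le> C * (x powr (a - 2 - h) * m2 + x powr (a - p + dl - h) * mp) \<longrightarrow>
     \<bar>v - plog_gen (- r * s2 / 2) s2 a g x * q\<bar> \<le> e * plog (a - 2) (g - 1) x * q"
    using plog_drift_approx [OF e h C Cp s2_pos dl(2)] by blast
  obtain x1 where x1: "\<forall>x\<ge>x1. \<forall>t\<ge>1. \<forall>B\<in>sets (F t). B \<subseteq> {w \<in> space M. X t w = x} \<longrightarrow>
    \<bar>(LINT w:B|M. incr X t w) - (- r * s2 / 2) / x * prob B\<bar> \<le> e' / (x * ln x) * prob B"
    using set_integral_mean [OF e'] by blast
  obtain x2 where x2: "\<forall>x\<ge>x2. \<forall>t\<ge>1. \<forall>B\<in>sets (F t). B \<subseteq> {w \<in> space M. X t w = x} \<longrightarrow>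
    \<bar>(LINT w:B|M. (incr X t w)\<^sup>2) - s2 * prob B\<bar> \<le> e' / ln x * prob B"
    using set_integral_var [OF e'] by blast
  show ?thesis
    using rem appr eventually_ge_at_top [of x1] eventually_ge_at_top [of x2] eventually_gt_at_top [of 0]
  proof eventually_elim
    case (elim x)
    show ?case
    proof (intro allI ballI impI)
      fix t :: nat and B and G :: "real \<Rightarrow> real"
      assume t: "1 \<le> t" and B: "B \<in> sets (F t)" and Bx: "B \<subseteq> {w \<in> space M. X t w = x}"
        and Gm: "G \<in> borel_measurable borel" and Gb: "\<forall>z\<ge>0. \<bar>G z\<bar> \<le> Bd * (1 + z) powr b"
        and Gp: "\<forall>z\<in>{x / 2..3 * x / 2}. G z = plog a g z"
      have BM: "B \<in> sets M" using B t sets_F_subset by blast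
      have Gx: "G x = plog a g x" using Gp elim(5) by auto
      have iG: "integrable M (\<lambda>w. G (X u w))" if "1 \<le> u" for u
        using Gb ab Bd by (intro integrable_fun_X [OF that Gm]) auto
      let ?m1 = "LINT w:B|M. incr X t w" and ?m2 = "LINT w:B|M. (incr X t w)\<^sup>2"
        and ?mp = "LINT w:B|M. \<bar>incr X t w\<bar> powr p" and ?v = "LINT w:B|M. (G (X (Suc t) w) - G (X t w))"
      let ?R = "\<lambda>w. G (X (Suc t) w) - G (X t w) - plog1 a g x * incr X t w - plog2 a g x / 2 * (incr X t w)\<^sup>2"
      let ?E = "\<lambda>w. C * (x powr (a - 2 - h) * (incr X t w)\<^sup>2 + x powr (a - p + dl - h) * \<bar>incr X t w\<bar> powr p)"
      note ints = integrable_incr [OF t] integrable_powr_incr [OF t] iG [OF t] iG [of "Suc t"]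
      have iR: "set_integrable M B ?R"
        using ints BM by (intro set_integrable_restrict) auto
      have iE: "set_integrable M B ?E"
        using ints BM by (intro set_integrable_restrict) auto
      have R: "\<bar>?R w\<bar> \<le> ?E w" if "w \<in> B" for w
      proof -
        have w: "w \<in> space M" "X t w = x" using that Bx by auto
        have "X (Suc t) w \<ge> 0" using X_nonneg w by auto
        then have "\<bar>G (X (Suc t) w) - plog a g x - plog1 a g x * (X (Suc t) w - x) - plog2 a g x / 2 * (X (Suc t) w - x)\<^sup>2\<bar>
          \<le> C * (x powr (a - 2 - h) * (X (Suc t) w - x)\<^sup>2 + x powr (a - p + dl - h) * \<bar>X (Suc t) w - x\<bar> powr p)"
          using elim(1) Gp Gb by blast
        then show ?thesis by (simp add: incr_def w Gx)
      qed
      have up: "(LINT w:B|M. ?R w) \<le> (LINT w:B|M. ?E w)"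
        using R by (intro set_integral_mono iR iE) (auto simp: abs_le_iff)
      have lo: "(LINT w:B|M. - ?E w) \<le> (LINT w:B|M. ?R w)"
        using R iE unfolding set_integrable_def
        by (intro set_integral_mono iR) (auto simp: abs_le_iff set_integrable_def, fastforce)
      have Req: "(LINT w:B|M. ?R w) = ?v - plog1 a g x * ?m1 - plog2 a g x / 2 * ?m2"
      proof -
        have i1: "set_integrable M B (\<lambda>w. G (X (Suc t) w) - G (X t w))"
          and i2: "set_integrable M B (\<lambda>w. plog1 a g x * incr X t w)"
          and i3: "set_integrable M B (\<lambda>w. plog2 a g x / 2 * (incr X t w)\<^sup>2)"
          using ints BM by (auto intro!: set_integrable_restrict)
        show ?thesis
          using i1 i2 i3 by (simp add: set_integral_diff)
      qed
      have Eeq: "(LINT w:B|M. ?E w) = C * (x powr (a - 2 - h) * ?m2 + x powr (a - p + dl - h) * ?mp)"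
      proof -
        have "set_integrable M B (\<lambda>w. x powr (a - 2 - h) * (incr X t w)\<^sup>2)"
          "set_integrable M B (\<lambda>w. x powr (a - p + dl - h) * \<bar>incr X t w\<bar> powr p)"
          using ints BM by (auto intro!: set_integrable_restrict)
        then show ?thesis by (simp add: set_integral_add)
      qed
      have mE: "(LINT w:B|M. - ?E w) = - (LINT w:B|M. ?E w)" by (rule set_integral_uminus [OF iE])
      have "\<bar>?v - plog1 a g x * ?m1 - plog2 a g x / 2 * ?m2\<bar>
        \<le> C * (x powr (a - 2 - h) * ?m2 + x powr (a - p + dl - h) * ?mp)"
        using up lo unfolding mE Req Eeq by (simp add: abs_le_iff)
      moreover have "\<bar>?m1 - (- r * s2 / 2) / x * prob B\<bar> \<le> e' / (x * ln x) * prob B"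
        using x1 elim(3) t B Bx by blast
      moreover have "\<bar>?m2 - s2 * prob B\<bar> \<le> e' / ln x * prob B" using x2 elim(4) t B Bx by blast
      moreover have "?mp \<le> Cp * (1 + x) powr (p - 2 - dl) * prob B"
        by (rule set_integral_incr_powr [OF t B Bx])
      moreover have "0 \<le> prob B" by simp
      ultimately show "\<bar>?v - plog_gen (- r * s2 / 2) s2 a g x * prob B\<bar> \<le> e * plog (a - 2) (g - 1) x * prob B"
        using elim(2) by blast
    qed
  qed
qed

end

lemma plog_mono_eventually:
  assumes "0 < a"
  shows "\<exists>x0>1. \<forall>x z. x0 \<le> x \<longrightarrow> x \<le> z \<longrightarrow> plog a g x \<le> plog a g z"
proof (intro exI conjI allI impI)
  let ?x0 = "exp (1 + \<bar>g\<bar> / a)"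
  show "1 < ?x0" using assms by (simp add: add_pos_nonneg)
  fix x z assume h: "?x0 \<le> x" "x \<le> z"
  show "plog a g x \<le> plog a g z"
  proof (rule DERIV_nonneg_imp_nondecreasing [OF h(2)])
    fix y assume y: "x \<le> y" "y \<le> z"
    have y0: "?x0 \<le> y" using h y by simp
    have y1: "1 < y" using y0 \<open>1 < ?x0\<close> by linarith
    have "1 + \<bar>g\<bar> / a \<le> ln y" using y0 y1 by (simp add: ln_ge_iff)
    then have "a * (1 + \<bar>g\<bar> / a) \<le> a * ln y" using assms by (intro mult_left_mono) auto
    then have "0 \<le> a * ln y + g" using assms by (simp add: algebra_simps)
    then have "0 \<le> plog1 a g y" using y1 by (simp add: plog1_eq)
    then show "\<exists>d. DERIV (plog a g) y :> d \<and> 0 \<le> d" using plog_has_derivative1 [OF y1] by blast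
  qed
qed

lemma plog_antimono:
  assumes "1 < x" "x \<le> y" "a \<le> 0" "g \<le> 0" shows "plog a g y \<le> plog a g x"
  unfolding plog_def using assms by (intro mult_mono powr_mono2') auto

context near_critical_process
begin

text \<open>An upper bound on the conditional drift of \<open>G (X t)\<close> at level \<open>x\<close>. As the state space is countable,
  integrals over events on which \<open>X t\<close> is constant replace conditional expectations.\<close>

definition drift_le :: "(real \<Rightarrow> real) \<Rightarrow> real \<Rightarrow> real \<Rightarrow> bool" where
  "drift_le G x k \<longleftrightarrow> (\<forall>t\<ge>1. \<forall>B\<in>sets (F t). B \<subseteq> {w \<in> space M. X t w = x} \<longrightarrow>
     (LINT w:B|M. (G (X (Suc t) w) - G (X t w))) \<le> k * prob B)"

lemma drift_le_mono: "drift_le G x k \<Longrightarrow> k \<le> l \<Longrightarrow> drift_le G x l"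
  unfolding drift_le_def by (meson measure_nonneg mult_right_mono order_trans)

lemma drift_le_bounded:
  assumes Gm: "G \<in> borel_measurable borel" and G: "\<And>z. 0 \<le> z \<Longrightarrow> \<bar>G z\<bar> \<le> Bd * (1 + z) powr b"
    and b: "b \<le> p" and Bd: "0 \<le> Bd"
  shows "\<exists>K\<ge>0. \<forall>x\<in>S. x \<le> A \<longrightarrow> drift_le G x K"
proof -
  define K where "K = Bd * (2 powr p * ((1 + \<bar>A\<bar>) powr p + Cp * (1 + \<bar>A\<bar>) powr (p - 2 - dl)) + (1 + \<bar>A\<bar>) powr p)"
  have K0: "K \<ge> 0" unfolding K_def using Bd Cp by (intro mult_nonneg_nonneg add_nonneg_nonneg) auto
  have "(LINT w:B|M. (G (X (Suc t) w) - G (X t w))) \<le> K * prob B"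
    if x: "x \<in> S" "x \<le> A" and t: "1 \<le> t" and B: "B \<in> sets (F t)" "B \<subseteq> {w \<in> space M. X t w = x}" for x t B
  proof -
    have x0: "0 \<le> x" using x S_nonneg by auto
    have BM: "B \<in> sets M" using B t sets_F_subset by blast
    have iG: "integrable M (\<lambda>w. G (X u w))" if "1 \<le> u" for u
      by (rule integrable_fun_X [OF that Gm G b Bd])
    let ?c = "Bd * (2 powr p * (1 + x) powr p + (1 + x) powr p)"
    let ?E = "\<lambda>w. ?c + Bd * 2 powr p * (\<bar>incr X t w\<bar> powr p)"
    have pt: "G (X (Suc t) w) - G (X t w) \<le> ?E w" if "w \<in> B" for w
    proof -
      have w: "w \<in> space M" "X t w = x" using that B by auto
      have n: "0 \<le> X (Suc t) w" using X_nonneg w by auto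
      have "G (X (Suc t) w) \<le> Bd * (1 + X (Suc t) w) powr b" using G [OF n] by linarith
      also have "\<dots> \<le> Bd * (1 + X (Suc t) w) powr p" using Bd n b by (intro mult_left_mono powr_mono) auto
      also have "\<dots> \<le> Bd * ((1 + x) + \<bar>incr X t w\<bar>) powr p"
        using Bd n p_gt2 w by (intro mult_left_mono powr_mono2) (auto simp: incr_def)
      also have "\<dots> \<le> Bd * (2 powr p * ((1 + x) powr p + \<bar>incr X t w\<bar> powr p))"
        using Bd p_gt2 x0 by (intro mult_left_mono powr_add_le_two_powr) auto
      finally have 1: "G (X (Suc t) w) \<le> Bd * (2 powr p * ((1 + x) powr p + \<bar>incr X t w\<bar> powr p))" .
      have "- G x \<le> Bd * (1 + x) powr b" using G [OF x0] by linarith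
      also have "\<dots> \<le> Bd * (1 + x) powr p" using Bd x0 b by (intro mult_left_mono powr_mono) auto
      finally show ?thesis using 1 w by (simp add: algebra_simps)
    qed
    have ip: "set_integrable M B (\<lambda>w. Bd * 2 powr p * (\<bar>incr X t w\<bar> powr p))"
      using integrable_powr_incr [OF t] BM by (intro set_integrable_restrict) auto
    have ic: "set_integrable M B (\<lambda>w. ?c)" by (rule set_integrable_restrict [OF _ BM]) simp
    have "(LINT w:B|M. (G (X (Suc t) w) - G (X t w))) \<le> (LINT w:B|M. ?E w)"
      using pt iG t BM ip ic
      by (intro set_integral_mono set_integral_add(1)) (auto intro!: set_integrable_restrict)
    also have "\<dots> = ?c * prob B + Bd * 2 powr p * (LINT w:B|M. \<bar>incr X t w\<bar> powr p)"
      using set_integral_add(2) [OF ic ip] set_integral_prob [OF BM, of ?c] by simp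
    also have "\<dots> \<le> ?c * prob B + Bd * 2 powr p * (Cp * (1 + x) powr (p - 2 - dl) * prob B)"
      using set_integral_incr_powr [OF t B] Bd by (intro add_left_mono mult_left_mono) auto
    also have "\<dots> = (Bd * (2 powr p * ((1 + x) powr p + Cp * (1 + x) powr (p - 2 - dl)) + (1 + x) powr p)) * prob B"
      by (simp add: algebra_simps)
    also have "\<dots> \<le> K * prob B"
      unfolding K_def using Bd Cp x0 x dl p_gt2
      by (intro mult_right_mono mult_left_mono add_mono powr_mono2) auto
    finally show ?thesis .
  qed
  then show ?thesis using K0 unfolding drift_le_def by blast
qed

lemma drift_le_set:
  assumes t: "1 \<le> t" and B: "B \<in> sets (F t)" "B \<subseteq> {w \<in> space M. X t w < y}"
    and iG: "\<And>u. 1 \<le> u \<Longrightarrow> integrable M (\<lambda>w. G (X u w))"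
    and low: "\<And>x. x \<in> S \<Longrightarrow> x \<le> A \<Longrightarrow> drift_le G x K"
    and high: "\<And>x. x \<in> S \<Longrightarrow> A < x \<Longrightarrow> x < y \<Longrightarrow> drift_le G x (- k)"
  shows "(LINT w:B|M. (G (X (Suc t) w) - G (X t w)))
    \<le> K * prob (B \<inter> {w \<in> space M. X t w \<le> A}) - k * prob (B \<inter> {w \<in> space M. A < X t w})"
proof -
  have [measurable]: "X t \<in> borel_measurable M" using X_measurable t by auto
  have BM [measurable]: "B \<in> sets M" using B t sets_F_subset by blast
  let ?L = "{w \<in> space M. X t w \<le> A}" and ?H = "{w \<in> space M. A < X t w}"
  let ?h = "\<lambda>w. K * indicator ?L w - k * indicator ?H w :: real"
  let ?d = "\<lambda>w. G (X (Suc t) w) - G (X t w)"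
  have ih: "integrable M ?h"
    by (intro Bochner_Integration.integrable_diff integrable_mult_right integrable_real_indicator)
      (auto simp: emeasure_eq_measure)
  have id: "integrable M ?d" using iG t by auto
  have sub: "set_integrable M C ?d" "set_integrable M C ?h" if "C \<in> sets M" for C
    using that id ih set_integrable_restrict by blast+
  have hint: "(LINT w:C|M. ?h w) = K * prob (C \<inter> ?L) - k * prob (C \<inter> ?H)" if [measurable]: "C \<in> sets M" for C
  proof -
    have *: "(LINT w:C|M. indicator D w) = prob (C \<inter> D)" "set_integrable M C (indicator D :: 'a \<Rightarrow> real)"
      if [measurable]: "D \<in> sets M" for D
      unfolding set_lebesgue_integral_def set_integrable_def
      by (simp_all add: indicator_inter_arith [symmetric] integrable_real_indicator emeasure_eq_measure)
    have "(LINT w:C|M. ?h w) = (LINT w:C|M. K * indicator ?L w) - (LINT w:C|M. k * indicator ?H w)"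
      by (rule set_integral_diff(2)) (intro set_integrable_mult_right * ; measurable)+
    then show ?thesis by (simp add: *)
  qed
  have "(LINT w:B|M. ?d w - ?h w) \<le> 0"
  proof (rule set_integral_nonpos_by_levels [OF t B(1)])
    show "integrable M (\<lambda>w. ?d w - ?h w)" using id ih by (rule Bochner_Integration.integrable_diff)
    fix x assume x: "x \<in> S"
    let ?C = "B \<inter> {w \<in> space M. X t w = x}"
    have CF: "?C \<in> sets (F t)" using B level_set_F t by blast
    have CM: "?C \<in> sets M" using CF t sets_F_subset by blast
    have "(LINT w:?C|M. ?d w) \<le> (LINT w:?C|M. ?h w)"
    proof (cases "?C = {}")
      case True
      then show ?thesis by (simp add: set_lebesgue_integral_def)
    next
      case False
      then have xy: "x < y" using B(2) by auto
      show ?thesis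
      proof (cases "x \<le> A")
        case True
        have "?C \<inter> ?L = ?C" "?C \<inter> ?H = {}" using True by auto
        then show ?thesis unfolding hint [OF CM] using low [OF x True] CF t by (simp add: drift_le_def)
      next
        case nA: False
        have "?C \<inter> ?L = {}" "?C \<inter> ?H = ?C" using nA by auto
        then show ?thesis unfolding hint [OF CM] using high [OF x _ xy] nA CF t by (simp add: drift_le_def)
      qed
    qed
    then show "(LINT w:?C|M. ?d w - ?h w) \<le> 0" using set_integral_diff(2) [OF sub [OF CM]] by simp
  qed
  then show ?thesis using set_integral_diff(2) [OF sub [OF BM]] hint [OF BM] by simp
qed

text \<open>With \<open>\<tau>\<close> the first zero after time \<open>s\<close>, \<open>alive s t\<close> is the event \<open>\<tau> > t\<close>, and \<open>below s y t\<close> requires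
  in addition that the process stays below \<open>y\<close> from \<open>s\<close> to \<open>t\<close>.\<close>

definition below :: "nat \<Rightarrow> real \<Rightarrow> nat \<Rightarrow> 'a set" where
  "below s y t = {w \<in> space M. (\<forall>u\<in>{s<..t}. X u w \<noteq> 0) \<and> (\<forall>u\<in>{s..t}. X u w < y)}"

definition alive :: "nat \<Rightarrow> nat \<Rightarrow> 'a set" where
  "alive s t = {w \<in> space M. \<forall>u\<in>{s<..t}. X u w \<noteq> 0}"

lemma alive_F: "1 \<le> s \<Longrightarrow> s \<le> t \<Longrightarrow> alive s t \<in> sets (F t)"
proof -
  assume st: "1 \<le> s" "s \<le> t"
  have "{w \<in> space (F t). \<forall>u\<in>{s<..t}. X u w \<noteq> 0} \<in> sets (F t)"
  proof (cases "s < t")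
    case True
    show ?thesis
    proof (intro sets.sets_Collect_finite_All' sets.sets_Collect)
      fix u assume "u \<in> {s<..t}"
      then have [measurable]: "X u \<in> borel_measurable (F t)" using X_measurable_F st by auto
      show "{w \<in> space (F t). X u w = 0} \<in> sets (F t)" by measurable
    qed (use True in auto)
  qed simp
  then show ?thesis using st by (simp add: alive_def space_F)
qed

lemma below_F: "1 \<le> s \<Longrightarrow> s \<le> t \<Longrightarrow> below s y t \<in> sets (F t)"
proof -
  assume st: "1 \<le> s" "s \<le> t"
  have "{w \<in> space (F t). \<forall>u\<in>{s..t}. X u w < y} \<in> sets (F t)"
  proof (intro sets.sets_Collect_finite_All')
    fix u assume "u \<in> {s..t}"
    then have [measurable]: "X u \<in> borel_measurable (F t)" using X_measurable_F st by auto
    show "{w \<in> space (F t). X u w < y} \<in> sets (F t)" by measurable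
  qed (use st in auto)
  then have "alive s t \<inter> {w \<in> space (F t). \<forall>u\<in>{s..t}. X u w < y} \<in> sets (F t)"
    using alive_F [OF st] by blast
  moreover have "below s y t = alive s t \<inter> {w \<in> space (F t). \<forall>u\<in>{s..t}. X u w < y}"
    using st by (auto simp: below_def alive_def space_F)
  ultimately show ?thesis by simp
qed

lemma below_M: "1 \<le> s \<Longrightarrow> s \<le> t \<Longrightarrow> below s y t \<in> sets M"
  by (meson below_F sets_F_subset order_trans)

lemma alive_M: "1 \<le> s \<Longrightarrow> s \<le> t \<Longrightarrow> alive s t \<in> sets M"
  by (meson alive_F sets_F_subset order_trans)

lemma below_Suc: "below s y (Suc t) \<subseteq> below s y t"
  by (auto simp: below_def)

lemma below_antimono: "t \<le> t' \<Longrightarrow> below s y t' \<subseteq> below s y t"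
  by (auto simp: below_def)

text \<open>A visit at time \<open>u\<close> to a level at most \<open>A\<close> is followed, with probability at least \<open>q\<close>, by a zero
  within \<open>m\<close> steps; on each path this happens for at most \<open>m\<close> times \<open>u\<close> before the first zero.\<close>

lemma occupation_bound:
  "\<exists>K0\<ge>0. \<forall>s\<ge>1. \<forall>v\<ge>s. \<forall>y n. (\<Sum>u\<in>{v..<v+n}. prob (below s y u \<inter> {w \<in> space M. X u w \<le> A}))
     \<le> K0 * prob (below s y v)"
proof -
  define T where "T = insert 0 (S \<inter> {..A})"
  have finT: "finite T" using S_locfin by (simp add: T_def)
  have TS: "T \<subseteq> S" using S_zero by (auto simp: T_def)
  define m where "m = Max ((\<lambda>x. mm x 0) ` T)"
  define q where "q = Min ((\<lambda>x. phi x 0) ` T)"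
  have Tne: "T \<noteq> {}" by (auto simp: T_def)
  have m: "mm x 0 \<le> m" if "x \<in> T" for x using that finT by (simp add: m_def)
  have q: "q \<le> phi x 0" if "x \<in> T" for x using that finT by (simp add: q_def)
  have q0: "q > 0" using finT Tne TS phi_pos S_zero by (auto simp: q_def)
  have "(\<Sum>u\<in>{v..<v+n}. prob (below s y u \<inter> {w \<in> space M. X u w \<le> A})) \<le> (real m / q) * prob (below s y v)"
    if s: "1 \<le> s" and v: "s \<le> v" for s v n y
  proof -
    let ?Q = "below s y"
    define Z where "Z u = {w \<in> space M. \<exists>k\<in>{u<..u+m}. X k w = 0}" for u
    have lev: "{w \<in> space M. X u w = x} \<in> sets M" if "1 \<le> u" for u x
      using level_set_F sets_F_subset that by blast
    have ZM: "Z u \<in> sets M" for u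
    proof -
      have "Z u = (\<Union>k\<in>{u<..u+m}. {w \<in> space M. X k w = 0})" by (auto simp: Z_def)
      also have "\<dots> \<in> sets M" by (intro sets.finite_UN lev) auto
      finally show ?thesis .
    qed
    have QM: "?Q u \<in> sets M" if "v \<le> u" for u using below_M s v that by auto
    have step: "q * prob (?Q u \<inter> {w \<in> space M. X u w \<le> A}) \<le> prob (?Q u \<inter> Z u)" if u: "v \<le> u" for u
    proof -
      have u1: "1 \<le> u" using u s v by auto
      let ?E = "\<lambda>x. ?Q u \<inter> {w \<in> space M. X u w = x}"
      have EM: "?E x \<in> sets M" for x using QM [OF u] lev [OF u1] by blast
      have EF: "?E x \<in> sets (F u)" for x using below_F [OF s] level_set_F [OF u1] u v by auto
      have "prob (?Q u \<inter> {w \<in> space M. X u w \<le> A}) \<le> prob (\<Union>x\<in>T. ?E x)"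
      proof (rule finite_measure_mono)
        show "?Q u \<inter> {w \<in> space M. X u w \<le> A} \<subseteq> (\<Union>x\<in>T. ?E x)"
          using X_in_S [OF u1] by (auto simp: T_def)
      qed (use EM finT in \<open>intro sets.finite_UN\<close>)
      also have "\<dots> \<le> (\<Sum>x\<in>T. prob (?E x))"
        using EM finT by (intro finite_measure_subadditive_finite) auto
      finally have "q * prob (?Q u \<inter> {w \<in> space M. X u w \<le> A}) \<le> (\<Sum>x\<in>T. q * prob (?E x))"
        using q0 by (simp add: sum_distrib_left [symmetric])
      also have "\<dots> \<le> (\<Sum>x\<in>T. prob (?E x \<inter> Z u))"
      proof (rule sum_mono)
        fix x assume x: "x \<in> T"
        have "q * prob (?E x) \<le> phi x 0 * prob (?E x)" using q [OF x] by (intro mult_right_mono) auto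
        also have "\<dots> \<le> prob (?E x \<inter> {w \<in> space M. X (u + mm x 0) w = 0})"
          by (rule prob_hit_ge [OF u1 S_zero EF]) auto
        also have "\<dots> \<le> prob (?E x \<inter> Z u)"
        proof (intro finite_measure_mono)
          have "u + mm x 0 \<in> {u<..u+m}" using m [OF x] mm_ge [of x 0] x TS S_zero by fastforce
          then show "?E x \<inter> {w \<in> space M. X (u + mm x 0) w = 0} \<subseteq> ?E x \<inter> Z u" by (auto simp: Z_def)
        qed (use EM ZM in auto)
        finally show "q * prob (?E x) \<le> prob (?E x \<inter> Z u)" .
      qed
      also have "\<dots> = prob (\<Union>x\<in>T. ?E x \<inter> Z u)"
        using finT EM ZM by (intro finite_measure_finite_Union [symmetric]) (auto simp: disjoint_family_on_def)
      also have "\<dots> \<le> prob (?Q u \<inter> Z u)"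
        using QM [OF u] ZM by (intro finite_measure_mono) auto
      finally show ?thesis .
    qed
    have pt: "(\<Sum>u\<in>{v..<v+n}. indicator (?Q u \<inter> Z u) w) \<le> real m * indicator (?Q v) w" for w
    proof -
      let ?U = "{u \<in> {v..<v+n}. w \<in> ?Q u \<inter> Z u}"
      have eq: "(\<Sum>u\<in>{v..<v+n}. indicator (?Q u \<inter> Z u) w) = real (card ?U)"
        by (simp add: indicator_def sum.If_cases Int_def)
      show ?thesis
      proof (cases "?U = {}")
        case True
        then show ?thesis unfolding eq by (metis card.empty indicator_pos_le mult_nonneg_nonneg of_nat_0 of_nat_0_le_iff)
      next
        case False
        define u0 where "u0 = Min ?U"
        have u0: "u0 \<in> ?U" unfolding u0_def by (rule Min_in) (use False in auto)
        then obtain k where k: "u0 < k" "k \<le> u0 + m" "X k w = 0" by (auto simp: Z_def)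
        have "?U \<subseteq> {u0..<u0+m}"
        proof
          fix u assume u: "u \<in> ?U"
          have "u0 \<le> u" unfolding u0_def by (rule Min_le) (use u in auto)
          moreover have "u < k"
          proof (rule ccontr)
            assume "\<not> u < k"
            then have "k \<in> {s<..u}" using k u0 v by auto
            then show False using u k by (auto simp: below_def)
          qed
          ultimately show "u \<in> {u0..<u0+m}" using k by auto
        qed
        then have "card ?U \<le> m" using card_mono [of "{u0..<u0+m}" ?U] by auto
        moreover have "w \<in> ?Q v" using u0 below_antimono [of v u0 s y] by auto
        ultimately show ?thesis unfolding eq by simp
      qed
    qed
    have "q * (\<Sum>u\<in>{v..<v+n}. prob (?Q u \<inter> {w \<in> space M. X u w \<le> A})) \<le> (\<Sum>u\<in>{v..<v+n}. prob (?Q u \<inter> Z u))"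
      unfolding sum_distrib_left using step by (intro sum_mono) auto
    also have "\<dots> = (\<Sum>u\<in>{v..<v+n}. expectation (indicator (?Q u \<inter> Z u)))"
      using QM ZM by (intro sum.cong) auto
    also have "\<dots> = expectation (\<lambda>w. \<Sum>u\<in>{v..<v+n}. indicator (?Q u \<inter> Z u) w)"
      using QM ZM by (intro Bochner_Integration.integral_sum [symmetric] integrable_real_indicator)
        (auto simp: emeasure_eq_measure)
    also have "\<dots> \<le> expectation (\<lambda>w. real m * indicator (?Q v) w)"
      using QM ZM pt
      by (intro integral_mono Bochner_Integration.integrable_sum integrable_real_indicator integrable_mult_right)
        (auto simp: emeasure_eq_measure)
    also have "\<dots> = real m * prob (?Q v)" using QM [of v] by simp
    finally show ?thesis using q0 by (simp add: field_simps)
  qed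
  moreover have "real m / q \<ge> 0" using q0 by simp
  ultimately show ?thesis by blast
qed

lemma telescope_below:
  assumes s: "1 \<le> s" "s \<le> v" and iG: "\<And>u. 1 \<le> u \<Longrightarrow> integrable M (\<lambda>w. G (X u w) :: real)"
  shows "(LINT w:below s y (v + n)|M. G (X (v + n) w))
     + (\<Sum>u\<in>{v..<v+n}. LINT w:(below s y u - below s y (Suc u))|M. G (X (Suc u) w))
   = (LINT w:below s y v|M. G (X v w)) + (\<Sum>u\<in>{v..<v+n}. LINT w:below s y u|M. (G (X (Suc u) w) - G (X u w)))"
proof (induction n)
  case (Suc n)
  let ?u = "v + n" and ?Q = "below s y"
  have u: "1 \<le> ?u" "s \<le> ?u" using s by auto
  have QM: "?Q ?u \<in> sets M" "?Q (Suc ?u) \<in> sets M" using below_M s by auto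
  note si = set_integrable_restrict [OF iG]
  have "(LINT w:?Q ?u|M. G (X (Suc ?u) w)) =
      (LINT w:(?Q (Suc ?u) \<union> (?Q ?u - ?Q (Suc ?u)))|M. G (X (Suc ?u) w))"
    using below_Suc [of s y ?u] by (simp add: Un_absorb1)
  also have "\<dots> = (LINT w:?Q (Suc ?u)|M. G (X (Suc ?u) w)) + (LINT w:(?Q ?u - ?Q (Suc ?u))|M. G (X (Suc ?u) w))"
    using QM by (intro set_integral_Un si) auto
  finally have 1: "(LINT w:?Q ?u|M. G (X (Suc ?u) w)) =
    (LINT w:?Q (Suc ?u)|M. G (X (Suc ?u) w)) + (LINT w:(?Q ?u - ?Q (Suc ?u))|M. G (X (Suc ?u) w))" .
  have 2: "(LINT w:?Q ?u|M. (G (X (Suc ?u) w) - G (X ?u w)))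
      = (LINT w:?Q ?u|M. G (X (Suc ?u) w)) - (LINT w:?Q ?u|M. G (X ?u w))"
    using QM u by (intro set_integral_diff si) auto
  show ?case using Suc.IH 1 2 by simp
qed simp

end

section \<open>Upper bounds\<close>

lemma plog_max_bound:
  assumes "0 < a" "a < b"
  shows "\<exists>A0>1. (\<forall>x z. A0 \<le> x \<longrightarrow> x \<le> z \<longrightarrow> plog a g x \<le> plog a g z) \<and>
    (\<forall>z\<ge>0. plog a g (max z A0) \<le> A0 powr b * (1 + z) powr b)"
proof -
  obtain x0 where x0: "x0 > 1" "\<forall>x z. x0 \<le> x \<longrightarrow> x \<le> z \<longrightarrow> plog a g x \<le> plog a g z"
    using plog_mono_eventually [OF assms(1)] by blast
  obtain x1 where x1: "\<And>x. x \<ge> x1 \<Longrightarrow> plog a g x \<le> x powr (a + (b - a))"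
    using plog_le_powr [of "b - a" a g] assms unfolding eventually_at_top_linorder by auto
  define A0 where "A0 = max x0 x1"
  have A0: "A0 > 1" using x0 by (auto simp: A0_def)
  have "plog a g (max z A0) \<le> A0 powr b * (1 + z) powr b" if "z \<ge> 0" for z
  proof -
    have "plog a g (max z A0) \<le> (max z A0) powr b" using x1 [of "max z A0"] by (simp add: A0_def)
    also have "\<dots> \<le> (A0 * (1 + z)) powr b"
    proof (rule powr_mono2)
      have "z \<le> A0 * z" "A0 * 1 \<le> A0 * (1 + z)" using A0 that by (auto simp: mult_le_cancel_right1)
      then show "max z A0 \<le> A0 * (1 + z)" using A0 by (simp add: algebra_simps)
    qed (use assms A0 in auto)
    also have "\<dots> = A0 powr b * (1 + z) powr b" using A0 that by (simp add: powr_mult)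
    finally show ?thesis .
  qed
  moreover have "\<forall>x z. A0 \<le> x \<longrightarrow> x \<le> z \<longrightarrow> plog a g x \<le> plog a g z" using x0 by (auto simp: A0_def)
  ultimately show ?thesis using A0 by blast
qed

context near_critical_process
begin

lemma supermartingale_function:
  assumes a: "0 < a" "a \<le> 1 + r" and g: "g < 0"
  obtains A0 A k K where "1 < A0" "A0 \<le> A" "0 < k" "0 \<le> K"
    "\<forall>x z. A0 \<le> x \<longrightarrow> x \<le> z \<longrightarrow> plog a g x \<le> plog a g z"
    "\<forall>t\<ge>1. integrable M (\<lambda>w. plog a g (max (X t w) A0))"
    "\<forall>x\<in>S. x \<le> A \<longrightarrow> drift_le (\<lambda>z. plog a g (max z A0)) x K"
    "\<forall>x\<in>S. A < x \<longrightarrow>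
      drift_le (\<lambda>z. plog a g (max z A0)) x (- (k * plog (a - 2) (g - 1) x))"
proof -
  define b where "b = min p (a + dl / 4)"
  have b: "a < b" "b \<le> p" "b \<le> a + dl / 4" using a p_gt_r dl by (auto simp: b_def)
  obtain A0 where A0: "A0 > 1" and mono: "\<forall>x z. A0 \<le> x \<longrightarrow> x \<le> z \<longrightarrow> plog a g x \<le> plog a g z"
    and bd: "\<forall>z\<ge>0. plog a g (max z A0) \<le> A0 powr b * (1 + z) powr b"
    using plog_max_bound [OF a(1) b(1)] by blast
  let ?G = "\<lambda>z. plog a g (max z A0)"
  have Gm: "?G \<in> borel_measurable borel" by measurable
  have Gb: "\<bar>?G z\<bar> \<le> A0 powr b * (1 + z) powr b" if "0 \<le> z" for z using bd that by simp
  have iG: "integrable M (\<lambda>w. ?G (X t w))" if "1 \<le> t" for t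
    by (rule integrable_fun_X [OF that Gm Gb b(2)]) auto
  obtain k where k: "k > 0" and gen: "\<forall>\<^sub>F x in at_top. plog_gen (- r * s2 / 2) s2 a g x \<le> - k * plog (a - 2) (g - 1) x"
    using plog_gen_neg [OF g a s2_pos] by blast
  have k2: "0 < k / 2" and A0b: "0 \<le> A0 powr b" using k by auto
  have "\<forall>\<^sub>F x in at_top. drift_le ?G x (- (k / 2 * plog (a - 2) (g - 1) x))"
    using gen plog_drift_set [OF a(1) b A0b k2, of g] eventually_ge_at_top [of "2 * A0"]
  proof eventually_elim
    case (elim x)
    show ?case unfolding drift_le_def
    proof (intro allI ballI impI)
      fix t :: nat and B assume t: "1 \<le> t" and B: "B \<in> sets (F t)" "B \<subseteq> {w \<in> space M. X t w = x}"
      have d1: "\<bar>(LINT w:B|M. (?G (X (Suc t) w) - ?G (X t w))) - plog_gen (- r * s2 / 2) s2 a g x * prob B\<bar>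
          \<le> k / 2 * plog (a - 2) (g - 1) x * prob B"
      proof -
        have "\<forall>z\<in>{x / 2..3 * x / 2}. ?G z = plog a g z"
        proof
          fix z assume "z \<in> {x / 2..3 * x / 2}"
          then have "A0 \<le> z" using elim(3) by auto
          then show "?G z = plog a g z" by (simp add: max_absorb1)
        qed
        then show ?thesis using elim(2) t B Gm Gb by blast
      qed
      have d2: "plog_gen (- r * s2 / 2) s2 a g x * prob B \<le> - k * plog (a - 2) (g - 1) x * prob B"
        using elim(1) by (intro mult_right_mono) auto
      show "(LINT w:B|M. (?G (X (Suc t) w) - ?G (X t w))) \<le> - (k / 2 * plog (a - 2) (g - 1) x) * prob B"
      proof -
        have arith: "i \<le> - (k / 2 * w) * q" if "\<bar>i - v * q\<bar> \<le> k / 2 * w * q" "v * q \<le> - k * w * q" for i v w q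
        proof -
          have "k / 2 * w * q = (k * w * q) / 2" "- (k / 2 * w) * q = - ((k * w * q) / 2)" "- k * w * q = - (k * w * q)"
            by simp_all
          then show ?thesis using that by linarith
        qed
        show ?thesis by (rule arith [OF d1 d2])
      qed
    qed
  qed
  then obtain A1 where A1: "\<And>x. x \<ge> A1 \<Longrightarrow> drift_le ?G x (- (k / 2 * plog (a - 2) (g - 1) x))"
    unfolding eventually_at_top_linorder by blast
  define A where "A = max A0 A1"
  obtain K where K: "K \<ge> 0" "\<forall>x\<in>S. x \<le> A \<longrightarrow> drift_le ?G x K"
    using drift_le_bounded [OF Gm Gb b(2) A0b, of A] by blast
  show thesis
  proof (rule that [OF A0 _ k2 K(1)])
    show "\<forall>x\<in>S. A < x \<longrightarrow> drift_le ?G x (- (k / 2 * plog (a - 2) (g - 1) x))"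
      using A1 by (simp add: A_def)
  qed (use mono iG K(2) in \<open>auto simp: A_def\<close>)
qed

definition exceed :: "nat \<Rightarrow> real \<Rightarrow> nat \<Rightarrow> 'a set" where
  "exceed s y u = below s y u \<inter> {w \<in> space M. y \<le> X (Suc u) w}"

lemma exceed_F: "1 \<le> s \<Longrightarrow> s \<le> u \<Longrightarrow> exceed s y u \<in> sets (F (Suc u))"
proof -
  assume su: "1 \<le> s" "s \<le> u"
  have [measurable]: "X (Suc u) \<in> borel_measurable (F (Suc u))" using adapted by auto
  have "{w \<in> space (F (Suc u)). y \<le> X (Suc u) w} \<in> sets (F (Suc u))" by measurable
  moreover have "below s y u \<in> sets (F (Suc u))"
    using below_F [OF su] filt_mono [of u "Suc u"] su by auto
  ultimately show ?thesis using su by (auto simp: exceed_def space_F)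
qed

lemma exceed_M: "1 \<le> s \<Longrightarrow> s \<le> u \<Longrightarrow> exceed s y u \<in> sets M"
  by (rule sets_F_subset [OF _ exceed_F]) auto

lemma exceed_subset:
  assumes su: "s \<le> u" shows "exceed s y u \<subseteq> below s y u - below s y (Suc u)"
proof
  fix w assume w: "w \<in> exceed s y u"
  then have "\<not> X (Suc u) w < y" by (auto simp: exceed_def)
  then have "w \<notin> below s y (Suc u)" if "s \<le> Suc u" using that by (auto simp: below_def)
  then show "w \<in> below s y u - below s y (Suc u)" using w su by (auto simp: exceed_def)
qed

lemma exceed_disjoint:
  assumes "s \<le> u" "s \<le> v" "u \<noteq> v" shows "exceed s y u \<inter> exceed s y v = {}"
proof -
  have *: "exceed s y u \<inter> exceed s y v = {}" if "u < v" "s \<le> u" for u v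
    using exceed_subset [of s u y] exceed_subset [of s v y] below_antimono [of "Suc u" v s y] that by auto
  show ?thesis
  proof (cases "u < v")
    case True then show ?thesis using * assms by blast
  next
    case False then show ?thesis using * [of v u] assms by auto
  qed
qed

lemma alive_cover:
  "alive s (s + n) \<subseteq> below s y (s + n) \<union> {w \<in> space M. y \<le> X s w} \<union> (\<Union>u\<in>{s..<s+n}. exceed s y u)"
proof
  fix w assume w: "w \<in> alive s (s + n)"
  then have ws: "w \<in> space M" and nz: "\<And>u. s < u \<Longrightarrow> u \<le> s + n \<Longrightarrow> X u w \<noteq> 0" by (auto simp: alive_def)
  show "w \<in> below s y (s + n) \<union> {w \<in> space M. y \<le> X s w} \<union> (\<Union>u\<in>{s..<s+n}. exceed s y u)"
  proof (cases "\<exists>u. s \<le> u \<and> u \<le> s + n \<and> y \<le> X u w")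
    case False
    then have "w \<in> below s y (s + n)" using ws nz by (force simp: below_def)
    then show ?thesis by simp
  next
    case True
    define u where "u = (LEAST u. s \<le> u \<and> u \<le> s + n \<and> y \<le> X u w)"
    have u: "s \<le> u" "u \<le> s + n" "y \<le> X u w" using LeastI_ex [OF True] by (auto simp: u_def)
    have less: "X v w < y" if "s \<le> v" "v < u" for v
      using not_less_Least [of v "\<lambda>u. s \<le> u \<and> u \<le> s + n \<and> y \<le> X u w"] that u
      by (force simp: u_def [symmetric])
    show ?thesis
    proof (cases "u = s")
      case True then show ?thesis using u ws by auto
    next
      case False
      then obtain v where v: "u = Suc v" "s \<le> v" using u by (metis Suc_le_D le_antisym not_less_eq_eq)
      have "w \<in> exceed s y v" using v u ws nz less by (auto simp: exceed_def below_def)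
      then show ?thesis using v u by auto
    qed
  qed
qed

lemma below_subset: "s \<le> u \<Longrightarrow> below s y u \<subseteq> {w \<in> space M. X u w < y}"
  by (auto simp: below_def)

lemma markov_set:
  assumes D: "D \<in> sets M" and E: "E \<in> sets M" "E \<subseteq> D" and g: "integrable M g"
    and ge: "\<And>w. w \<in> E \<Longrightarrow> c \<le> g w" and nn: "\<And>w. w \<in> D \<Longrightarrow> 0 \<le> g w"
  shows "c * prob E \<le> (LINT w:D|M. g w :: real)"
proof -
  have "(LINT w:D|M. c * indicator E w) = (\<integral>w. c * indicator E w \<partial>M)"
    unfolding set_lebesgue_integral_def using E
    by (intro Bochner_Integration.integral_cong) (auto simp: indicator_def)
  also have "\<dots> = c * prob E" using E by simp
  finally have "c * prob E = (LINT w:D|M. c * indicator E w)" by (rule sym)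
  also have "\<dots> \<le> (LINT w:D|M. g w)"
  proof (rule set_integral_mono)
    show "set_integrable M D (\<lambda>w. c * indicator E w)"
      using E by (intro set_integrable_restrict D integrable_mult_right integrable_real_indicator)
        (auto simp: emeasure_eq_measure)
  qed (use set_integrable_restrict [OF g D] ge nn in \<open>auto simp: indicator_def\<close>)
  finally show ?thesis .
qed

lemma alive_le_below:
  assumes g: "g < 0"
  shows "\<exists>A0 C0. 1 < A0 \<and> 0 \<le> C0 \<and> (\<forall>t\<ge>1. integrable M (\<lambda>w. plog (1 + r) g (max (X t w) A0))) \<and>
    (\<forall>s\<ge>1. \<forall>y\<ge>A0. \<forall>n. prob (alive s (s + n)) \<le> prob (below s y (s + n)) +
       (2 * expectation (\<lambda>w. plog (1 + r) g (max (X s w) A0)) + C0) / plog (1 + r) g y)"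
proof -
  have r1: "0 < 1 + r" using r_gt by simp
  obtain A0 A k K where A0: "1 < A0" "A0 \<le> A" and k: "0 < k" and K: "0 \<le> K"
    and mono: "\<forall>x z. A0 \<le> x \<longrightarrow> x \<le> z \<longrightarrow> plog (1 + r) g x \<le> plog (1 + r) g z"
    and iG: "\<forall>t\<ge>1. integrable M (\<lambda>w. plog (1 + r) g (max (X t w) A0))"
    and low: "\<forall>x\<in>S. x \<le> A \<longrightarrow> drift_le (\<lambda>z. plog (1 + r) g (max z A0)) x K"
    and high: "\<forall>x\<in>S. A < x \<longrightarrow>
      drift_le (\<lambda>z. plog (1 + r) g (max z A0)) x (- (k * plog (1 + r - 2) (g - 1) x))"
    by (rule supermartingale_function [OF r1 order_refl g])
  note mono = mono [rule_format] and iG = iG [rule_format] and low = low [rule_format] and high = high [rule_format]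
  obtain K0 where K0: "K0 \<ge> 0" and occ: "\<And>s v y n. 1 \<le> s \<Longrightarrow> s \<le> v \<Longrightarrow>
      (\<Sum>u\<in>{v..<v+n}. prob (below s y u \<inter> {w \<in> space M. X u w \<le> A})) \<le> K0 * prob (below s y v)"
    using occupation_bound [of A] by blast
  let ?G = "\<lambda>z. plog (1 + r) g (max z A0)"
  have "prob (alive s (s + n)) \<le> prob (below s y (s + n)) +
       (2 * expectation (\<lambda>w. ?G (X s w)) + K * K0) / plog (1 + r) g y"
    if s: "1 \<le> s" and y: "A0 \<le> y" for s y n
  proof -
    let ?Q = "below s y"
    have QM: "?Q u \<in> sets M" if "s \<le> u" for u using below_M s that by auto
    have py: "plog (1 + r) g y > 0" using y A0 by (intro plog_pos) auto
    have Gy: "plog (1 + r) g y \<le> ?G z" if "y \<le> z" for z using mono [of y "max z A0"] y that by auto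
    have high0: "drift_le ?G x (- 0)" if "x \<in> S" "A < x" for x
      by (rule drift_le_mono [OF high [OF that]]) (use k in auto)
    have step: "(LINT w:?Q u|M. (?G (X (Suc u) w) - ?G (X u w))) \<le> K * prob (?Q u \<inter> {w \<in> space M. X u w \<le> A})"
      if u: "s \<le> u" for u
    proof -
      have "(LINT w:?Q u|M. (?G (X (Suc u) w) - ?G (X u w))) \<le> K * prob (?Q u \<inter> {w \<in> space M. X u w \<le> A})
          - 0 * prob (?Q u \<inter> {w \<in> space M. A < X u w})"
        by (rule drift_le_set [OF _ below_F [OF s u] below_subset [OF u] iG low high0]) (use s u in auto)
      then show ?thesis by simp
    qed
    let ?E = "expectation (\<lambda>w. ?G (X s w))"
    have init: "(LINT w:?Q s|M. ?G (X s w)) \<le> ?E"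
    proof -
      have "(LINT w:?Q s|M. ?G (X s w)) \<le> (LINT w:space M|M. ?G (X s w))"
        using QM [of s] iG [OF s] sets.sets_into_space [OF QM [of s]]
        unfolding set_lebesgue_integral_def
        by (intro integral_mono integrable_mult_indicator) (auto simp: indicator_def)
      then show ?thesis by (simp add: set_integral_space iG [OF s])
    qed
    have "plog (1 + r) g y * (\<Sum>u\<in>{s..<s+n}. prob (exceed s y u)) \<le>
        (\<Sum>u\<in>{s..<s+n}. LINT w:(?Q u - ?Q (Suc u))|M. ?G (X (Suc u) w))"
      unfolding sum_distrib_left
    proof (rule sum_mono)
      fix u assume u: "u \<in> {s..<s+n}"
      show "plog (1 + r) g y * prob (exceed s y u) \<le> (LINT w:(?Q u - ?Q (Suc u))|M. ?G (X (Suc u) w))"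
        using QM u exceed_M s exceed_subset iG Gy by (intro markov_set) (auto simp: exceed_def)
    qed
    also have "\<dots> \<le> (LINT w:?Q (s + n)|M. ?G (X (s + n) w)) + \<dots>"
      by (simp add: set_lebesgue_integral_def)
    also have "\<dots> = (LINT w:?Q s|M. ?G (X s w)) + (\<Sum>u\<in>{s..<s+n}. LINT w:?Q u|M. (?G (X (Suc u) w) - ?G (X u w)))"
      using telescope_below [OF s order_refl, of ?G] iG by simp
    also have "\<dots> \<le> ?E + (\<Sum>u\<in>{s..<s+n}. K * prob (?Q u \<inter> {w \<in> space M. X u w \<le> A}))"
      using init step by (intro add_mono sum_mono) auto
    also have "\<dots> \<le> ?E + K * (K0 * prob (?Q s))"
      unfolding sum_distrib_left [symmetric] using occ [OF s order_refl] K
      by (intro add_left_mono mult_left_mono)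
    also have "\<dots> \<le> ?E + K * K0"
      using K K0 mult_left_le [of "prob (?Q s)" "K * K0"] by (simp add: mult.assoc)
    finally have ex: "(\<Sum>u\<in>{s..<s+n}. prob (exceed s y u)) \<le> (?E + K * K0) / plog (1 + r) g y"
      using py by (simp add: field_simps)
    have sM: "{w \<in> space M. y \<le> X s w} \<in> sets M" using X_measurable [OF s] by measurable
    have ini: "prob {w \<in> space M. y \<le> X s w} \<le> ?E / plog (1 + r) g y"
    proof -
      have "plog (1 + r) g y * prob {w \<in> space M. y \<le> X s w} \<le> (LINT w:space M|M. ?G (X s w))"
        using sM iG [OF s] Gy by (intro markov_set) auto
      then show ?thesis using py by (simp add: set_integral_space iG [OF s] field_simps)
    qed
    have "prob (alive s (s + n)) \<le>
      prob (?Q (s + n) \<union> {w \<in> space M. y \<le> X s w} \<union> (\<Union>u\<in>{s..<s+n}. exceed s y u))"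
      using alive_cover QM sM exceed_M s by (intro finite_measure_mono) auto
    also have "\<dots> \<le> prob (?Q (s + n) \<union> {w \<in> space M. y \<le> X s w}) + prob (\<Union>u\<in>{s..<s+n}. exceed s y u)"
      using QM sM exceed_M s by (intro measure_Un_le) auto
    also have "\<dots> \<le> (prob (?Q (s + n)) + prob {w \<in> space M. y \<le> X s w}) + (\<Sum>u\<in>{s..<s+n}. prob (exceed s y u))"
      using QM sM exceed_M s by (intro add_mono measure_Un_le finite_measure_subadditive_finite) auto
    also have "\<dots> \<le> (prob (?Q (s + n)) + ?E / plog (1 + r) g y) + (?E + K * K0) / plog (1 + r) g y"
      using ex ini by (intro add_mono) auto
    also have "\<dots> = prob (?Q (s + n)) + (2 * ?E + K * K0) / plog (1 + r) g y"
      by (simp add: add_divide_distrib)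
    finally show ?thesis .
  qed
  then show ?thesis
    using K K0 A0(1) iG by (intro exI [of _ A0] exI [of _ "K * K0"] conjI allI impI) simp_all
qed

lemma below_decay:
  "\<exists>C1>0. \<forall>\<^sub>F y in at_top. \<forall>s\<ge>1. \<forall>v\<ge>s. \<forall>n. real n * prob (below s y (v + n)) \<le> C1 * y\<^sup>2 * ln y * prob (below s y v)"
    (is "\<exists>C1>0. ?P C1")
proof -
  define a where "a = min (1 + r) 2"
  have a: "0 < a" "a \<le> 1 + r" "a \<le> 2" using r_gt by (auto simp: a_def)
  have neg: "(- 1 :: real) < 0" by simp
  obtain A0 A k K where A0: "1 < A0" "A0 \<le> A" and k: "0 < k" and K: "0 \<le> K"
    and mono: "\<forall>x z. A0 \<le> x \<longrightarrow> x \<le> z \<longrightarrow> plog a (- 1) x \<le> plog a (- 1) z"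
    and iG: "\<forall>t\<ge>1. integrable M (\<lambda>w. plog a (- 1) (max (X t w) A0))"
    and low: "\<forall>x\<in>S. x \<le> A \<longrightarrow> drift_le (\<lambda>z. plog a (- 1) (max z A0)) x K"
    and high: "\<forall>x\<in>S. A < x \<longrightarrow>
      drift_le (\<lambda>z. plog a (- 1) (max z A0)) x (- (k * plog (a - 2) (- 1 - 1) x))"
    by (rule supermartingale_function [OF a(1,2) neg])
  note mono = mono [rule_format] and iG = iG [rule_format] and low = low [rule_format] and high = high [rule_format]
  obtain K0 where K0: "K0 \<ge> 0" and occ: "\<And>s v y n. 1 \<le> s \<Longrightarrow> s \<le> v \<Longrightarrow>
      (\<Sum>u\<in>{v..<v+n}. prob (below s y u \<inter> {w \<in> space M. X u w \<le> A})) \<le> K0 * prob (below s y v)"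
    using occupation_bound [of A] by blast
  let ?G = "\<lambda>z. plog a (- 1) (max z A0)"
  define C1 where "C1 = 1 / k + 1"
  have C1: "C1 > 0" using k by (simp add: C1_def add_pos_pos)
  have evs: "\<forall>\<^sub>F y in at_top. (plog a (- 1) y + K * K0) / (k * plog (a - 2) (- 2) y) + K0 \<le> C1 * y\<^sup>2 * ln y"
  proof -
    have 1: "\<forall>\<^sub>F y in at_top. K * K0 / k * (y powr (2 - a) * (ln y)\<^sup>2) + K0 \<le> y\<^sup>2 * ln y"
    proof -
      define D where "D = K * K0 / k + 1"
      have D: "0 < D" using K K0 k by (simp add: D_def add_nonneg_pos)
      have "\<forall>\<^sub>F y in at_top. D * (y powr (2 - a) * (ln y)\<^sup>2) \<le> y powr 2 * ln y / 2"
        using a(1) D by real_asymp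
      moreover have "\<forall>\<^sub>F y in at_top. K0 \<le> y\<^sup>2 * ln y / 2" by real_asymp
      ultimately show ?thesis using eventually_gt_at_top [of 0]
      proof eventually_elim
        case (elim y)
        have "K * K0 / k * (y powr (2 - a) * (ln y)\<^sup>2) \<le> D * (y powr (2 - a) * (ln y)\<^sup>2)"
          by (intro mult_right_mono) (auto simp: D_def)
        moreover have "y powr 2 = y\<^sup>2" using elim by simp
        ultimately show ?case using elim by simp
      qed
    qed
    show ?thesis using 1 eventually_gt_at_top [of 1]
    proof eventually_elim
      case (elim y)
      have L: "ln y > 0" using elim by simp
      have p1: "plog (a - 2) (- 2) y = 1 / (y powr (2 - a) * (ln y)\<^sup>2)"
        using L elim by (simp add: plog_def powr_minus powr_diff field_simps)
      have p2: "plog a (- 1) y * (y powr (2 - a) * (ln y)\<^sup>2) = y\<^sup>2 * ln y"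
        using L elim by (simp add: plog_def powr_minus powr_diff field_simps power2_eq_square)
      have "(plog a (- 1) y + K * K0) / (k * plog (a - 2) (- 2) y) + K0 =
          (plog a (- 1) y * (y powr (2 - a) * (ln y)\<^sup>2)) / k + (K * K0 / k * (y powr (2 - a) * (ln y)\<^sup>2) + K0)"
        unfolding p1 using k L elim by (simp add: field_simps)
      also have "\<dots> \<le> y\<^sup>2 * ln y / k + y\<^sup>2 * ln y" unfolding p2 using elim(1) by simp
      also have "\<dots> = C1 * y\<^sup>2 * ln y" by (simp add: C1_def algebra_simps)
      finally show ?case .
    qed
  qed
  have "?P C1"
    using evs eventually_gt_at_top [of A]
  proof eventually_elim
    case (elim y)
    have y: "A < y" "A0 < y" "1 < y" using elim A0 by auto
    define ky where "ky = k * plog (a - 2) (- 2) y"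
    have ky: "ky > 0" using k y by (simp add: ky_def plog_pos)
    show ?case
    proof (intro allI impI)
      fix s v n :: nat assume s: "1 \<le> s" and v: "s \<le> v"
      let ?Q = "below s y"
      have QM: "?Q u \<in> sets M" if "v \<le> u" for u using below_M s v that by auto
      have hi: "drift_le ?G x (- ky)" if "x \<in> S" "A < x" "x < y" for x
      proof (rule drift_le_mono [OF high])
        have "plog (a - 2) (- 2) y \<le> plog (a - 2) (- 2) x"
          using that A0 a by (intro plog_antimono) auto
        then show "- (k * plog (a - 2) (- 1 - 1) x) \<le> - ky" using k by (simp add: ky_def)
      qed (use that in auto)
      let ?L = "\<lambda>u. prob (?Q u \<inter> {w \<in> space M. X u w \<le> A})"
      let ?H = "\<lambda>u. prob (?Q u \<inter> {w \<in> space M. A < X u w})"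
      have step: "(LINT w:?Q u|M. (?G (X (Suc u) w) - ?G (X u w))) \<le> K * ?L u - ky * ?H u"
        if u: "v \<le> u" for u
      proof -
        have u': "s \<le> u" using u v by simp
        show ?thesis
          by (rule drift_le_set [OF _ below_F [OF s u'] below_subset [OF u'] iG low hi]) (use s u' in auto)
      qed
      have init: "(LINT w:?Q v|M. ?G (X v w)) \<le> plog a (- 1) y * prob (?Q v)"
      proof -
        have "(LINT w:?Q v|M. ?G (X v w)) \<le> (LINT w:?Q v|M. plog a (- 1) y)"
        proof (rule set_integral_mono)
          fix w assume "w \<in> ?Q v"
          then have "X v w < y" using v by (auto simp: below_def)
          then show "?G (X v w) \<le> plog a (- 1) y" using mono y by auto
        qed (use iG s v QM in \<open>auto intro!: set_integrable_restrict\<close>)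
        then show ?thesis using set_integral_prob [OF QM] by simp
      qed
      have "0 \<le> (LINT w:?Q (v + n)|M. ?G (X (v + n) w)) +
          (\<Sum>u\<in>{v..<v+n}. LINT w:(?Q u - ?Q (Suc u))|M. ?G (X (Suc u) w))"
        by (auto intro!: add_nonneg_nonneg sum_nonneg simp: set_lebesgue_integral_def)
      also have "\<dots> = (LINT w:?Q v|M. ?G (X v w)) + (\<Sum>u\<in>{v..<v+n}. LINT w:?Q u|M. (?G (X (Suc u) w) - ?G (X u w)))"
        using telescope_below [OF s v, of ?G] iG by simp
      also have "\<dots> \<le> plog a (- 1) y * prob (?Q v) + (\<Sum>u\<in>{v..<v+n}. K * ?L u - ky * ?H u)"
        using init step by (intro add_mono sum_mono) auto
      also have "\<dots> = plog a (- 1) y * prob (?Q v) + K * (\<Sum>u\<in>{v..<v+n}. ?L u) - ky * (\<Sum>u\<in>{v..<v+n}. ?H u)"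
        by (simp add: sum_subtractf sum_distrib_left)
      also have "\<dots> \<le> plog a (- 1) y * prob (?Q v) + K * (K0 * prob (?Q v)) - ky * (\<Sum>u\<in>{v..<v+n}. ?H u)"
        using occ [OF s v] K by (intro diff_right_mono add_left_mono mult_left_mono)
      finally have "ky * (\<Sum>u\<in>{v..<v+n}. ?H u) \<le> (plog a (- 1) y + K * K0) * prob (?Q v)"
        by (simp add: algebra_simps)
      then have H: "(\<Sum>u\<in>{v..<v+n}. ?H u) \<le> (plog a (- 1) y + K * K0) / ky * prob (?Q v)"
        using ky by (simp add: field_simps)
      have "real n * prob (?Q (v + n)) = (\<Sum>u\<in>{v..<v+n}. prob (?Q (v + n)))" by simp
      also have "\<dots> \<le> (\<Sum>u\<in>{v..<v+n}. ?L u + ?H u)"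
      proof (rule sum_mono)
        fix u assume u: "u \<in> {v..<v+n}"
        have u1: "1 \<le> u" using u s v by auto
        have [measurable]: "X u \<in> borel_measurable M" using X_measurable [OF u1] .
        have LM: "?Q u \<inter> {w \<in> space M. X u w \<le> A} \<in> sets M" "?Q u \<inter> {w \<in> space M. A < X u w} \<in> sets M"
          using QM [of u] u by (auto intro!: sets.Int)
        have "?Q (v + n) \<subseteq> (?Q u \<inter> {w \<in> space M. X u w \<le> A}) \<union> (?Q u \<inter> {w \<in> space M. A < X u w})"
          using below_antimono [of u "v + n" s y] u by (auto simp: below_def)
        then have "prob (?Q (v + n)) \<le> prob ((?Q u \<inter> {w \<in> space M. X u w \<le> A}) \<union> (?Q u \<inter> {w \<in> space M. A < X u w}))"
          using LM by (intro finite_measure_mono) auto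
        also have "\<dots> \<le> ?L u + ?H u" using LM by (intro measure_Un_le)
        finally show "prob (?Q (v + n)) \<le> ?L u + ?H u" .
      qed
      also have "\<dots> \<le> K0 * prob (?Q v) + (plog a (- 1) y + K * K0) / ky * prob (?Q v)"
        unfolding sum.distrib using occ [OF s v] H by (intro add_mono)
      also have "\<dots> = ((plog a (- 1) y + K * K0) / (k * plog (a - 2) (- 2) y) + K0) * prob (?Q v)"
        by (simp add: ky_def algebra_simps)
      also have "\<dots> \<le> C1 * y\<^sup>2 * ln y * prob (?Q v)" using elim(1) by (intro mult_right_mono) auto
      finally show "real n * prob (?Q (v + n)) \<le> C1 * y\<^sup>2 * ln y * prob (?Q v)" .
    qed
  qed
  then show ?thesis using C1 by blast
qed

lemma below_geometric:
  "\<exists>C1>0. \<forall>\<^sub>F y in at_top. \<forall>s\<ge>1. \<forall>n j. C1 * y\<^sup>2 * ln y \<le> real n \<longrightarrow> prob (below s y (s + j * n)) \<le> (1 / 2) ^ j"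
    (is "\<exists>C1>0. ?P C1")
proof -
  obtain C1 where C1: "C1 > 0" and ev: "\<forall>\<^sub>F y in at_top. \<forall>s\<ge>1. \<forall>v\<ge>s. \<forall>n.
      real n * prob (below s y (v + n)) \<le> C1 * y\<^sup>2 * ln y * prob (below s y v)"
    using below_decay by blast
  have "?P (2 * C1)"
    using ev eventually_gt_at_top [of 1]
  proof eventually_elim
    case (elim y)
    show ?case
    proof (intro allI impI)
      fix s n j :: nat assume s: "1 \<le> s" and n: "2 * C1 * y\<^sup>2 * ln y \<le> real n"
      have pos: "0 < C1 * y\<^sup>2 * ln y" using C1 elim by simp
      show "prob (below s y (s + j * n)) \<le> (1 / 2) ^ j"
      proof (induction j)
        case (Suc j)
        let ?v = "s + j * n"
        have "real n * prob (below s y (?v + n)) \<le> C1 * y\<^sup>2 * ln y * prob (below s y ?v)"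
          using elim(1) s by simp
        also have "\<dots> \<le> real n / 2 * prob (below s y ?v)" using n by (intro mult_right_mono) auto
        also have "\<dots> \<le> real n / 2 * (1 / 2) ^ j" using Suc.IH by (intro mult_left_mono) auto
        finally have "real n * prob (below s y (?v + n)) \<le> real n * (1 / 2) ^ Suc j" by simp
        moreover have "0 < real n" using pos n by linarith
        ultimately have "prob (below s y (?v + n)) \<le> (1 / 2) ^ Suc j" by simp
        then show ?case by (simp add: algebra_simps)
      qed simp
    qed
  qed
  moreover have "0 < 2 * C1" using C1 by simp
  ultimately show ?thesis by blast
qed

end

lemma plog_at_top: "0 < a \<Longrightarrow> filterlim (plog a g) at_top at_top"
  unfolding plog_def [abs_def] by real_asymp

context near_critical_process
begin

lemma alive_antimono: "t \<le> t' \<Longrightarrow> alive s t' \<subseteq> alive s t"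
  by (auto simp: alive_def)

lemma below_tendsto_0:
  "\<forall>\<^sub>F y in at_top. \<forall>s\<ge>1. (\<lambda>n. prob (below s y (s + n))) \<longlonglongrightarrow> 0"
proof -
  obtain C1 where "C1 > 0" and ev: "\<forall>\<^sub>F y in at_top. \<forall>s\<ge>1. \<forall>n j. C1 * y\<^sup>2 * ln y \<le> real n \<longrightarrow>
      prob (below s y (s + j * n)) \<le> (1 / 2) ^ j"
    using below_geometric by blast
  show ?thesis using ev
  proof eventually_elim
    case (elim y)
    show ?case
    proof (intro allI impI LIMSEQ_I)
      fix s :: nat and e :: real assume s: "1 \<le> s" and e: "0 < e"
      obtain n :: nat where n: "C1 * y\<^sup>2 * ln y \<le> real n" using real_arch_simple by blast
      obtain j where j: "(1 / 2 :: real) ^ j < e" using real_arch_pow_inv [OF e, of "1 / 2"] by auto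
      have "norm (prob (below s y (s + k)) - 0) < e" if k: "j * n \<le> k" for k
      proof -
        have "prob (below s y (s + k)) \<le> prob (below s y (s + j * n))"
          using k s below_M below_antimono by (intro finite_measure_mono) auto
        also have "\<dots> \<le> (1 / 2) ^ j" using elim s n by blast
        finally show ?thesis using j by simp
      qed
      then show "\<exists>no. \<forall>k\<ge>no. norm (prob (below s y (s + k)) - 0) < e" by blast
    qed
  qed
qed

lemma alive_tendsto_0:
  assumes s: "1 \<le> s" shows "(\<lambda>n. prob (alive s (s + n))) \<longlonglongrightarrow> 0"
proof (rule LIMSEQ_I)
  fix e :: real assume e: "0 < e"
  have neg: "(- 1 :: real) < 0" by simp
  obtain A0 C0 where C0: "0 \<le> C0"
    and al: "\<And>s y n. 1 \<le> s \<Longrightarrow> A0 \<le> y \<Longrightarrow> prob (alive s (s + n)) \<le> prob (below s y (s + n)) +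
       (2 * expectation (\<lambda>w. plog (1 + r) (- 1) (max (X s w) A0)) + C0) / plog (1 + r) (- 1) y"
    using alive_le_below [OF neg] by blast
  define D where "D = 2 * expectation (\<lambda>w. plog (1 + r) (- 1) (max (X s w) A0)) + C0"
  have "\<forall>\<^sub>F y in at_top. 2 * D / e + 1 \<le> plog (1 + r) (- 1) y"
    using plog_at_top [of "1 + r" "- 1"] r_gt unfolding filterlim_at_top by auto
  with below_tendsto_0 eventually_ge_at_top [of A0] eventually_gt_at_top [of 1]
  have "\<forall>\<^sub>F y in at_top. (\<lambda>n. prob (below s y (s + n))) \<longlonglongrightarrow> 0 \<and> A0 \<le> y \<and> D / plog (1 + r) (- 1) y < e / 2"
  proof eventually_elim
    case (elim y)
    have "plog (1 + r) (- 1) y > 0" using elim by (intro plog_pos)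
    moreover have "2 * D / e < plog (1 + r) (- 1) y" using elim by linarith
    ultimately have "D / plog (1 + r) (- 1) y < e / 2" using e by (simp add: field_simps)
    then show ?case using elim s by blast
  qed
  then obtain y where y: "(\<lambda>n. prob (below s y (s + n))) \<longlonglongrightarrow> 0" "A0 \<le> y" "D / plog (1 + r) (- 1) y < e / 2"
    using eventually_happens' [OF trivial_limit_at_top_linorder] by blast
  obtain no where no: "\<And>n. n \<ge> no \<Longrightarrow> norm (prob (below s y (s + n)) - 0) < e / 2"
    using LIMSEQ_D [OF y(1), of "e / 2"] e by auto
  have "norm (prob (alive s (s + n)) - 0) < e" if "n \<ge> no" for n
  proof -
    have "prob (alive s (s + n)) \<le> prob (below s y (s + n)) + D / plog (1 + r) (- 1) y"
      unfolding D_def by (rule al [OF s y(2)])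
    moreover have "prob (below s y (s + n)) < e / 2" using no [OF that] by simp
    ultimately have "prob (alive s (s + n)) < e" using y(3) by linarith
    then show ?thesis by simp
  qed
  then show "\<exists>no. \<forall>n\<ge>no. norm (prob (alive s (s + n)) - 0) < e" by blast
qed

lemma recurrent: "AE w in M. \<forall>s\<ge>1. \<exists>u>s. X u w = 0"
proof -
  have "AE w in M. 1 \<le> s \<longrightarrow> (\<exists>u>s. X u w = 0)" for s
  proof (cases "1 \<le> s")
    case True
    let ?N = "\<Inter>n. alive s (s + n)"
    have NM: "?N \<in> sets M" using alive_M [OF True] by (intro sets.countable_INT) auto
    have "prob ?N \<le> prob (alive s (s + n))" for n
      using alive_M [OF True] by (intro finite_measure_mono) auto
    then have "prob ?N \<le> 0"
      using LIMSEQ_le_const [OF alive_tendsto_0 [OF True], of "prob ?N"] by blast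
    then have "emeasure M ?N = 0" by (simp add: emeasure_eq_measure measure_le_0_iff)
    then have "?N \<in> null_sets M" using NM by auto
    moreover have "{w \<in> space M. \<not> (1 \<le> s \<longrightarrow> (\<exists>u>s. X u w = 0))} \<subseteq> ?N"
      by (auto simp: alive_def)
    ultimately show ?thesis by (rule AE_I')
  qed simp
  then show ?thesis by (simp add: AE_all_countable)
qed

lemma upper_tail:
  assumes e: "0 < e"
  shows "\<forall>\<^sub>F x in at_top. prob (alive 1 (nat \<lceil>x\<rceil>)) \<le> x powr (- (1 + r) / 2) * ln x powr (2 + r + e)"
proof -
  have r1: "0 < 1 + r" using r_gt by simp
  have ng: "- e / 2 < 0" using e by simp
  obtain A0 C0 where A0: "1 < A0" and C0: "0 \<le> C0"
    and al: "\<And>s y n. 1 \<le> s \<Longrightarrow> A0 \<le> y \<Longrightarrow> prob (alive s (s + n)) \<le> prob (below s y (s + n)) +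
       (2 * expectation (\<lambda>w. plog (1 + r) (- e / 2) (max (X s w) A0)) + C0) / plog (1 + r) (- e / 2) y"
    using alive_le_below [OF ng] by blast
  define D where "D = 2 * expectation (\<lambda>w. plog (1 + r) (- e / 2) (max (X 1 w) A0)) + C0"
  have D: "D \<ge> 0" unfolding D_def using C0 by simp
  obtain C1 where C1: "C1 > 0" and geo: "\<forall>\<^sub>F y in at_top. \<forall>s\<ge>1. \<forall>n j. C1 * y\<^sup>2 * ln y \<le> real n \<longrightarrow>
      prob (below s y (s + j * n)) \<le> (1 / 2) ^ j"
    using below_geometric by blast
  \<comment> \<open>any \<open>b > 1\<close> with \<open>b (1 + r) < 2 + r\<close> would do: the first makes the number of blocks grow faster
    than \<open>log x\<close>, the second keeps the power of the logarithm\<close>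
  define b where "b = 1 + 1 / (2 * (1 + r))"
  have b: "b > 1" using r1 by (simp add: b_def)
  have br: "b * (1 + r) = 3 / 2 + r" using r1 by (simp add: b_def field_simps)
  define y where "y x = sqrt x * ln x powr (- b)" for x :: real
  define bb where "bb = 2 * b - 1"
  have bb: "bb > 1" using b by (simp add: bb_def)
  have ylim: "filterlim y at_top at_top" unfolding y_def [abs_def] using b by real_asymp
  have yle: "\<forall>\<^sub>F x in at_top. y x \<le> x" unfolding y_def using b by real_asymp
  define rr where "rr = (1 + r) / 2"
  have rr: "rr > 0" using r1 by (simp add: rr_def)
  have e5: "\<forall>\<^sub>F x in at_top. (1 - (x - 1) / (C1 * x * ln x powr (- bb) + 1)) * ln 2 \<le> ln (1 / 2) - rr * ln x"
    using C1 bb rr by real_asymp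
  have e6: "\<forall>\<^sub>F x in at_top. D * ln x powr (3 / 2 + r + e / 2) \<le> 1 / 2 * ln x powr (2 + r + e)"
    using e r1 by real_asymp
  show ?thesis
    using eventually_compose_filterlim [OF geo ylim] eventually_compose_filterlim [OF eventually_ge_at_top [of A0] ylim]
      yle e5 e6 eventually_gt_at_top [of "exp 1"]
  proof eventually_elim
    case (elim x)
    have x1: "x > 1" using elim(6) one_le_exp_iff [of 1] by linarith
    have L: "ln x \<ge> 1" using elim(6) x1 by (simp add: ln_ge_iff)
    let ?L = "ln x" and ?y = "y x"
    have y1: "?y > 1" using elim(2) A0 by linarith
    have lny: "ln ?y \<le> ?L" "ln ?y > 0" using y1 elim(3) x1 by auto
    have ysq: "?y\<^sup>2 = x * ?L powr (- (2 * b))"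
    proof -
      have "(?L powr (- b))\<^sup>2 = ?L powr (- (2 * b))"
        unfolding power2_eq_square powr_add [symmetric] by simp
      then show ?thesis using x1 by (simp add: y_def power_mult_distrib)
    qed
    define n where "n = nat \<lceil>C1 * ?y\<^sup>2 * ln ?y\<rceil>"
    have cpos: "C1 * ?y\<^sup>2 * ln ?y > 0" using C1 y1 lny by simp
    have n1: "C1 * ?y\<^sup>2 * ln ?y \<le> real n" "real n \<le> C1 * ?y\<^sup>2 * ln ?y + 1"
      using cpos unfolding n_def by linarith+
    have npos: "real n > 0" using cpos n1 by linarith
    define nu where "nu = C1 * x * ?L powr (- bb) + 1"
    have "C1 * ?y\<^sup>2 * ln ?y \<le> C1 * ?y\<^sup>2 * ?L" using C1 lny by (intro mult_left_mono) auto
    also have "\<dots> = C1 * x * (?L powr (- (2 * b)) * ?L powr 1)" using L by (simp add: ysq)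
    also have "\<dots> = C1 * x * ?L powr (- bb)" unfolding powr_add [symmetric] bb_def by (simp add: algebra_simps)
    finally have nnu: "real n \<le> nu" using n1 by (simp add: nu_def)
    define j where "j = nat \<lfloor>(x - 1) / real n\<rfloor>"
    have q0: "0 \<le> (x - 1) / real n" using x1 npos by simp
    have j1: "real j \<le> (x - 1) / real n" "(x - 1) / real n - 1 \<le> real j"
      using q0 unfolding j_def by linarith+
    have jn: "real (1 + j * n) \<le> x"
      using j1(1) npos by (simp add: field_simps)
    have "1 + j * n \<le> nat \<lceil>x\<rceil>" using jn by linarith
    then have "prob (alive 1 (nat \<lceil>x\<rceil>)) \<le> prob (alive 1 (1 + j * n))"
      using alive_M [of 1 "1 + j * n"] alive_antimono by (intro finite_measure_mono) auto
    also have "\<dots> \<le> prob (below 1 ?y (1 + j * n)) + D / plog (1 + r) (- e / 2) ?y"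
      unfolding D_def by (rule al) (use elim in auto)
    also have "\<dots> \<le> (1 / 2) ^ j + D / plog (1 + r) (- e / 2) ?y"
      using elim(1) n1 by (intro add_right_mono) auto
    also have "\<dots> \<le> 1 / 2 * (x powr (- rr) * ?L powr (2 + r + e)) + 1 / 2 * (x powr (- rr) * ?L powr (2 + r + e))"
    proof (rule add_mono)
      have nupos: "0 < nu" using nnu npos by linarith
      have "(x - 1) / nu \<le> (x - 1) / real n" using x1 npos nnu by (intro divide_left_mono) auto
      then have "1 - (x - 1) / nu \<ge> - real j" using j1 by linarith
      then have "- real j * ln 2 \<le> (1 - (x - 1) / nu) * ln 2" by (intro mult_right_mono) auto
      also have "\<dots> \<le> ln (1 / 2) - rr * ?L" using elim(4) by (simp add: nu_def)
      finally have "exp (- real j * ln 2) \<le> exp (ln (1 / 2) - rr * ?L)" by simp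
      moreover have "exp (- real j * ln 2) = (1 / 2 :: real) ^ j"
        by (simp add: exp_minus exp_of_nat_mult power_one_over inverse_eq_divide)
      moreover have "exp (ln (1 / 2) - rr * ?L) = 1 / 2 * x powr (- rr)"
        using x1 by (simp add: exp_diff powr_def exp_minus field_simps)
      ultimately have "(1 / 2) ^ j \<le> 1 / 2 * x powr (- rr)" by simp
      also have "\<dots> \<le> 1 / 2 * (x powr (- rr) * ?L powr (2 + r + e))"
        using L e r1 ge_one_powr_ge_zero [of ?L "2 + r + e"] by (simp add: mult_le_cancel_left1)
      finally show "(1 / 2) ^ j \<le> 1 / 2 * (x powr (- rr) * ?L powr (2 + r + e))" .
    next
      have "?y powr (1 + r) = x powr rr * ?L powr (- (3 / 2 + r))"
      proof -
        have "?y powr (1 + r) = sqrt x powr (1 + r) * (?L powr (- b)) powr (1 + r)"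
          unfolding y_def by (rule powr_mult)
        also have "sqrt x powr (1 + r) = x powr rr"
          using x1 by (simp add: powr_half_sqrt [symmetric] powr_powr rr_def)
        also have "(?L powr (- b)) powr (1 + r) = ?L powr (- (3 / 2 + r))"
          by (simp add: powr_powr br [symmetric])
        finally show ?thesis .
      qed
      moreover have "?L powr (- e / 2) \<le> ln ?y powr (- e / 2)"
        using lny e by (intro powr_mono2') auto
      ultimately have "x powr rr * ?L powr (- (3 / 2 + r)) * ?L powr (- e / 2) \<le> plog (1 + r) (- e / 2) ?y"
        unfolding plog_def by (simp add: mult_left_mono)
      then have pl: "x powr rr * ?L powr (- (3 / 2 + r + e / 2)) \<le> plog (1 + r) (- e / 2) ?y"
        by (simp add: mult.assoc powr_add [symmetric])
      have pp: "0 < x powr rr * ?L powr (- (3 / 2 + r + e / 2))" using x1 L by simp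
      have "D / plog (1 + r) (- e / 2) ?y \<le> D / (x powr rr * ?L powr (- (3 / 2 + r + e / 2)))"
        using D pl pp by (intro divide_left_mono mult_pos_pos) auto
      also have "\<dots> = x powr (- rr) * (D * ?L powr (3 / 2 + r + e / 2))"
      proof -
        have inv: "D / (v * inverse u) = inverse v * (D * u)" for u v :: real by (simp add: divide_inverse)
        show ?thesis unfolding powr_minus [of ?L "3 / 2 + r + e / 2"] powr_minus [of x rr] by (rule inv)
      qed
      also have "\<dots> \<le> x powr (- rr) * (1 / 2 * ?L powr (2 + r + e))"
        using elim(5) by (intro mult_left_mono) auto
      finally show "D / plog (1 + r) (- e / 2) ?y \<le> 1 / 2 * (x powr (- rr) * ?L powr (2 + r + e))" by simp
    qed
    finally show ?case by (simp add: rr_def minus_divide_left)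
  qed
qed


section \<open>Lower bounds\<close>

lemma drift_le_set_all:
  assumes t: "1 \<le> t" and B: "B \<in> sets (F t)"
    and iG: "\<And>u. 1 \<le> u \<Longrightarrow> integrable M (\<lambda>w. G (X u w))"
    and dr: "\<And>x. x \<in> S \<Longrightarrow> drift_le G x k"
  shows "(LINT w:B|M. (G (X (Suc t) w) - G (X t w))) \<le> k * prob B"
proof -
  let ?d = "\<lambda>w. G (X (Suc t) w) - G (X t w)"
  have BM: "B \<in> sets M" using B t sets_F_subset by blast
  have id: "integrable M ?d" using iG t by auto
  have sub: "(LINT w:C|M. ?d w - k) = (LINT w:C|M. ?d w) - k * prob C" if "C \<in> sets M" for C
  proof -
    have "set_integrable M C (\<lambda>w. k)" by (rule set_integrable_restrict [OF _ that]) simp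
    then show ?thesis
      using set_integral_diff(2) [OF set_integrable_restrict [OF id that]] set_integral_prob [OF that, of k] by simp
  qed
  have "(LINT w:B|M. ?d w - k) \<le> 0"
  proof (rule set_integral_nonpos_by_levels [OF t B])
    show "integrable M (\<lambda>w. ?d w - k)" by (rule Bochner_Integration.integrable_diff [OF id]) simp
    fix x assume x: "x \<in> S"
    let ?C = "B \<inter> {w \<in> space M. X t w = x}"
    have CF: "?C \<in> sets (F t)" using B level_set_F t by blast
    have CM: "?C \<in> sets M" using CF t sets_F_subset by blast
    have "(LINT w:?C|M. ?d w) \<le> k * prob ?C" 
      by (rule dr [OF x, unfolded drift_le_def, rule_format, OF t CF]) auto
    then show "(LINT w:?C|M. ?d w - k) \<le> 0" using sub [OF CM] by simp
  qed
  then show ?thesis using sub [OF BM] by simp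
qed

text \<open>\<open>dip y\<close> equals 1 below \<open>y / 2\<close> and 0 above \<open>y\<close>; in between it is bounded by a function whose
  derivative is Lipschitz with constant of order \<open>1 / y\<^sup>2\<close>.\<close>

definition dip :: "real \<Rightarrow> real \<Rightarrow> real" where
  "dip y z = min 1 (4 * (max 0 (1 - z / y))\<^sup>2)"

lemma dip_bounds: "0 \<le> dip y z" "dip y z \<le> 1"
  by (auto simp: dip_def)

lemma dip_measurable [measurable]: "dip y \<in> borel_measurable borel"
  unfolding dip_def [abs_def] by measurable

lemma dip_increment:
  assumes "0 < y" "y / 2 < x"
  shows "dip y z - dip y x \<le> 4 * (- 2 * max 0 (1 - x / y) / y * (z - x) + (z - x)\<^sup>2 / y\<^sup>2)"
proof -
  define a where "a = 1 - x / y"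
  define b where "b = 1 - z / y"
  have ab: "(z - x) / y = a - b" using assms by (simp add: a_def b_def diff_divide_distrib)
  have "x / y > 1 / 2" using assms by (simp add: field_simps)
  then have "a \<le> 1 / 2" unfolding a_def by linarith
  then have a12: "max 0 a \<le> 1 / 2" by simp
  then have "(max 0 a)\<^sup>2 \<le> (1 / 2)\<^sup>2" by (intro power_mono) auto
  then have d1: "dip y x = 4 * (max 0 a)\<^sup>2" by (simp add: dip_def a_def power2_eq_square)
  have d2: "dip y z \<le> 4 * (max 0 b)\<^sup>2" by (simp add: dip_def b_def)
  have d3: "(max 0 b)\<^sup>2 - (max 0 a)\<^sup>2 \<le> - 2 * max 0 a * (a - b) + (a - b)\<^sup>2"
  proof (cases "a \<ge> 0")
    case True
    have "(max 0 b)\<^sup>2 \<le> b\<^sup>2" by (simp add: max_def)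
    also have "b\<^sup>2 = a\<^sup>2 - 2 * a * (a - b) + (a - b)\<^sup>2" by (simp add: power2_eq_square algebra_simps)
    finally show ?thesis using True by (simp add: max_def)
  next
    case False
    have "(max 0 b)\<^sup>2 \<le> (a - b)\<^sup>2"
    proof (cases "b \<ge> 0")
      case True
      then have "b\<^sup>2 \<le> (b - a)\<^sup>2" using False by (intro power_mono) auto
      then show ?thesis using True by (simp add: max_def power2_commute)
    qed (simp add: max_def)
    then show ?thesis using False by (simp add: max_def)
  qed
  have "u - v \<le> 4 * k" if "v = 4 * v'" "u \<le> 4 * u'" "u' - v' \<le> k" for u v k u' v' :: real
    using that by linarith
  from this [OF d1 d2 d3] have "dip y z - dip y x \<le> 4 * (- 2 * max 0 a * (a - b) + (a - b)\<^sup>2)" .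
  also have "\<dots> = 4 * (- 2 * max 0 a / y * (z - x) + (z - x)\<^sup>2 / y\<^sup>2)"
    by (simp add: ab [symmetric] power_divide)
  finally show ?thesis by (simp add: a_def)
qed

lemma dip_drift: "\<exists>C2>0. \<forall>\<^sub>F y in at_top. \<forall>x\<in>S. drift_le (dip y) x (C2 / y\<^sup>2)"
    (is "\<exists>C2>0. ?P C2")
proof -
  define kk where "kk = - r * s2 / 2"
  define c where "c = \<bar>kk\<bar> + 1"
  have c: "c > 0" by (simp add: c_def)
  define C2 where "C2 = 16 * c + 4 * (s2 + 1)"
  have C2: "C2 > 0" using c s2_pos by (simp add: C2_def add_pos_pos)
  obtain x1 where x1: "\<forall>x\<ge>x1. \<forall>t\<ge>1. \<forall>B\<in>sets (F t). B \<subseteq> {w \<in> space M. X t w = x} \<longrightarrow>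
    \<bar>(LINT w:B|M. incr X t w) - (- r * s2 / 2) / x * prob B\<bar> \<le> 1 / (x * ln x) * prob B"
    using set_integral_mean [OF zero_less_one] by blast
  note x1 = x1 [folded kk_def, rule_format]
  obtain x2 where x2: "\<forall>x\<ge>x2. \<forall>t\<ge>1. \<forall>B\<in>sets (F t). B \<subseteq> {w \<in> space M. X t w = x} \<longrightarrow>
    \<bar>(LINT w:B|M. (incr X t w)\<^sup>2) - s2 * prob B\<bar> \<le> 1 / ln x * prob B"
    using set_integral_var [OF zero_less_one] by blast
  note x2 = x2 [rule_format]
  have "?P C2"
    using eventually_ge_at_top [of "2 * x1"] eventually_ge_at_top [of "2 * x2"] eventually_gt_at_top [of "2 * exp 1"]
  proof eventually_elim
    case (elim y)
    have ypos: "y > 0" by (rule order_less_trans [OF _ elim(3)]) simp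
    show ?case
    proof
      fix x assume x: "x \<in> S"
      show "drift_le (dip y) x (C2 / y\<^sup>2)" unfolding drift_le_def
      proof (intro allI ballI impI)
        fix t :: nat and B assume t: "1 \<le> t" and B: "B \<in> sets (F t)" "B \<subseteq> {w \<in> space M. X t w = x}"
        have BM: "B \<in> sets M" using B t sets_F_subset by blast
        have iV: "integrable M (\<lambda>w. dip y (X u w))" if "1 \<le> u" for u
          using dip_bounds by (intro integrable_fun_X [OF that, of _ 1 0]) (use p_gt2 in auto)
        have iD: "set_integrable M B (\<lambda>w. dip y (X (Suc t) w) - dip y (X t w))"
          using iV t BM by (intro set_integrable_restrict) auto
        show "(LINT w:B|M. (dip y (X (Suc t) w) - dip y (X t w))) \<le> C2 / y\<^sup>2 * prob B"
        proof (cases "x \<le> y / 2")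
          case True
          have "1 / 2 \<le> 1 - x / y" using True ypos by (simp add: field_simps)
          then have "1 / 2 \<le> max 0 (1 - x / y)" by linarith
          then have "(1 / 2)\<^sup>2 \<le> (max 0 (1 - x / y))\<^sup>2" by (rule power_mono) simp
          moreover have "min 1 (4 * q) = 1" if "(1 / 2)\<^sup>2 \<le> q" for q :: real
            using that by (simp add: power2_eq_square min_def)
          ultimately have d1: "dip y x = 1" unfolding dip_def by blast
          have "(LINT w:B|M. (dip y (X (Suc t) w) - dip y (X t w))) \<le> (LINT w:B|M. 0)"
            using B(2) dip_bounds(2) d1 by (intro set_integral_mono iD) (auto simp: set_integrable_def)
          also have "\<dots> \<le> C2 / y\<^sup>2 * prob B" using C2 by simp
          finally show ?thesis .
        next
          case False
          then have x2y: "y / 2 < x" by simp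
          have xb: "x \<ge> x1" "x \<ge> x2" "x > exp 1" using x2y elim by auto
          have x1': "x > 1" using xb one_le_exp_iff [of 1] by linarith
          have L: "ln x \<ge> 1" using xb x1' by (simp add: ln_ge_iff)
          define a where "a = max 0 (1 - x / y)"
          have a: "0 \<le> a" "a \<le> 1" using ypos x1' by (auto simp: a_def)
          let ?E = "\<lambda>w. - (8 * a / y) * incr X t w + 4 / y\<^sup>2 * (incr X t w)\<^sup>2"
          have i1: "set_integrable M B (\<lambda>w. - (8 * a / y) * incr X t w)"
            using integrable_incr(1) [OF t] BM by (intro set_integrable_restrict integrable_mult_right) auto
          have i2: "set_integrable M B (\<lambda>w. 4 / y\<^sup>2 * (incr X t w)\<^sup>2)"
            using integrable_incr(2) [OF t] BM by (intro set_integrable_restrict integrable_mult_right) auto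
          have "(LINT w:B|M. (dip y (X (Suc t) w) - dip y (X t w))) \<le> (LINT w:B|M. ?E w)"
          proof (rule set_integral_mono [OF iD set_integral_add(1) [OF i1 i2]])
            fix w assume "w \<in> B"
            then have w: "X t w = x" using B by auto
            show "dip y (X (Suc t) w) - dip y (X t w) \<le> ?E w"
            proof -
              have eq: "4 * (- 2 * m / y * d + d\<^sup>2 / y\<^sup>2) = - (8 * m / y) * d + 4 / y\<^sup>2 * d\<^sup>2" for m d :: real
                by (simp add: algebra_simps)
              show ?thesis
                using dip_increment [OF ypos x2y, of "X (Suc t) w"] unfolding eq by (simp only: w incr_def a_def)
            qed
          qed
          also have "\<dots> = - (8 * a / y) * (LINT w:B|M. incr X t w) + 4 / y\<^sup>2 * (LINT w:B|M. (incr X t w)\<^sup>2)"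
            unfolding set_integral_add(2) [OF i1 i2] set_integral_mult_right by simp
          also have "\<dots> \<le> 8 / y * (2 * c / y * prob B) + 4 / y\<^sup>2 * ((s2 + 1) * prob B)"
          proof (rule add_mono)
            have "\<bar>LINT w:B|M. incr X t w\<bar> \<le> \<bar>kk / x * prob B\<bar> + 1 / (x * ln x) * prob B"
            proof -
              have "\<bar>i\<bar> \<le> \<bar>k\<bar> + l" if "\<bar>i - k\<bar> \<le> l" for i k l :: real using that by linarith
              from this [OF x1 [OF xb(1) t B]] show ?thesis .
            qed
            also have "\<dots> = (\<bar>kk\<bar> / x + 1 / (x * ln x)) * prob B"
            proof -
              have "\<bar>kk / x * prob B\<bar> = \<bar>kk\<bar> / x * prob B" using x1' by (simp add: abs_mult)
              then show ?thesis by (simp only: distrib_right)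
            qed
            also have "\<dots> \<le> (\<bar>kk\<bar> / x + 1 / x) * prob B"
              using x1' L by (intro mult_right_mono add_left_mono divide_left_mono) auto
            also have "\<dots> = c / x * prob B" by (simp add: c_def add_divide_distrib)
            also have "\<dots> \<le> 2 * c / y * prob B"
            proof (rule mult_right_mono)
              have "c * y \<le> c * (2 * x)" using c x2y by (intro mult_left_mono) auto
              then show "c / x \<le> 2 * c / y" using x1' ypos by (simp add: field_simps)
            qed simp
            finally have m: "\<bar>LINT w:B|M. incr X t w\<bar> \<le> 2 * c / y * prob B" .
            have "- (8 * a / y) * (LINT w:B|M. incr X t w) \<le> (8 * a / y) * \<bar>LINT w:B|M. incr X t w\<bar>"
            proof -
              have "(8 * a / y) * (- (LINT w:B|M. incr X t w)) \<le> (8 * a / y) * \<bar>LINT w:B|M. incr X t w\<bar>"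
                using a ypos by (intro mult_left_mono) auto
              then show ?thesis by simp
            qed
            also have "\<dots> \<le> 8 / y * (2 * c / y * prob B)"
              using m a ypos by (intro mult_mono divide_right_mono) auto
            finally show "- (8 * a / y) * (LINT w:B|M. incr X t w) \<le> 8 / y * (2 * c / y * prob B)" .
          next
            have "1 / ln x * prob B \<le> 1 * prob B" using L by (intro mult_right_mono) auto
            then have "(LINT w:B|M. (incr X t w)\<^sup>2) \<le> (s2 + 1) * prob B"
            proof -
              assume v: "1 / ln x * prob B \<le> 1 * prob B"
              have "m \<le> (s2 + 1) * q" if "\<bar>m - s2 * q\<bar> \<le> l" "l \<le> 1 * q" for m l q
              proof -
                have "(s2 + 1) * q = s2 * q + q" by (simp add: distrib_right)
                then show ?thesis using that by linarith
              qed
              from this [OF x2 [OF xb(2) t B] v] show ?thesis .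
            qed
            then show "4 / y\<^sup>2 * (LINT w:B|M. (incr X t w)\<^sup>2) \<le> 4 / y\<^sup>2 * ((s2 + 1) * prob B)"
              by (intro mult_left_mono) auto
          qed
          also have "\<dots> = C2 / y\<^sup>2 * prob B"
            using ypos by (simp add: C2_def field_simps power2_eq_square)
          finally show ?thesis .
        qed
      qed
    qed
  qed
  then show ?thesis using C2 by blast
qed

lemma survival:
  "\<exists>C2>0. \<forall>\<^sub>F y in at_top. \<forall>t\<ge>1. \<forall>B\<in>sets (F t). B \<subseteq> {w \<in> space M. y \<le> X t w} \<longrightarrow>
     (\<forall>n. prob (B - alive t (t + n)) \<le> C2 / y\<^sup>2 * real n * prob B)"
    (is "\<exists>C2>0. ?P C2")
proof -
  obtain C2 where C2: "C2 > 0" and ev: "\<forall>\<^sub>F y in at_top. \<forall>x\<in>S. drift_le (dip y) x (C2 / y\<^sup>2)"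
    using dip_drift by blast
  have "?P C2"
    using ev eventually_gt_at_top [of 0]
  proof eventually_elim
    case (elim y)
    have iV: "integrable M (\<lambda>w. dip y (X u w))" if "1 \<le> u" for u
      using dip_bounds by (intro integrable_fun_X [OF that, of _ 1 0]) (use p_gt2 in auto)
    note siV = set_integrable_restrict [OF iV]
    show ?case
    proof (intro allI ballI impI)
      fix t :: nat and B n assume t: "1 \<le> t" and B: "B \<in> sets (F t)" "B \<subseteq> {w \<in> space M. y \<le> X t w}"
      have BM: "B \<in> sets M" using B t sets_F_subset by blast
      define Q where "Q n = B \<inter> alive t (t + n)" for n
      have QF: "Q n \<in> sets (F (t + n))" for n
        using alive_F [OF t] B(1) filt_mono [OF t, of "t + n"] by (auto simp: Q_def)
      have QM: "Q n \<in> sets M" for n using QF [of n] sets_F_subset [of "t + n"] t by auto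
      have QS: "Q (Suc n) \<subseteq> Q n" for n by (auto simp: Q_def alive_def)
      have main: "(LINT w:Q n|M. dip y (X (t + n) w)) + prob (B - Q n) \<le> C2 / y\<^sup>2 * real n * prob B" for n
      proof (induction n)
        case 0
        have "Q 0 = B" using BM sets.sets_into_space by (auto simp: Q_def alive_def)
        moreover have "(LINT w:B|M. dip y (X t w)) = (LINT w:B|M. 0)"
        proof (rule set_lebesgue_integral_cong [OF BM], intro allI impI)
          fix w assume "w \<in> B"
          then have "1 \<le> X t w / y" using B elim(2) by auto
          then show "dip y (X t w) = 0" by (simp add: dip_def max_def)
        qed
        ultimately show ?case by simp
      next
        case (Suc n)
        let ?u = "t + n"
        have u: "1 \<le> ?u" using t by simp
        have "(LINT w:Q n|M. (dip y (X (Suc ?u) w) - dip y (X ?u w))) \<le> C2 / y\<^sup>2 * prob (Q n)"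
          by (rule drift_le_set_all [OF u QF iV]) (use elim in auto)
        moreover have "C2 / y\<^sup>2 * prob (Q n) \<le> C2 / y\<^sup>2 * prob B"
          using C2 BM by (intro mult_left_mono finite_measure_mono) (auto simp: Q_def)
        moreover have "(LINT w:Q n|M. (dip y (X (Suc ?u) w) - dip y (X ?u w))) =
            (LINT w:Q n|M. dip y (X (Suc ?u) w)) - (LINT w:Q n|M. dip y (X ?u w))"
          using u QM by (intro set_integral_diff siV) auto
        moreover have "(LINT w:Q n|M. dip y (X (Suc ?u) w)) =
            (LINT w:Q (Suc n)|M. dip y (X (Suc ?u) w)) + prob (Q n - Q (Suc n))"
        proof -
          have "Q n = Q (Suc n) \<union> (Q n - Q (Suc n))" using QS [of n] by auto
          then have "(LINT w:Q n|M. dip y (X (Suc ?u) w)) =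
              (LINT w:(Q (Suc n) \<union> (Q n - Q (Suc n)))|M. dip y (X (Suc ?u) w))" by simp
          also have "\<dots> = (LINT w:Q (Suc n)|M. dip y (X (Suc ?u) w)) + (LINT w:(Q n - Q (Suc n))|M. dip y (X (Suc ?u) w))"
            using QM by (intro set_integral_Un siV) auto
          also have "(LINT w:(Q n - Q (Suc n))|M. dip y (X (Suc ?u) w)) = (LINT w:(Q n - Q (Suc n))|M. 1)"
          proof (rule set_lebesgue_integral_cong, goal_cases)
            case 1 then show ?case using QM by auto
          next
            case 2
            show ?case
            proof (intro allI impI)
              fix w assume w: "w \<in> Q n - Q (Suc n)"
              then obtain k where "k \<in> {t<..t + Suc n}" "X k w = 0" "\<forall>k\<in>{t<..t + n}. X k w \<noteq> 0"
                by (auto simp: Q_def alive_def)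
              moreover from this have "k = Suc ?u" by (metis add_Suc_right greaterThanAtMost_iff le_Suc_eq)
              ultimately have "X (Suc ?u) w = 0" by simp
              then show "dip y (X (Suc ?u) w) = 1" by (simp add: dip_def)
            qed
          qed
          also have "\<dots> = prob (Q n - Q (Suc n))" using set_integral_prob [of "Q n - Q (Suc n)" 1] QM by auto
          finally show ?thesis .
        qed
        moreover have "prob (B - Q (Suc n)) = prob (B - Q n) + prob (Q n - Q (Suc n))"
        proof -
          have "B - Q (Suc n) = (B - Q n) \<union> (Q n - Q (Suc n))" using QS [of n] by (auto simp: Q_def)
          then show ?thesis using QM BM by (auto intro!: finite_measure_Union)
        qed
        moreover have "C2 / y\<^sup>2 * real (Suc n) * prob B = C2 / y\<^sup>2 * real n * prob B + C2 / y\<^sup>2 * prob B"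
          by (simp add: algebra_simps add_divide_distrib)
        ultimately show ?case using Suc.IH by simp
      qed
      have nn: "0 \<le> (LINT w:Q n|M. dip y (X (t + n) w))"
        using dip_bounds by (simp add: set_lebesgue_integral_def)
      have "B - Q n = B - alive t (t + n)" by (auto simp: Q_def)
      then show "prob (B - alive t (t + n)) \<le> C2 / y\<^sup>2 * real n * prob B"
        using main [of n] nn by simp
    qed
  qed
  then show ?thesis using C2 by blast
qed


lemma exceed_lower:
  assumes g: "0 < g" and reach: "\<And>z. \<exists>t\<ge>1. 0 < prob (alive 1 t \<inter> {w \<in> space M. z \<le> X t w})"
  shows "\<exists>k>0. \<forall>\<^sub>F y in at_top. \<exists>n. k / plog (1 + r) g (2 * y) \<le> (\<Sum>u\<in>{1..<1+n}. prob (exceed 1 y u))"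
proof -
  define a where "a = 1 + r"
  have a: "0 < a" "a < p" using r_gt p_gt_r by (auto simp: a_def)
  define b where "b = min p (a + dl / 4)"
  have b: "a < b" "b \<le> p" "b \<le> a + dl / 4" using a dl by (auto simp: b_def)
  obtain A0 where A0: "A0 > 1" and mono: "\<And>x z. A0 \<le> x \<Longrightarrow> x \<le> z \<Longrightarrow> plog a g x \<le> plog a g z"
    and bd: "\<And>z. 0 \<le> z \<Longrightarrow> plog a g (max z A0) \<le> A0 powr b * (1 + z) powr b"
    using plog_max_bound [OF a(1) b(1)] by blast
  let ?P = "\<lambda>y z. plog a g (min (max z A0) (2 * y))"
  obtain k where k: "k > 0" and gen: "\<forall>\<^sub>F x in at_top. k * plog (a - 2) (g - 1) x \<le> plog_gen (- r * s2 / 2) s2 a g x"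
    using plog_gen_pos [OF g, of r s2] a s2_pos unfolding a_def by auto
  have A0b: "0 \<le> A0 powr b" by simp
  have "\<forall>\<^sub>F x in at_top. \<forall>y>x. drift_le (\<lambda>z. - ?P y z) x 0"
    using gen plog_drift_set [OF a(1) b A0b k, of g] eventually_ge_at_top [of "2 * A0"]
  proof eventually_elim
    case (elim x)
    show ?case unfolding drift_le_def
    proof (intro allI ballI impI)
      fix y :: real and u :: nat and B
      assume y: "x < y" and t: "1 \<le> u" and B: "B \<in> sets (F u)" "B \<subseteq> {w \<in> space M. X u w = x}"
      have Pm: "?P y \<in> borel_measurable borel" by measurable
      have Pb: "\<forall>z\<ge>0. \<bar>?P y z\<bar> \<le> A0 powr b * (1 + z) powr b"
      proof (intro allI impI)
        fix z :: real assume z: "0 \<le> z"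
        have "?P y z \<le> plog a g (max z A0)" using A0 y elim(3) by (intro mono) auto
        then show "\<bar>?P y z\<bar> \<le> A0 powr b * (1 + z) powr b" using bd [OF z] by simp
      qed
      have Pe: "\<forall>z\<in>{x / 2..3 * x / 2}. ?P y z = plog a g z"
      proof
        fix z assume "z \<in> {x / 2..3 * x / 2}"
        then have "A0 \<le> z" "z \<le> 2 * y" using elim(3) y A0 by auto
        then show "?P y z = plog a g z" by (simp add: max_absorb1 min_absorb1)
      qed
      let ?v = "LINT w:B|M. (?P y (X (Suc u) w) - ?P y (X u w))"
      have "\<bar>?v - plog_gen (- r * s2 / 2) s2 a g x * prob B\<bar> \<le> k * plog (a - 2) (g - 1) x * prob B"
        using elim(2) t B Pm Pb Pe by blast
      moreover have "k * plog (a - 2) (g - 1) x * prob B \<le> plog_gen (- r * s2 / 2) s2 a g x * prob B"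
        using elim(1) by (intro mult_right_mono) auto
      ultimately have "0 \<le> ?v" by linarith
      moreover have "(LINT w:B|M. (- ?P y (X (Suc u) w) - - ?P y (X u w))) = - ?v"
      proof -
        have "integrable M (\<lambda>w. ?P y (X v w))" if "1 \<le> v" for v
          using Pb b by (intro integrable_fun_X [OF that Pm, of "A0 powr b" b]) auto
        then have "set_integrable M B (\<lambda>w. ?P y (X (Suc u) w) - ?P y (X u w))"
          using t B sets_F_subset by (intro set_integrable_restrict Bochner_Integration.integrable_diff) auto
        from set_integral_uminus [OF this] show ?thesis by simp
      qed
      ultimately show "(LINT w:B|M. (- ?P y (X (Suc u) w) - - ?P y (X u w))) \<le> 0 * prob B" by simp
    qed
  qed
  then obtain A1 where A1: "\<And>x y. x \<ge> A1 \<Longrightarrow> x < y \<Longrightarrow> drift_le (\<lambda>z. - ?P y z) x 0"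
    unfolding eventually_at_top_linorder by blast
  define A where "A = max A0 A1"
  have A: "A \<ge> A0" "A \<ge> A1" "A > 1" using A0 by (auto simp: A_def)
  have "\<forall>\<^sub>F z in at_top. plog a g A + 1 \<le> plog a g z"
    using plog_at_top [OF a(1), of g] unfolding filterlim_at_top by blast
  then obtain z where z: "plog a g A + 1 \<le> plog a g z" "z \<ge> A"
    using eventually_happens' [OF trivial_limit_at_top_linorder eventually_conj [OF _ eventually_ge_at_top [of A]]]
    by blast
  obtain t where t: "1 \<le> t" and q: "0 < prob (alive 1 t \<inter> {w \<in> space M. z \<le> X t w})"
    using reach by blast
  define q where "q = prob (alive 1 t \<inter> {w \<in> space M. z \<le> X t w})"
  define gz where "gz = plog a g z - plog a g A"
  have gz: "gz \<ge> 1" using z by (simp add: gz_def)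
  have kq: "gz * q > 0" using gz q by (simp add: q_def)
  have "\<forall>\<^sub>F y in at_top. \<exists>n. gz * q / 2 / plog a g (2 * y) \<le> (\<Sum>u\<in>{1..<1+n}. prob (exceed 1 y u))"
    using below_tendsto_0 eventually_gt_at_top [of z]
  proof eventually_elim
    case (elim y)
    have y: "y > z" "y > A" "y > 1" "y > A0" using elim z A by auto
    \<comment> \<open>vanishing on \<open>[0, A]\<close>, so that stopping at the zeros costs nothing\<close>
    define G where "G x = max 0 (?P y x - plog a g A)" for x
    have [measurable]: "G \<in> borel_measurable borel" unfolding G_def [abs_def] by measurable
    have G0: "0 \<le> G x" for x by (simp add: G_def)
    have GA: "G x = 0" if "x \<le> A" for x
    proof -
      have "?P y x \<le> plog a g A" using that A y A0 by (intro mono) auto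
      then show ?thesis by (simp add: G_def)
    qed
    have Gy: "G x \<le> plog a g (2 * y)" for x
    proof -
      have "?P y x \<le> plog a g (2 * y)" using y A0 by (intro mono) auto
      then show ?thesis using plog_nonneg [of a g A] plog_nonneg [of a g "2 * y"] unfolding G_def by linarith
    qed
    have Gz: "gz \<le> G x" if "z \<le> x" for x
    proof -
      have "plog a g z \<le> ?P y x" using that z A y A0 by (intro mono) auto
      then show ?thesis by (simp add: G_def gz_def)
    qed
    have iG: "integrable M (\<lambda>w. G (X u w))" if "1 \<le> u" for u
      using G0 Gy p_gt2 by (intro integrable_fun_X [OF that, of _ "plog a g (2 * y)" 0]) auto
    have imG: "integrable M (\<lambda>w. - G (X u w))" if "1 \<le> u" for u using iG that by simp
    have dr: "drift_le (\<lambda>x. - G x) x 0" if x: "x \<in> S" "x < y" for x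
    proof (cases "x \<le> A")
      case True
      show ?thesis unfolding drift_le_def
      proof (intro allI ballI impI)
        fix u B assume u: "1 \<le> u" and B: "B \<in> sets (F u)" "B \<subseteq> {w \<in> space M. X u w = x}"
        have BM: "B \<in> sets M" using B u sets_F_subset by blast
        have "(LINT w:B|M. (- G (X (Suc u) w) - - G (X u w))) \<le> (LINT w:B|M. 0)"
        proof (rule set_integral_mono)
          show "set_integrable M B (\<lambda>w. - G (X (Suc u) w) - - G (X u w))"
            using u by (intro set_integrable_restrict BM Bochner_Integration.integrable_diff imG) auto
          fix w assume "w \<in> B"
          then have "G (X u w) = 0" using B GA True by auto
          then show "- G (X (Suc u) w) - - G (X u w) \<le> 0" using G0 by simp
        qed (simp add: set_integrable_def)
        then show "(LINT w:B|M. (- G (X (Suc u) w) - - G (X u w))) \<le> 0 * prob B" by simp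
      qed
    next
      case False
      then have xA: "A < x" by simp
      have Px: "G x = ?P y x - plog a g A"
      proof -
        have "plog a g A \<le> ?P y x" using xA A x y A0 by (intro mono) auto
        then show ?thesis by (simp add: G_def)
      qed
      show ?thesis unfolding drift_le_def
      proof (intro allI ballI impI)
        fix u B assume u: "1 \<le> u" and B: "B \<in> sets (F u)" "B \<subseteq> {w \<in> space M. X u w = x}"
        have BM: "B \<in> sets M" using B u sets_F_subset by blast
        have iP: "integrable M (\<lambda>w. - ?P y (X v w))" if "1 \<le> v" for v
        proof -
          have "?P y x \<le> plog a g (2 * y)" for x using y A0 by (intro mono) auto
          then show ?thesis using p_gt2
            by (intro Bochner_Integration.integrable_minus integrable_fun_X [OF that, of _ "plog a g (2 * y)" 0]) auto
        qed
        have "(LINT w:B|M. (- G (X (Suc u) w) - - G (X u w))) \<le> (LINT w:B|M. (- ?P y (X (Suc u) w) - - ?P y (X u w)))"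
        proof (rule set_integral_mono)
          show "set_integrable M B (\<lambda>w. - G (X (Suc u) w) - - G (X u w))"
            using u by (intro set_integrable_restrict BM Bochner_Integration.integrable_diff imG) auto
          show "set_integrable M B (\<lambda>w. - ?P y (X (Suc u) w) - - ?P y (X u w))"
            using u by (intro set_integrable_restrict BM Bochner_Integration.integrable_diff iP) auto
          fix w assume "w \<in> B"
          then have "X u w = x" using B by auto
          then have "G (X u w) = ?P y (X u w) - plog a g A" using Px by simp
          moreover have "?P y (X (Suc u) w) - plog a g A \<le> G (X (Suc u) w)" by (simp add: G_def)
          ultimately show "- G (X (Suc u) w) - - G (X u w) \<le> - ?P y (X (Suc u) w) - - ?P y (X u w)" by linarith
        qed
        also have "\<dots> \<le> 0 * prob B"
          using xA A x by (intro A1 [of x y, unfolded drift_le_def, rule_format, OF _ _ u B]) auto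
        finally show "(LINT w:B|M. (- G (X (Suc u) w) - - G (X u w))) \<le> 0 * prob B" .
      qed
    qed
    let ?Q = "below 1 y"
    have QM: "?Q u \<in> sets M" if "1 \<le> u" for u using below_M that by auto
    have EM: "exceed 1 y u \<in> sets M" if "1 \<le> u" for u using exceed_M that by auto
    have step: "0 \<le> (LINT w:?Q u|M. (G (X (Suc u) w) - G (X u w)))" if u: "1 \<le> u" for u
    proof -
      have "(LINT w:?Q u|M. (- G (X (Suc u) w) - - G (X u w))) \<le>
          0 * prob (?Q u \<inter> {w \<in> space M. X u w \<le> A}) - 0 * prob (?Q u \<inter> {w \<in> space M. A < X u w})"
        by (rule drift_le_set [OF u below_F [OF order_refl u] below_subset [OF u] imG]) (use dr y in auto)
      then have "(LINT w:?Q u|M. (- G (X (Suc u) w) - - G (X u w))) \<le> 0" by simp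
      moreover have "(LINT w:?Q u|M. (- G (X (Suc u) w) - - G (X u w))) = - (LINT w:?Q u|M. (G (X (Suc u) w) - G (X u w)))"
      proof -
        have "set_integrable M (?Q u) (\<lambda>w. G (X (Suc u) w) - G (X u w))"
          using iG u QM [OF u] by (intro set_integrable_restrict Bochner_Integration.integrable_diff) auto
        from set_integral_uminus [OF this] show ?thesis by simp
      qed
      ultimately show ?thesis by simp
    qed
    define v where "v n = (LINT w:?Q (1 + n)|M. G (X (1 + n) w))
        + (\<Sum>u\<in>{1..<1+n}. LINT w:(?Q u - ?Q (Suc u))|M. G (X (Suc u) w))" for n
    have vmono: "v n \<le> v (n + m)" for n m
    proof -
      have "v (n + m) = (LINT w:?Q 1|M. G (X 1 w)) + (\<Sum>u\<in>{1..<1+(n+m)}. LINT w:?Q u|M. (G (X (Suc u) w) - G (X u w)))"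
        unfolding v_def using telescope_below [OF order_refl order_refl, of G y "n + m"] iG by simp
      moreover have "v n = (LINT w:?Q 1|M. G (X 1 w)) + (\<Sum>u\<in>{1..<1+n}. LINT w:?Q u|M. (G (X (Suc u) w) - G (X u w)))"
        unfolding v_def using telescope_below [OF order_refl order_refl, of G y n] iG by simp
      moreover have "(\<Sum>u\<in>{1..<1+n}. LINT w:?Q u|M. (G (X (Suc u) w) - G (X u w)))
          \<le> (\<Sum>u\<in>{1..<1+(n+m)}. LINT w:?Q u|M. (G (X (Suc u) w) - G (X u w)))"
        using step by (intro sum_mono2) auto
      ultimately show ?thesis by simp
    qed
    define n0 where "n0 = t - 1"
    have n0: "t = 1 + n0" using t by (simp add: n0_def)
    have low: "gz * q \<le> v n0"
    proof -
      have tM: "{w \<in> space M. z \<le> X t w} \<in> sets M" using X_measurable [OF t] by measurable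
      have sM: "{w \<in> space M. y \<le> X 1 w} \<in> sets M" using X_measurable [of 1] by measurable
      have "AE w in M. w \<notin> {w \<in> space M. y \<le> X 1 w}" using start y by auto
      then have p0: "prob {w \<in> space M. y \<le> X 1 w} = 0"
        using sM by (simp add: prob_eq_0)
      have "q \<le> prob ((?Q t \<inter> {w \<in> space M. z \<le> X t w}) \<union> {w \<in> space M. y \<le> X 1 w} \<union> (\<Union>u\<in>{1..<1+n0}. exceed 1 y u))"
        unfolding q_def using alive_cover [of 1 n0 y] QM tM sM EM t n0
        by (intro finite_measure_mono) auto
      also have "\<dots> \<le> prob ((?Q t \<inter> {w \<in> space M. z \<le> X t w}) \<union> {w \<in> space M. y \<le> X 1 w}) + prob (\<Union>u\<in>{1..<1+n0}. exceed 1 y u)"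
        using QM tM sM EM t by (intro measure_Un_le) auto
      also have "\<dots> \<le> (prob (?Q t \<inter> {w \<in> space M. z \<le> X t w}) + prob {w \<in> space M. y \<le> X 1 w}) + (\<Sum>u\<in>{1..<1+n0}. prob (exceed 1 y u))"
        using QM tM sM EM t by (intro add_mono measure_Un_le finite_measure_subadditive_finite) auto
      finally have "gz * q \<le> gz * (prob (?Q t \<inter> {w \<in> space M. z \<le> X t w}) + (\<Sum>u\<in>{1..<1+n0}. prob (exceed 1 y u)))"
        using gz p0 by (intro mult_left_mono) auto
      also have "\<dots> = gz * prob (?Q t \<inter> {w \<in> space M. z \<le> X t w}) + (\<Sum>u\<in>{1..<1+n0}. gz * prob (exceed 1 y u))"
        by (simp add: distrib_left sum_distrib_left)
      also have "\<dots> \<le> v n0"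
        unfolding v_def n0 [symmetric]
      proof (intro add_mono sum_mono)
        show "gz * prob (?Q t \<inter> {w \<in> space M. z \<le> X t w}) \<le> (LINT w:?Q t|M. G (X t w))"
          using QM [OF t] tM iG [OF t] Gz G0 by (intro markov_set) auto
        fix u assume "u \<in> {1..<t}"
        then show "gz * prob (exceed 1 y u) \<le> (LINT w:(?Q u - ?Q (Suc u))|M. G (X (Suc u) w))"
          using QM EM iG Gz G0 y exceed_subset [of 1 u y] by (intro markov_set) (auto simp: exceed_def)
      qed
      finally show ?thesis .
    qed
    have up: "v n \<le> plog a g (2 * y) * (prob (?Q (1 + n)) + (\<Sum>u\<in>{1..<1+n}. prob (exceed 1 y u)))" for n
    proof -
      have "(LINT w:?Q (1 + n)|M. G (X (1 + n) w)) \<le> (LINT w:?Q (1 + n)|M. plog a g (2 * y))"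
        using QM iG Gy by (intro set_integral_mono set_integrable_restrict) auto
      also have "\<dots> = plog a g (2 * y) * prob (?Q (1 + n))" using QM by (intro set_integral_prob) auto
      finally have 1: "(LINT w:?Q (1 + n)|M. G (X (1 + n) w)) \<le> plog a g (2 * y) * prob (?Q (1 + n))" .
      have 2: "(LINT w:(?Q u - ?Q (Suc u))|M. G (X (Suc u) w)) \<le> plog a g (2 * y) * prob (exceed 1 y u)"
        if u: "1 \<le> u" for u
      proof -
        have DM: "?Q u - ?Q (Suc u) \<in> sets M" using QM u by auto
        have "(LINT w:(?Q u - ?Q (Suc u))|M. G (X (Suc u) w)) \<le>
            (LINT w:(?Q u - ?Q (Suc u))|M. plog a g (2 * y) * indicator (exceed 1 y u) w)"
        proof (rule set_integral_mono)
          show "set_integrable M (?Q u - ?Q (Suc u)) (\<lambda>w. G (X (Suc u) w))"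
            using iG u by (intro set_integrable_restrict DM) auto
          show "set_integrable M (?Q u - ?Q (Suc u)) (\<lambda>w. plog a g (2 * y) * indicator (exceed 1 y u) w)"
            using EM [OF u] by (intro set_integrable_restrict DM integrable_mult_right integrable_real_indicator)
              (auto simp: emeasure_eq_measure)
          fix w assume w: "w \<in> ?Q u - ?Q (Suc u)"
          show "G (X (Suc u) w) \<le> plog a g (2 * y) * indicator (exceed 1 y u) w"
          proof (cases "w \<in> exceed 1 y u")
            case True then show ?thesis using Gy by simp
          next
            case False
            have ws: "w \<in> space M" using w by (auto simp: below_def)
            have lt: "X (Suc u) w < y" using False w ws by (auto simp: exceed_def)
            have "X (Suc u) w = 0"
            proof (rule ccontr)
              assume nz: "X (Suc u) w \<noteq> 0"
              have "w \<in> ?Q (Suc u)" using w nz lt by (auto simp: below_def le_Suc_eq)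
              then show False using w by simp
            qed
            then show ?thesis using GA [of 0] A False by simp
          qed
        qed
        also have "\<dots> = (\<integral>w. plog a g (2 * y) * indicator (exceed 1 y u) w \<partial>M)"
          unfolding set_lebesgue_integral_def using exceed_subset [OF u, of y]
          by (intro Bochner_Integration.integral_cong) (auto simp: indicator_def)
        also have "\<dots> = plog a g (2 * y) * prob (exceed 1 y u)" using EM [OF u] by simp
        finally show ?thesis .
      qed
      have "v n \<le> plog a g (2 * y) * prob (?Q (1 + n)) + (\<Sum>u\<in>{1..<1+n}. plog a g (2 * y) * prob (exceed 1 y u))"
        unfolding v_def using 1 2 by (intro add_mono sum_mono) auto
      then show ?thesis by (simp only: distrib_left sum_distrib_left)
    qed
    have py: "plog a g (2 * y) > 0" using y by (intro plog_pos) auto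
    have kp: "0 < gz * q / 2 / plog a g (2 * y)" using kq py by simp
    have lim: "(\<lambda>n. prob (?Q (1 + n))) \<longlonglongrightarrow> 0" using elim(1) by blast
    obtain no where no: "\<And>n. n \<ge> no \<Longrightarrow> norm (prob (?Q (1 + n)) - 0) < gz * q / 2 / plog a g (2 * y)"
      using LIMSEQ_D [OF lim kp] by blast
    have "gz * q \<le> v (n0 + no)" using low vmono [of n0 no] by simp
    also have "\<dots> \<le> plog a g (2 * y) * (prob (?Q (1 + (n0 + no))) + (\<Sum>u\<in>{1..<1+(n0+no)}. prob (exceed 1 y u)))"
      by (rule up)
    finally have "gz * q / plog a g (2 * y) \<le> prob (?Q (1 + (n0 + no))) + (\<Sum>u\<in>{1..<1+(n0+no)}. prob (exceed 1 y u))"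
      unfolding pos_divide_le_eq [OF py] by (subst mult.commute [of _ "plog a g (2 * y)"])
    moreover have "prob (?Q (1 + (n0 + no))) < gz * q / 2 / plog a g (2 * y)" using no [of "n0 + no"] by simp
    moreover have "gz * q / plog a g (2 * y) = gz * q / 2 / plog a g (2 * y) + gz * q / 2 / plog a g (2 * y)"
      by (simp add: add_divide_distrib [symmetric])
    ultimately have "gz * q / 2 / plog a g (2 * y) \<le> (\<Sum>u\<in>{1..<1+(n0+no)}. prob (exceed 1 y u))" by linarith
    then show ?case by blast
  qed
  moreover have "0 < gz * q / 2" using kq by simp
  ultimately show ?thesis unfolding a_def by blast
qed

end

lemma ret_time_SucD:
  assumes "ret_time X (Suc n) w = enat k"
  shows "X k w = 0 \<and> (\<exists>j<k. ret_time X n w = enat j)"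
proof (cases "ret_time X n w")
  case (enat j)
  with assms have ex: "\<exists>t>j. X t w = 0" and k: "k = (LEAST t. t > j \<and> X t w = 0)"
    by (auto split: if_splits)
  have "k > j \<and> X k w = 0" unfolding k using LeastI_ex [of "\<lambda>t. t > j \<and> X t w = 0"] ex by auto
  then show ?thesis using enat by auto
qed (use assms in auto)

lemma ret_time_gt: "ret_time X n w = enat k \<Longrightarrow> n < k"
proof (induction n arbitrary: k)
  case (Suc n)
  from ret_time_SucD [OF Suc.prems] obtain j where "j < k" "ret_time X n w = enat j" by blast
  then show ?case using Suc.IH by fastforce
qed auto

lemma ret_time_finite:
  assumes "\<forall>s\<ge>1. \<exists>u>s. X u w = 0" shows "\<exists>k. ret_time X n w = enat k"
proof (induction n)
  case (Suc n)
  then obtain k where k: "ret_time X n w = enat k" by blast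
  then have "1 \<le> k" using ret_time_gt [of X n w k] by simp
  then have "\<exists>t>k. X t w = 0" using assms by blast
  then show ?case using k by simp
qed simp

lemma N_infinite_eq: "N_infinite X M = {w \<in> space M. \<forall>s\<ge>1. \<exists>u>s. X u w = 0}"
proof -
  have "(\<forall>n. ret_time X n w \<noteq> \<infinity>) \<longleftrightarrow> (\<forall>s\<ge>1. \<exists>u>s. X u w = 0)" for w
  proof
    assume fin: "\<forall>n. ret_time X n w \<noteq> \<infinity>"
    show "\<forall>s\<ge>1. \<exists>u>s. X u w = 0"
    proof (intro allI impI)
      fix s :: nat assume "1 \<le> s"
      then obtain m where m: "s = Suc m" by (cases s) auto
      obtain k where k: "ret_time X s w = enat k" using fin by auto
      then show "\<exists>u>s. X u w = 0" using ret_time_gt [of X s w k] ret_time_SucD [of X m w k] m by blast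
    qed
  next
    assume "\<forall>s\<ge>1. \<exists>u>s. X u w = 0"
    then show "\<forall>n. ret_time X n w \<noteq> \<infinity>" using ret_time_finite [of X w] by (metis enat.distinct(1))
  qed
  then show ?thesis by (auto simp: N_infinite_def)
qed

lemma excursion_cover:
  assumes fin: "\<And>n. \<exists>k. ret_time X n w = enat k" and t: "1 \<le> t"
  shows "\<exists>n\<ge>1. X t w \<in> set (excursion X n w)"
proof -
  have ex: "\<exists>n. enat t < ret_time X n w"
  proof -
    obtain k where "ret_time X t w = enat k" using fin by blast
    then show ?thesis using ret_time_gt [of X t w k] by (intro exI [of _ t]) simp
  qed
  define n where "n = (LEAST n. enat t < ret_time X n w)"
  have n: "enat t < ret_time X n w" unfolding n_def using ex by (rule LeastI_ex)
  then obtain m where m: "n = Suc m" using t by (cases n) auto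
  have "\<not> enat t < ret_time X m w"
    using not_less_Least [of m "\<lambda>n. enat t < ret_time X n w"] m by (simp add: n_def)
  moreover obtain i j where "ret_time X m w = enat i" "ret_time X n w = enat j" using fin by blast
  ultimately have "X t w \<in> set (excursion X n w)" using n m by (auto simp: excursion_def)
  then show ?thesis using m by (intro exI [of _ n]) simp
qed

lemma first_return_no_zero:
  assumes "ret_time X 1 w = enat k" "1 < u" "u < k" shows "X u w \<noteq> 0"
proof
  assume "X u w = 0"
  moreover have "k = (LEAST t. t > 1 \<and> X t w = 0)"
    using assms by (auto split: if_splits)
  ultimately have "k \<le> u" using assms Least_le [of "\<lambda>t. t > 1 \<and> X t w = 0" u] by auto
  then show False using assms by simp
qed

lemma exc_length_ge_iff:
  assumes "1 \<le> n"
  shows "enat n \<le> exc_length X 1 w \<longleftrightarrow> (\<forall>u\<in>{1<..n}. X u w \<noteq> 0)"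
proof (cases "\<exists>t>1. X t w = 0")
  case True
  define k where "k = (LEAST t. t > 1 \<and> X t w = 0)"
  have rt: "ret_time X 1 w = enat k" using True by (simp add: k_def)
  have k: "1 < k" "X k w = 0" using LeastI_ex [of "\<lambda>t. t > 1 \<and> X t w = 0"] True by (auto simp: k_def)
  have "exc_length X 1 w = enat (k - 1)" using rt by (simp add: exc_length_def one_enat_def)
  then have "enat n \<le> exc_length X 1 w \<longleftrightarrow> n < k" using k by auto
  also have "\<dots> \<longleftrightarrow> (\<forall>u\<in>{1<..n}. X u w \<noteq> 0)"
    using first_return_no_zero [OF rt] k by (auto simp: not_less [symmetric])
  finally show ?thesis .
next
  case False
  then have "exc_length X 1 w = \<infinity>" by (auto simp: exc_length_def)
  then show ?thesis using False by auto
qed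

lemma ereal_le_enat_iff: "ereal x \<le> ereal_of_enat m \<longleftrightarrow> enat (nat \<lceil>x\<rceil>) \<le> m"
  by (cases m) (auto simp: ceiling_le_iff nat_le_iff)

context near_critical_process
begin

lemma tail_event_eq:
  assumes "1 \<le> x"
  shows "{w \<in> space M. ereal x \<le> ereal_of_enat (exc_length X 1 w)} = alive 1 (nat \<lceil>x\<rceil>)"
proof -
  have "1 \<le> nat \<lceil>x\<rceil>" using assms by linarith
  then show ?thesis unfolding ereal_le_enat_iff alive_def by (simp only: exc_length_ge_iff)
qed

lemma lower_tail:
  assumes e: "0 < e" and reach: "\<And>z. \<exists>t\<ge>1. 0 < prob (alive 1 t \<inter> {w \<in> space M. z \<le> X t w})"
  shows "\<forall>\<^sub>F x in at_top. x powr (- (1 + r) / 2) * ln x powr (- e) \<le> prob (alive 1 (nat \<lceil>x\<rceil>))"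
proof -
  have r1: "0 < 1 + r" using r_gt by simp
  have e2: "0 < e / 2" using e by simp
  obtain k where k: "k > 0" and ev1: "\<forall>\<^sub>F y in at_top. \<exists>n. k / plog (1 + r) (e / 2) (2 * y) \<le> (\<Sum>u\<in>{1..<1+n}. prob (exceed 1 y u))"
    using exceed_lower [OF e2 reach] by blast
  obtain C2 where C2: "C2 > 0" and ev2: "\<forall>\<^sub>F y in at_top. \<forall>t\<ge>1. \<forall>B\<in>sets (F t). B \<subseteq> {w \<in> space M. y \<le> X t w} \<longrightarrow>
     (\<forall>n. prob (B - alive t (t + n)) \<le> C2 / y\<^sup>2 * real n * prob B)"
    using survival by blast
  define c0 where "c0 = sqrt (4 * C2)"
  have c0: "c0 > 0" "c0\<^sup>2 = 4 * C2" using C2 by (auto simp: c0_def)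
  define y where "y x = c0 * sqrt x" for x
  have ylim: "filterlim y at_top at_top" unfolding y_def [abs_def] using c0(1) by real_asymp
  have lny: "\<forall>\<^sub>F x in at_top. 1 < 2 * y x \<and> ln (2 * y x) \<le> ln x"
    unfolding y_def by (rule eventually_conj; use c0(1) in real_asymp)
  define rr where "rr = (1 + r) / 2"
  have evc: "\<forall>\<^sub>F x in at_top. (2 * c0) powr (1 + r) \<le> k / 2 * ln x powr (e / 2)"
    using k e by real_asymp
  show ?thesis
    using eventually_compose_filterlim [OF ev1 ylim] eventually_compose_filterlim [OF ev2 ylim] lny evc
      eventually_gt_at_top [of "exp 1"]
  proof eventually_elim
    case (elim x)
    have x1: "x > 1" using elim(5) one_le_exp_iff [of 1] by linarith
    have L: "ln x \<ge> 1" using elim(5) x1 by (simp add: ln_ge_iff)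
    let ?y = "y x" and ?N = "nat \<lceil>x\<rceil>"
    have ypos: "?y > 0" using c0 x1 by (simp add: y_def)
    have ysq: "?y\<^sup>2 = 4 * C2 * x" using x1 c0 by (simp add: y_def power_mult_distrib)
    have N: "real ?N \<le> 2 * x" "1 \<le> ?N" using x1 by linarith+
    have half: "C2 / ?y\<^sup>2 * real ?N \<le> 1 / 2"
      unfolding ysq using N C2 x1 by (simp add: field_simps)
    obtain n where n: "k / plog (1 + r) (e / 2) (2 * ?y) \<le> (\<Sum>u\<in>{1..<1+n}. prob (exceed 1 ?y u))"
      using elim(1) by blast
    define A where "A u = exceed 1 ?y u \<inter> alive (Suc u) (Suc u + ?N)" for u
    have EM: "exceed 1 ?y u \<in> sets M" if "1 \<le> u" for u using exceed_M that by auto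
    have AM: "A u \<in> sets M" if "1 \<le> u" for u
      using EM [OF that] alive_M [of "Suc u" "Suc u + ?N"] by (auto simp: A_def)
    have surv: "prob (exceed 1 ?y u) / 2 \<le> prob (A u)" if u: "1 \<le> u" for u
    proof -
      have "prob (exceed 1 ?y u - alive (Suc u) (Suc u + ?N)) \<le> C2 / ?y\<^sup>2 * real ?N * prob (exceed 1 ?y u)"
        by (rule elim(2) [rule_format, OF _ exceed_F [OF order_refl u]]) (auto simp: exceed_def)
      also have "\<dots> \<le> 1 / 2 * prob (exceed 1 ?y u)" using half by (intro mult_right_mono) auto
      finally have 1: "prob (exceed 1 ?y u - alive (Suc u) (Suc u + ?N)) \<le> 1 / 2 * prob (exceed 1 ?y u)" .
      have "prob (exceed 1 ?y u - A u) = prob (exceed 1 ?y u) - prob (A u)"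
        using EM [OF u] AM [OF u] by (intro finite_measure_Diff) (auto simp: A_def)
      moreover have "exceed 1 ?y u - A u = exceed 1 ?y u - alive (Suc u) (Suc u + ?N)" by (auto simp: A_def)
      ultimately show ?thesis using 1 by simp
    qed
    have sub: "A u \<subseteq> alive 1 ?N" if u: "1 \<le> u" for u
    proof
      fix w assume w: "w \<in> A u"
      then have ws: "w \<in> space M" by (auto simp: A_def alive_def)
      have "X v w \<noteq> 0" if v: "1 < v" "v \<le> ?N" for v
      proof (cases v "Suc u" rule: linorder_cases)
        case less
        then show ?thesis using w v by (auto simp: A_def exceed_def below_def)
      next
        case equal
        then show ?thesis using w ypos by (auto simp: A_def exceed_def)
      next
        case greater
        then show ?thesis using w v by (auto simp: A_def alive_def)
      qed
      then show "w \<in> alive 1 ?N" using ws by (auto simp: alive_def)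
    qed
    have "(2 * ?y) powr (1 + r) * ln (2 * ?y) powr (e / 2) \<le> ((2 * c0) powr (1 + r) * x powr rr) * ln x powr (e / 2)"
    proof (rule mult_mono)
      have "(2 * ?y) powr (1 + r) = ((2 * c0) * sqrt x) powr (1 + r)" by (simp add: y_def mult.assoc)
      also have "\<dots> = (2 * c0) powr (1 + r) * sqrt x powr (1 + r)" by (rule powr_mult)
      also have "sqrt x powr (1 + r) = x powr rr"
        using x1 by (simp add: powr_half_sqrt [symmetric] powr_powr rr_def)
      finally show "(2 * ?y) powr (1 + r) \<le> (2 * c0) powr (1 + r) * x powr rr" by simp
      show "ln (2 * ?y) powr (e / 2) \<le> ln x powr (e / 2)" using elim(3) e by (intro powr_mono2) auto
    qed auto
    also have "\<dots> \<le> (k / 2 * ln x powr (e / 2) * x powr rr) * ln x powr (e / 2)"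
      using elim(4) by (intro mult_right_mono) auto
    also have "\<dots> = k / 2 * x powr rr * (ln x powr (e / 2) * ln x powr (e / 2))" by simp
    also have "ln x powr (e / 2) * ln x powr (e / 2) = ln x powr e"
      unfolding powr_add [symmetric] by simp
    finally have pl: "plog (1 + r) (e / 2) (2 * ?y) \<le> k / 2 * x powr rr * ln x powr e" by (simp add: plog_def)
    have ppos: "0 < plog (1 + r) (e / 2) (2 * ?y)" using elim(3) by (intro plog_pos) auto
    have inv: "x powr (- rr) * ln x powr (- e) = k / (2 * (k / 2 * x powr rr * ln x powr e))"
    proof -
      have inv: "inverse u * inverse v = k / (2 * (k / 2 * u * v))" if "0 < u" "0 < v" for u v :: real
        using k that by (simp add: field_simps)
      show ?thesis unfolding powr_minus [of x rr] powr_minus [of "ln x" e]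
        by (rule inv) (use x1 L in auto)
    qed
    have "x powr (- rr) * ln x powr (- e) \<le> k / (2 * plog (1 + r) (e / 2) (2 * ?y))"
      unfolding inv using pl ppos k by (intro divide_left_mono mult_left_mono mult_pos_pos) auto
    also have "\<dots> = (k / plog (1 + r) (e / 2) (2 * ?y)) / 2" by simp
    also have "\<dots> \<le> (\<Sum>u\<in>{1..<1+n}. prob (exceed 1 ?y u)) / 2" using n by (rule divide_right_mono) simp
    also have "\<dots> = (\<Sum>u\<in>{1..<1+n}. prob (exceed 1 ?y u) / 2)" by (rule sum_divide_distrib)
    also have "\<dots> \<le> (\<Sum>u\<in>{1..<1+n}. prob (A u))" using surv by (intro sum_mono) auto
    also have "\<dots> = prob (\<Union>u\<in>{1..<1+n}. A u)"
    proof (rule finite_measure_finite_Union [symmetric])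
      show "disjoint_family_on A {1..<1 + n}"
        using exceed_disjoint [of 1 _ _ ?y] by (force simp: disjoint_family_on_def A_def)
    qed (use AM in auto)
    also have "\<dots> \<le> prob (alive 1 ?N)"
    proof (rule finite_measure_mono)
      show "(\<Union>u\<in>{1..<1+n}. A u) \<subseteq> alive 1 ?N" by (rule UN_least, rule sub) simp
    qed (use alive_M N in auto)
    finally show ?case by (simp add: rr_def minus_divide_left)
  qed
qed

lemma reach_high_levels:
  assumes idd: "emeasure M (N_infinite X M) > 0 \<longrightarrow>
      prob_space.indep_vars (uniform_measure M (N_infinite X M)) (\<lambda>_. count_space UNIV) (excursion X) {1..} \<and>
      (\<forall>n\<ge>1. distr (uniform_measure M (N_infinite X M)) (count_space UNIV) (excursion X n)
         = distr (uniform_measure M (N_infinite X M)) (count_space UNIV) (excursion X 1))"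
  shows "\<exists>t\<ge>1. 0 < prob (alive 1 t \<inter> {w \<in> space M. z \<le> X t w})"
proof (rule ccontr)
  assume contra: "\<not> ?thesis"
  let ?N = "N_infinite X M"
  have lev: "{w \<in> space M. X u w = x} \<in> sets M" if "1 \<le> u" for u x
    using level_set_F sets_F_subset that by blast
  have "?N = (\<Inter>s\<in>{1..}. \<Union>u\<in>{s<..}. {w \<in> space M. X u w = 0})"
    unfolding N_infinite_eq by fastforce
  also have "\<dots> \<in> sets M"
    using lev by (intro sets.countable_INT' sets.countable_UN' image_subsetI) auto
  finally have NM: "?N \<in> sets M" .
  have aeN: "AE w in M. w \<in> ?N" using recurrent unfolding N_infinite_eq by (auto elim!: AE_mp intro!: AE_I2)
  then have "prob ?N = 1" using NM by (simp add: AE_in_set_eq_1)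
  then have N1: "emeasure M ?N = 1" by (simp add: emeasure_eq_measure)
  then have posN: "0 < emeasure M ?N" by simp
  let ?U = "uniform_measure M ?N"
  have pU: "prob_space ?U" by (rule prob_space_uniform_measure) (auto simp: N1)
  have indep: "prob_space.indep_vars ?U (\<lambda>_. count_space UNIV) (excursion X) {1..}"
    and dist: "\<And>n. 1 \<le> n \<Longrightarrow> distr ?U (count_space UNIV) (excursion X n) = distr ?U (count_space UNIV) (excursion X 1)"
    using mp [OF idd posN] by blast+
  have meas: "excursion X n \<in> measurable ?U (count_space UNIV)" if "1 \<le> n" for n
    using indep that unfolding prob_space.indep_vars_def [OF pU] by auto
  define bad where "bad = {l :: real list. \<exists>x\<in>set l. z \<le> x}"
  have exc_sets: "excursion X n -` bad \<inter> space M \<in> sets M" if "1 \<le> n" for n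
    using measurable_sets [OF meas [OF that], of bad] by simp
  have dU: "emeasure (distr ?U (count_space UNIV) (excursion X n)) bad = emeasure M (?N \<inter> (excursion X n -` bad \<inter> space M))"
    if "1 \<le> n" for n
    using emeasure_distr [OF meas [OF that], of bad] emeasure_uniform_measure [OF NM exc_sets [OF that]] N1
    by (simp add: divide_ennreal_def)
  have zM: "alive 1 t \<inter> {w \<in> space M. z \<le> X t w} \<in> sets M" if "1 \<le> t" for t
    using alive_M [OF order_refl that] X_measurable [OF that] by measurable
  have null: "(\<Union>t\<in>{1..}. alive 1 t \<inter> {w \<in> space M. z \<le> X t w}) \<in> null_sets M"
  proof (rule null_sets_UN')
    fix t :: nat assume t: "t \<in> {1..}"
    have "prob (alive 1 t \<inter> {w \<in> space M. z \<le> X t w}) = 0"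
    proof -
      have "\<not> 0 < prob (alive 1 t \<inter> {w \<in> space M. z \<le> X t w})" using contra t by auto
      then show ?thesis by (simp only: zero_less_measure_iff not_not)
    qed
    then show "alive 1 t \<inter> {w \<in> space M. z \<le> X t w} \<in> null_sets M"
      using zM t by (intro null_setsI) (auto simp: emeasure_eq_measure)
  qed simp
  have "?N \<inter> (excursion X 1 -` bad \<inter> space M) \<subseteq> (\<Union>t\<in>{1..}. alive 1 t \<inter> {w \<in> space M. z \<le> X t w})"
  proof
    fix w assume w: "w \<in> ?N \<inter> (excursion X 1 -` bad \<inter> space M)"
    then have "\<And>n. ret_time X n w \<noteq> \<infinity>" by (simp add: N_infinite_def)
    then obtain k where k: "ret_time X 1 w = enat k" by (metis not_enat_eq)
    obtain x where x: "x \<in> set (excursion X 1 w)" "z \<le> x" using w by (auto simp: bad_def)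
    then obtain t where t: "1 \<le> t" "t < k" "x = X t w" using k by (auto simp: excursion_def)
    have "w \<in> alive 1 t" using w t first_return_no_zero [OF k] by (auto simp: alive_def)
    then show "w \<in> (\<Union>t\<in>{1..}. alive 1 t \<inter> {w \<in> space M. z \<le> X t w})" using t x w by auto
  qed
  then have "emeasure M (?N \<inter> (excursion X 1 -` bad \<inter> space M)) = 0"
    using null NM exc_sets [of 1] by (intro null_setsD1 [OF null_sets_subset [OF null]]) auto
  then have zero: "emeasure M (?N \<inter> (excursion X n -` bad \<inter> space M)) = 0" if "1 \<le> n" for n
    using dU [OF that] dU [of 1] dist [OF that] by simp
  have "AE w in M. 1 \<le> n \<longrightarrow> w \<notin> ?N \<inter> (excursion X n -` bad \<inter> space M)" for n
  proof (cases "1 \<le> n")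
    case True
    have "?N \<inter> (excursion X n -` bad \<inter> space M) \<in> null_sets M"
      using zero [OF True] NM exc_sets [OF True] by (intro null_setsI) auto
    from AE_not_in [OF this] show ?thesis by eventually_elim blast
  qed simp
  then have "AE w in M. \<forall>n. 1 \<le> n \<longrightarrow> w \<notin> ?N \<inter> (excursion X n -` bad \<inter> space M)"
    by (simp only: AE_all_countable) blast
  with aeN have ae: "AE w in M. \<forall>t\<ge>1. X t w < z"
  proof (eventually_elim, intro allI impI)
    fix w and t :: nat
    assume w: "w \<in> ?N" and nb: "\<forall>n. 1 \<le> n \<longrightarrow> w \<notin> ?N \<inter> (excursion X n -` bad \<inter> space M)" and t: "1 \<le> t"
    have "\<exists>k. ret_time X n w = enat k" for n using w by (simp add: N_infinite_def)
    from excursion_cover [OF this t] obtain n where n: "n \<ge> 1" "X t w \<in> set (excursion X n w)" by blast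
    have "w \<in> space M" using w by (simp add: N_infinite_def)
    then have "excursion X n w \<notin> bad" using nb w n(1) by blast
    then show "X t w < z" using n by (auto simp: bad_def)
  qed
  obtain x where x: "x \<in> S" "z \<le> x" using S_unbdd by (metis bdd_aboveI linear)
  let ?B = "{w \<in> space M. X 1 w = 0}"
  have BF: "?B \<in> sets (F 1)" using level_set_F by simp
  have "AE w in M. w \<in> ?B" using start AE_space by eventually_elim simp
  then have B1: "prob ?B = 1" using AE_in_set_eq_1 [OF lev [OF order_refl, of 0]] by blast
  let ?H = "?B \<inter> {w \<in> space M. X (1 + mm 0 x) w = x}"
  have "phi 0 x * prob ?B \<le> prob ?H" by (rule prob_hit_ge [OF order_refl x(1) BF order_refl])
  then have "0 < prob ?H" using B1 phi_pos [OF S_zero x(1)] by simp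
  moreover have "AE w in M. w \<notin> ?H"
    using ae
  proof eventually_elim
    case (elim w)
    have "1 \<le> 1 + mm 0 x" by simp
    then have "X (1 + mm 0 x) w < z" using elim by blast
    then show ?case using x by auto
  qed
  then have "prob ?H = 0"
    using prob_eq_0 [OF sets.Int [OF lev [of 1 0] lev [of "1 + mm 0 x" x]]] by simp
  ultimately show False by simp
qed

end

section \<open>Moments\<close>

lemma two_power_powr: "((2::real) ^ k) powr b = (2 powr b) ^ k"
  by (induction k) (simp_all add: powr_mult)

lemma dyadic_sum_le:
  fixes a :: real and m :: nat
  assumes a: "0 < a"
  shows "(\<Sum>k | k < K \<and> 2 ^ k \<le> m. (2 powr a) ^ k) \<le> 2 powr a / (2 powr a - 1) * real m powr a"
proof -
  define q where "q = 2 powr a"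
  have q: "q > 1" using a by (simp add: q_def)
  let ?T = "{k. k < K \<and> 2 ^ k \<le> m}"
  show ?thesis
  proof (cases "?T = {}")
    case True
    have "0 \<le> q / (q - 1) * real m powr a" using q by simp
    then show ?thesis unfolding True q_def by simp
  next
    case False
    define j where "j = Max ?T"
    have fin: "finite ?T" by (rule finite_subset [of _ "{..<K}"]) auto
    have j: "j \<in> ?T" unfolding j_def using fin False by (rule Max_in)
    have "?T \<subseteq> {..<Suc j}" using Max_ge [OF fin] by (auto simp: j_def less_Suc_eq_le)
    then have "(\<Sum>k\<in>?T. q ^ k) \<le> (\<Sum>k<Suc j. q ^ k)" using q by (intro sum_mono2) auto
    also have "\<dots> = (q ^ Suc j - 1) / (q - 1)" using q by (intro geometric_sum) auto
    also have "\<dots> \<le> q ^ Suc j / (q - 1)" using q by (intro divide_right_mono) auto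
    also have "\<dots> = q / (q - 1) * (2 ^ j) powr a" by (simp add: two_power_powr q_def)
    also have "\<dots> \<le> q / (q - 1) * real m powr a"
    proof (intro mult_left_mono powr_mono2)
      have "real (2 ^ j) \<le> real m" using j by (intro of_nat_mono) auto
      then show "2 ^ j \<le> real m" by simp
    qed (use a q in auto)
    finally show ?thesis by (simp add: q_def)
  qed
qed

lemma dyadic_bracket:
  fixes m :: nat assumes "1 \<le> m" shows "\<exists>k. 2 ^ k \<le> m \<and> m < 2 ^ Suc k"
  using ex_power_ivl1 [of 2 m] assms by auto

context near_critical_process
begin

lemma alive_eq: "1 \<le> n \<Longrightarrow> alive 1 n = {w \<in> space M. enat n \<le> exc_length X 1 w}"
  unfolding alive_def by (simp only: exc_length_ge_iff)

lemma exc_length_measurable [measurable]: "exc_length X 1 \<in> measurable M (count_space UNIV)"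
proof (rule measurable_count_space_eq_countable [THEN iffD2], goal_cases)
  case 1 show ?case by simp
next
  case 2
  have "exc_length X 1 -` {j} \<inter> space M \<in> sets M" for j
  proof (cases j)
    case (enat m)
    have "exc_length X 1 -` {enat m} \<inter> space M =
        {w \<in> space M. enat m \<le> exc_length X 1 w} - {w \<in> space M. enat (Suc m) \<le> exc_length X 1 w}"
      by (auto simp: Suc_ile_eq not_less)
    also have "{w \<in> space M. enat (Suc m) \<le> exc_length X 1 w} = alive 1 (Suc m)"
      by (rule alive_eq [symmetric]) simp
    also have "{w \<in> space M. enat m \<le> exc_length X 1 w} = (if m = 0 then space M else alive 1 m)"
    proof (cases "m = 0")
      case False
      then have "1 \<le> m" by simp
      from alive_eq [OF this] show ?thesis using False by simp
    qed (simp add: zero_enat_def [symmetric])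
    finally show ?thesis using alive_M [of 1 "Suc m"] alive_M [of 1 m] enat by auto
  next
    case infinity
    have "exc_length X 1 -` {\<infinity>} \<inter> space M = (\<Inter>m\<in>{1..}. alive 1 m)"
    proof -
      have "j = \<infinity>" if "\<forall>m\<ge>1. enat m \<le> j" for j
      proof (cases j)
        case (enat n)
        then show ?thesis using that [rule_format, of "Suc n"] by simp
      qed simp
      then have "j = \<infinity> \<longleftrightarrow> (\<forall>m\<ge>1. enat m \<le> j)" for j by auto
      moreover have "w \<in> (\<Inter>m\<in>{1..}. alive 1 m) \<longleftrightarrow> w \<in> space M \<and> (\<forall>m\<ge>1. enat m \<le> exc_length X 1 w)" for w
        using alive_eq by blast
      ultimately show ?thesis by blast
    qed
    also have "\<dots> \<in> sets M" using alive_M by (intro sets.countable_INT' image_subsetI) auto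
    finally show ?thesis using infinity by simp
  qed
  then show ?case by auto
qed

lemma alive_power_iff:
  assumes "w \<in> space M" "exc_length X 1 w = enat m"
  shows "w \<in> alive 1 (2 ^ k) \<longleftrightarrow> 2 ^ k \<le> m"
proof -
  have eq: "alive 1 (2 ^ k) = {w \<in> space M. enat (2 ^ k) \<le> exc_length X 1 w}" by (rule alive_eq) simp
  show ?thesis unfolding eq using assms by simp
qed

lemma moment_infinite:
  assumes a: "0 < a" and low: "\<forall>\<^sub>F x in at_top. x powr (- a) * ln x powr (- 1) \<le> prob (alive 1 (nat \<lceil>x\<rceil>))"
  shows "(\<integral>\<^sup>+w. enat_powr (exc_length X 1 w) a \<partial>M) = \<infinity>"
proof (rule ccontr)
  let ?I = "\<integral>\<^sup>+w. enat_powr (exc_length X 1 w) a \<partial>M"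
  assume "\<not> ?thesis"
  then have fin: "?I < \<infinity>" by (simp add: less_top)
  define q where "q = 2 powr a"
  have q: "q > 1" using a by (simp add: q_def)
  define C where "C = q / (q - 1)"
  have C: "C > 0" using q by (simp add: C_def)
  have AM: "alive 1 (2 ^ k) \<in> sets M" for k by (intro alive_M) auto
  define u where "u k = q ^ k * prob (alive 1 (2 ^ k))" for k
  have u0: "0 \<le> u k" for k using q by (simp add: u_def)
  have pt: "(\<Sum>k<K. ennreal (q ^ k) * indicator (alive 1 (2 ^ k)) w) \<le> ennreal C * enat_powr (exc_length X 1 w) a"
    if w: "w \<in> space M" for K w
  proof (cases "exc_length X 1 w")
    case (enat m)
    have "(\<Sum>k<K. ennreal (q ^ k) * indicator (alive 1 (2 ^ k)) w) = (\<Sum>k<K. if 2 ^ k \<le> m then ennreal (q ^ k) else 0)"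
    proof (rule sum.cong)
      fix k
      show "ennreal (q ^ k) * indicator (alive 1 (2 ^ k)) w = (if 2 ^ k \<le> m then ennreal (q ^ k) else 0)"
        using alive_power_iff [OF w enat, of k] by (simp add: indicator_def)
    qed simp
    also have "\<dots> = (\<Sum>k | k < K \<and> 2 ^ k \<le> m. ennreal (q ^ k))"
      by (simp add: sum.If_cases lessThan_def Collect_conj_eq)
    also have "\<dots> = ennreal (\<Sum>k | k < K \<and> 2 ^ k \<le> m. q ^ k)" using q by (intro sum_ennreal) auto
    also have "\<dots> \<le> ennreal (C * real m powr a)"
      using dyadic_sum_le [OF a, of K m] by (intro ennreal_leI) (simp add: C_def q_def)
    also have "\<dots> = ennreal C * enat_powr (exc_length X 1 w) a"
      using C enat by (simp add: enat_powr_def ennreal_mult)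
    finally show ?thesis .
  next
    case infinity
    then show ?thesis using C by (simp add: enat_powr_def ennreal_mult_top)
  qed
  have IM: "(\<lambda>w. enat_powr (exc_length X 1 w) a) \<in> borel_measurable M"
    by measurable
  have "ennreal (\<Sum>k<K. u k) \<le> ennreal C * ?I" for K
  proof -
    have "ennreal (\<Sum>k<K. u k) = (\<Sum>k<K. ennreal (q ^ k) * emeasure M (alive 1 (2 ^ k)))"
      using q by (simp add: u_def emeasure_eq_measure ennreal_mult [symmetric] sum_ennreal)
    also have "\<dots> = (\<integral>\<^sup>+w. (\<Sum>k<K. ennreal (q ^ k) * indicator (alive 1 (2 ^ k)) w) \<partial>M)"
      using AM by (subst nn_integral_sum) (auto simp: nn_integral_cmult_indicator)
    also have "\<dots> \<le> (\<integral>\<^sup>+w. ennreal C * enat_powr (exc_length X 1 w) a \<partial>M)"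
      using pt by (intro nn_integral_mono)
    also have "\<dots> = ennreal C * ?I" by (rule nn_integral_cmult [OF IM])
    finally show ?thesis .
  qed
  moreover obtain R where R: "ennreal C * ?I = ennreal R" "0 \<le> R"
    using fin by (cases "ennreal C * ?I" rule: ennreal_cases) (auto simp: ennreal_mult_eq_top_iff)
  ultimately have "(\<Sum>k<K. u k) \<le> R" for K by (metis ennreal_le_iff)
  then have su: "summable u" using u0 by (intro summableI_nonneg_bounded)
  have lim: "filterlim (\<lambda>k. (2::real) ^ k) at_top sequentially" by real_asymp
  have "\<forall>\<^sub>F k in sequentially. norm (inverse (real k)) \<le> ln 2 * u k"
    using eventually_compose_filterlim [OF low lim] eventually_gt_at_top [of 0]
  proof eventually_elim
    case (elim k)
    have 1: "((2::real) ^ k) powr (- a) = inverse (q ^ k)"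
      unfolding powr_minus [of _ a] two_power_powr q_def ..
    have 2: "ln ((2::real) ^ k) powr (- 1) = inverse (real k * ln 2)"
      unfolding powr_minus [of _ 1] using elim by (simp add: ln_realpow)
    have 3: "nat \<lceil>(2::real) ^ k\<rceil> = 2 ^ k"
      by (metis ceiling_of_nat nat_int of_nat_numeral of_nat_power)
    have "inverse (q ^ k) * inverse (real k * ln 2) \<le> prob (alive 1 (2 ^ k))"
      using elim(1) unfolding 1 2 3 .
    then have "q ^ k * (inverse (q ^ k) * inverse (real k * ln 2)) \<le> u k"
      unfolding u_def using q by (intro mult_left_mono) auto
    moreover have "v * (inverse v * z) = z" if "0 < v" for v z :: real using that by simp
    ultimately have "inverse (real k * ln 2) \<le> u k" using q by simp
    then have "ln 2 * inverse (real k * ln 2) \<le> ln 2 * u k" by (rule mult_left_mono) simp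
    moreover have "ln 2 * inverse (real k * ln 2) = norm (inverse (real k))"
      using elim(2) by (simp add: field_simps)
    ultimately show ?case by (simp only:)
  qed
  then have "summable (\<lambda>k. inverse (real k))"
    using summable_mult [OF su, of "ln 2"] by (rule summable_comparison_test_ev)
  then show False using not_summable_harmonic [where 'a = real] by (simp add: inverse_eq_divide)
qed

lemma moment_finite:
  assumes up: "\<forall>\<^sub>F x in at_top. prob (alive 1 (nat \<lceil>x\<rceil>)) \<le> x powr (- a) * ln x powr d" and b: "b < a"
  shows "(\<integral>\<^sup>+w. enat_powr (exc_length X 1 w) b \<partial>M) < \<infinity>"
proof -
  have AM: "alive 1 (2 ^ k) \<in> sets M" for k by (intro alive_M) auto
  have ae: "AE w in M. exc_length X 1 w \<noteq> \<infinity>"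
    using recurrent
  proof eventually_elim
    case (elim w)
    then have "\<exists>t>1. X t w = 0" by blast
    then show ?case by (auto simp: exc_length_def)
  qed
  show ?thesis
  proof (cases "0 \<le> b")
    case False
    have "(\<integral>\<^sup>+w. enat_powr (exc_length X 1 w) b \<partial>M) \<le> (\<integral>\<^sup>+w. 1 \<partial>M)"
    proof (rule nn_integral_mono_AE, use ae in eventually_elim)
      case (elim w)
      then obtain m where m: "exc_length X 1 w = enat m" by auto
      have "real m powr b \<le> 1"
      proof (cases "m = 0")
        case mpos: False
        have "real m powr b \<le> real m powr 0" using mpos False by (intro powr_mono) auto
        then show ?thesis using mpos by simp
      qed simp
      then show ?case using m by (simp add: enat_powr_def)
    qed
    also have "\<dots> < \<infinity>" by (simp add: emeasure_space_1)
    finally show ?thesis .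
  next
    case b0: True
    define q where "q = 2 powr b"
    have q: "q \<ge> 1" using b0 by (simp add: q_def ge_one_powr_ge_zero)
    define u where "u k = q ^ k * prob (alive 1 (2 ^ k))" for k
    have u0: "0 \<le> u k" for k using q by (simp add: u_def)
    have lim: "filterlim (\<lambda>k. (2::real) ^ k) at_top sequentially" by real_asymp
    define rho where "rho = 2 powr (- ((a - b) / 2))"
    have rho: "0 < rho" "rho < 1" using b by (auto simp: rho_def powr_less_one)
    have growth: "\<forall>\<^sub>F k in sequentially. (real k * ln 2) powr d \<le> 2 powr (real k * ((a - b) / 2))"
    proof -
      define h where "h = (a - b) / 2"
      have "0 < h" using b by (simp add: h_def)
      then show ?thesis unfolding h_def [symmetric] by real_asymp
    qed
    have "\<forall>\<^sub>F k in sequentially. norm (u k) \<le> rho ^ k"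
      using eventually_compose_filterlim [OF up lim] growth
    proof eventually_elim
      case (elim k)
      have 1: "nat \<lceil>(2::real) ^ k\<rceil> = 2 ^ k"
        by (metis ceiling_of_nat nat_int of_nat_numeral of_nat_power)
      have 2: "ln ((2::real) ^ k) = real k * ln 2" by (simp add: ln_realpow)
      have "prob (alive 1 (2 ^ k)) \<le> (2 powr (- a)) ^ k * (real k * ln 2) powr d"
        using elim(1) unfolding 1 2 two_power_powr .
      also have "\<dots> \<le> (2 powr (- a)) ^ k * 2 powr (real k * ((a - b) / 2))"
        using elim(2) by (intro mult_left_mono) auto
      also have "2 powr (real k * ((a - b) / 2)) = (2 powr ((a - b) / 2)) ^ k"
        by (subst powr_realpow [symmetric]) (simp_all add: powr_powr mult.commute)
      finally have "u k \<le> q ^ k * ((2 powr (- a)) ^ k * (2 powr ((a - b) / 2)) ^ k)"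
        unfolding u_def using q by (intro mult_left_mono) auto
      also have "\<dots> = (2 powr b * (2 powr (- a) * 2 powr ((a - b) / 2))) ^ k"
        by (simp add: q_def power_mult_distrib)
      also have "2 powr b * (2 powr (- a) * 2 powr ((a - b) / 2)) = rho"
      proof -
        have "b + (- a + (a - b) / 2) = - ((a - b) / 2)" by (simp add: field_simps)
        then show ?thesis unfolding powr_add [symmetric] rho_def by (rule arg_cong)
      qed
      finally show ?case using u0 [of k] by simp
    qed
    then have "summable u" using rho by (intro summable_comparison_test_ev [OF _ summable_geometric]) auto
    then have su: "summable (\<lambda>k. q * u k)" by (rule summable_mult)
    have "(\<integral>\<^sup>+w. enat_powr (exc_length X 1 w) b \<partial>M) \<le>
        (\<integral>\<^sup>+w. (\<Sum>k. ennreal (q * q ^ k) * indicator (alive 1 (2 ^ k)) w) \<partial>M)"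
    proof (rule nn_integral_mono_AE, use ae AE_space in eventually_elim)
      case (elim w)
      then obtain m where m: "exc_length X 1 w = enat m" by auto
      show ?case
      proof (cases "m = 0")
        case False
        then obtain k where k: "2 ^ k \<le> m" "m < 2 ^ Suc k" using dyadic_bracket [of m] by auto
        have "real m \<le> real (2 ^ Suc k)" using k by (intro of_nat_mono) auto
        then have "real m powr b \<le> (2 ^ Suc k) powr b" using b0 by (intro powr_mono2) auto
        also have "\<dots> = q * q ^ k" unfolding two_power_powr q_def by simp
        finally have le: "real m powr b \<le> q * q ^ k" .
        have "w \<in> alive 1 (2 ^ k)" using alive_power_iff [OF elim(2) m] k by blast
        then have "enat_powr (exc_length X 1 w) b \<le> ennreal (q * q ^ k) * indicator (alive 1 (2 ^ k)) w"
          using m le by (simp add: enat_powr_def ennreal_leI)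
        also have "\<dots> \<le> (\<Sum>k. ennreal (q * q ^ k) * indicator (alive 1 (2 ^ k)) w)"
        proof -
          have "f k \<le> suminf f" for f :: "nat \<Rightarrow> ennreal" using sum_le_suminf [of f "{k}"] by simp
          then show ?thesis .
        qed
        finally show ?thesis .
      qed (use m in \<open>simp add: enat_powr_def\<close>)
    qed
    also have "\<dots> = (\<Sum>k. \<integral>\<^sup>+w. ennreal (q * q ^ k) * indicator (alive 1 (2 ^ k)) w \<partial>M)"
      using AM by (intro nn_integral_suminf) auto
    also have "\<dots> = (\<Sum>k. ennreal (q * u k))"
    proof (rule suminf_cong)
      fix k
      have "(\<integral>\<^sup>+w. ennreal (q * q ^ k) * indicator (alive 1 (2 ^ k)) w \<partial>M) = ennreal (q * q ^ k) * emeasure M (alive 1 (2 ^ k))"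
        using AM by (simp add: nn_integral_cmult_indicator)
      also have "\<dots> = ennreal (q * u k)"
        using q by (simp add: u_def emeasure_eq_measure ennreal_mult [symmetric] mult.assoc)
      finally show "(\<integral>\<^sup>+w. ennreal (q * q ^ k) * indicator (alive 1 (2 ^ k)) w \<partial>M) = ennreal (q * u k)" .
    qed
    also have "\<dots> = ennreal (\<Sum>k. q * u k)" using u0 q su by (intro suminf_ennreal2) auto
    also have "\<dots> < \<infinity>" by simp
    finally show ?thesis .
  qed
qed

end

theorem theorem2p4:
  fixes M :: "'a measure" and F :: "nat \<Rightarrow> 'a measure" and X :: "nat \<Rightarrow> 'a \<Rightarrow> real"
    and S :: "real set" and c s2 r p :: real
  assumes prob: "prob_space M"
    \<comment> \<open>(A0)\<close>
    and S_nonneg: "S \<subseteq> {0..}" and S_zero: "0 \<in> S"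
    and S_locfin: "\<forall>b. finite (S \<inter> {..b})" and S_unbdd: "\<not> bdd_above S"
    and filt_sub: "\<forall>t\<ge>1. subalgebra M (F t)"
    and filt_mono: "\<forall>s t. 1 \<le> s \<and> s \<le> t \<longrightarrow> sets (F s) \<subseteq> sets (F t)"
    and adapted: "\<forall>t\<ge>1. X t \<in> borel_measurable (F t)"
    and X_in_S: "\<forall>t\<ge>1. \<forall>\<omega>\<in>space M. X t \<omega> \<in> S"
    and start: "AE \<omega> in M. X 1 \<omega> = 0"
    \<comment> \<open>(A1)\<close>
    and A1: "\<exists>(m :: real \<Rightarrow> real \<Rightarrow> nat) (\<phi> :: real \<Rightarrow> real \<Rightarrow> real).
              (\<forall>x\<in>S. \<forall>y\<in>S. 1 \<le> m x y \<and> 0 < \<phi> x y) \<and>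
              (\<forall>y\<in>S. \<forall>t\<ge>1. AE \<omega> in M.
                 real_cond_exp M (F t)
                   (indicator {\<omega>'\<in>space M. X (t + m (X t \<omega>') y) \<omega>' = y}) \<omega>
                 \<ge> \<phi> (X t \<omega>) y)"
    \<comment> \<open>(A2)\<close>
    and s2_pos: "0 < s2"
    and A2_mean: "\<forall>e>0. \<exists>x0. \<forall>t\<ge>1. AE \<omega> in M. X t \<omega> \<ge> x0 \<longrightarrow>
              \<bar>real_cond_exp M (F t) (incr X t) \<omega> - c / X t \<omega>\<bar>
                \<le> e / (X t \<omega> * ln (X t \<omega>))"
    and A2_var: "\<forall>e>0. \<exists>x0. \<forall>t\<ge>1. AE \<omega> in M. X t \<omega> \<ge> x0 \<longrightarrow>
              \<bar>real_cond_exp M (F t) (\<lambda>\<omega>'. (incr X t \<omega>')\<^sup>2) \<omega> - s2\<bar>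
                \<le> e / ln (X t \<omega>)"
    and r_def: "r = - 2 * c / s2"
    \<comment> \<open>(A3)\<close>
    and A3a: "emeasure M (N_infinite X M) > 0 \<longrightarrow>
              prob_space.indep_vars (uniform_measure M (N_infinite X M))
                 (\<lambda>_. count_space UNIV) (excursion X) {1..} \<and>
              (\<forall>n\<ge>1. distr (uniform_measure M (N_infinite X M)) (count_space UNIV) (excursion X n)
                    = distr (uniform_measure M (N_infinite X M)) (count_space UNIV) (excursion X 1))"
    and A3b: "\<forall>n\<ge>1. cond_prob M (\<lambda>\<omega>. exc_length X (Suc n) \<omega> < \<infinity>) (\<lambda>\<omega>. ret_time X n \<omega> < \<infinity>)
                 = \<P>(\<omega> in M. exc_length X 1 \<omega> < \<infinity>)"
    \<comment> \<open>theorem hypotheses\<close>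
    and r_gt: "r > -1"
    and p_gt: "p > max 2 (1 + r)"
    and Mp: "\<exists>\<delta>>0. \<exists>C::real. \<forall>t\<ge>1. AE \<omega> in M.
              nn_cond_exp M (F t) (\<lambda>\<omega>'. ennreal (\<bar>incr X t \<omega>'\<bar> powr p)) \<omega>
                \<le> ennreal (C * (1 + X t \<omega>) powr (p - 2 - \<delta>))"
  shows "(\<forall>\<epsilon>>0. \<forall>\<^sub>F x in at_top.
            x powr (- (1 + r) / 2) * ln x powr (- \<epsilon>)
              \<le> \<P>(\<omega> in M. ereal x \<le> ereal_of_enat (exc_length X 1 \<omega>)) \<and>
            \<P>(\<omega> in M. ereal x \<le> ereal_of_enat (exc_length X 1 \<omega>))
              \<le> x powr (- (1 + r) / 2) * ln x powr (2 + r + \<epsilon>))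
         \<and> (\<integral>\<^sup>+ \<omega>. enat_powr (exc_length X 1 \<omega>) ((1 + r) / 2) \<partial>M) = \<infinity>
         \<and> (\<forall>\<epsilon>>0. (\<integral>\<^sup>+ \<omega>. enat_powr (exc_length X 1 \<omega>) ((1 + r) / 2 - \<epsilon>) \<partial>M) < \<infinity>)"
proof -
  obtain m \<phi> where m: "\<forall>x\<in>S. \<forall>y\<in>S. 1 \<le> m x y \<and> 0 < \<phi> x y"
    and hit: "\<forall>y\<in>S. \<forall>t\<ge>1. AE \<omega> in M. real_cond_exp M (F t)
        (indicator {\<omega>'\<in>space M. X (t + m (X t \<omega>') y) \<omega>' = y}) \<omega> \<ge> \<phi> (X t \<omega>) y"
    using A1 by blast
  obtain \<delta> C where \<delta>: "\<delta> > 0" and Mp': "\<forall>t\<ge>1. AE \<omega> in M.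
      nn_cond_exp M (F t) (\<lambda>\<omega>'. ennreal (\<bar>incr X t \<omega>'\<bar> powr p)) \<omega>
        \<le> ennreal (C * (1 + X t \<omega>) powr (p - 2 - \<delta>))"
    using Mp by blast
  have c: "c = - r * s2 / 2" using r_def s2_pos by (simp add: field_simps)
  interpret near_critical_process M F X S r s2 p "min \<delta> (p - 2)" "max C 0" m \<phi>
  proof (rule near_critical_process.intro [OF prob], rule near_critical_process_axioms.intro)
    fix t :: nat assume t: "1 \<le> t"
    show "AE w in M. nn_cond_exp M (F t) (\<lambda>w. ennreal (\<bar>incr X t w\<bar> powr p)) w
        \<le> ennreal (max C 0 * (1 + X t w) powr (p - 2 - min \<delta> (p - 2)))"
      using Mp' [rule_format, OF t] AE_space
    proof eventually_elim
      case (elim w)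
      have "0 \<le> X t w" using X_in_S t elim(2) S_nonneg by fastforce
      then have "(1 + X t w) powr (p - 2 - \<delta>) \<le> (1 + X t w) powr (p - 2 - min \<delta> (p - 2))"
        by (intro powr_mono) auto
      then have "C * (1 + X t w) powr (p - 2 - \<delta>) \<le> max C 0 * (1 + X t w) powr (p - 2 - min \<delta> (p - 2))"
        by (intro mult_mono) auto
      then show ?case using elim(1) by (meson ennreal_leI order_trans)
    qed
  next
    fix e :: real assume "0 < e"
    then show "\<exists>x0. \<forall>t\<ge>1. AE w in M. x0 \<le> X t w \<longrightarrow>
        \<bar>real_cond_exp M (F t) (incr X t) w - (- r * s2 / 2) / X t w\<bar> \<le> e / (X t w * ln (X t w))"
      using A2_mean unfolding c by blast
  next
    fix e :: real assume "0 < e"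
    then show "\<exists>x0. \<forall>t\<ge>1. AE w in M. x0 \<le> X t w \<longrightarrow>
        \<bar>real_cond_exp M (F t) (\<lambda>w. (incr X t w)\<^sup>2) w - s2\<bar> \<le> e / ln (X t w)"
      using A2_var by blast
  qed (use S_nonneg S_zero S_locfin S_unbdd filt_sub filt_mono adapted X_in_S start m hit s2_pos r_gt p_gt \<delta> in auto)
  note reach = reach_high_levels [OF A3a]
  define a where "a = (1 + r) / 2"
  have a: "0 < a" using r_gt by (simp add: a_def)
  have ma: "- (1 + r) / 2 = - a" by (simp only: a_def minus_divide_left)
  have tails: "\<forall>\<^sub>F x in at_top. x powr (- a) * ln x powr (- \<epsilon>) \<le> \<P>(\<omega> in M. ereal x \<le> ereal_of_enat (exc_length X 1 \<omega>)) \<and>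
      \<P>(\<omega> in M. ereal x \<le> ereal_of_enat (exc_length X 1 \<omega>)) \<le> x powr (- a) * ln x powr (2 + r + \<epsilon>)"
    if "0 < \<epsilon>" for \<epsilon>
    using lower_tail [OF that reach] upper_tail [OF that] eventually_ge_at_top [of 1]
    unfolding ma by eventually_elim (simp only: tail_event_eq)
  have one: "(0::real) < 1" by simp
  have "(\<integral>\<^sup>+ \<omega>. enat_powr (exc_length X 1 \<omega>) a \<partial>M) = \<infinity>"
    by (rule moment_infinite [OF a lower_tail [OF one reach, unfolded ma]])
  moreover have "(\<integral>\<^sup>+ \<omega>. enat_powr (exc_length X 1 \<omega>) (a - \<epsilon>) \<partial>M) < \<infinity>" if "0 < \<epsilon>" for \<epsilon>
    by (rule moment_finite [OF upper_tail [OF one, unfolded ma]]) (use that in simp)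
  ultimately show ?thesis using tails unfolding ma a_def [symmetric] by blast
qed

end
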